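(* Let $\{X_t\}_{t\ge 0}$ be a $d$-dimensional super-Brownian motion started from $X_0=\delta_0$ with branching mechanism $$\psi(u)=-\beta u+\alpha u^2+\int_0^\infty\left(e^{-uy}-1+uy\right)n(dy),\qquad u\ge 0,$$ where $\beta>0$, $\alpha>0$, and $n$ is a $\sigma$-finite measure on $(0,\infty)$ with $\int_0^\infty (y^2\wedge y)\,n(dy)<\infty$. Assume moreover that there exists $\gamma>0$ such that $$\int_1^\infty y(\log y)^{2+\gamma}\,n(dy)<\infty.$$ Let $R_t:=\inf\{r>0: X_s(\{x\in\mathbb{R}^d:|x|\ge r\})=0 \text{ for all } 0\le s\le t\}$. Then for every $\rho\in(\sqrt{2\beta},\infty)$, $$\lim_{t\to\infty}\frac{1}{t}\log\mathbb{P}(R_t\ge \rho t)=-\left(\frac{\rho^2}{2}-\beta\right).$$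
   Context: $M_F(\mathbb{R}^d)$ denotes the space of finite Borel measures on $\mathbb{R}^d$, and $\nu(f):=\int f\,d\nu$. The super-Brownian motion with branching mechanism $\psi$ is the $M_F(\mathbb{R}^d)$-valued Markov process whose law $\mathbb{P}_\mu$ started from $\mu$ is characterized by: for every positive bounded function $g$ on $\mathbb{R}^d$, $\mathbb{E}_\mu[e^{-X_t(g)}]=e^{-\mu(v(t,\cdot))}$, where $v$ is the unique locally bounded positive solution of $\partial_t v=\frac12\Delta v-\psi(v)$, $v(0,x)=g(x)$. Here $\mathbb{P}=\mathbb{P}_{\delta_0}$. *)

theory Defs
  imports "HOL-Probability.Probability"
begin

definition psi :: "real \<Rightarrow> real \<Rightarrow> real measure \<Rightarrow> real \<Rightarrow> real" where
  "psi \<beta> \<alpha> n u = - \<beta> * u + \<alpha> * u\<^sup>2 + (\<integral>y. (exp (- u * y) - 1 + u * y) \<partial>n)"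

definition heat_sg :: "real \<Rightarrow> ('a::euclidean_space \<Rightarrow> real) \<Rightarrow> 'a \<Rightarrow> real" where
  "heat_sg t f x = (if t = 0 then f x else
     (\<integral>y. (2 * pi * t) powr (- real DIM('a) / 2) * exp (- (norm (x - y))\<^sup>2 / (2 * t)) * f y \<partial>lborel))"

definition pos_bdd :: "('a::euclidean_space \<Rightarrow> real) \<Rightarrow> bool" where
  "pos_bdd f \<longleftrightarrow> f \<in> borel_measurable borel \<and> (\<forall>x. 0 \<le> f x) \<and> bounded (range f)"

text \<open>v is a locally bounded positive (mild) solution of
  d/dt v = (1/2) Laplacian v - psi(v), v(0,.) = g.\<close>
definition sbm_sol :: "real \<Rightarrow> real \<Rightarrow> real measure \<Rightarrow> ('a::euclidean_space \<Rightarrow> real)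
    \<Rightarrow> (real \<Rightarrow> 'a \<Rightarrow> real) \<Rightarrow> bool" where
  "sbm_sol \<beta> \<alpha> n g v \<longleftrightarrow>
     (\<lambda>p. v (fst p) (snd p)) \<in> borel_measurable borel \<and>
     (\<forall>t x. 0 \<le> t \<longrightarrow> 0 \<le> v t x) \<and>
     (\<forall>T. \<exists>C. \<forall>t\<in>{0..T}. \<forall>x. \<bar>v t x\<bar> \<le> C) \<and>
     (\<forall>t x. 0 \<le> t \<longrightarrow>
        v t x = heat_sg t g x - (LBINT s=0..t. heat_sg (t - s) (\<lambda>y. psi \<beta> \<alpha> n (v s y)) x))"

text \<open>X is (a right-continuous realization of) super-Brownian motion with branching
  mechanism psi, started from delta_0, on the probability space M.  The Markov property
  is expressed through the Laplace functional: for r_i <= s,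
  E[exp(-sum X_{r_i}(h_i)) exp(-X_{s+t}(g))] = E[exp(-sum X_{r_i}(h_i)) exp(-X_s(v(t,.)))].\<close>
definition super_BM :: "'w measure \<Rightarrow> (real \<Rightarrow> 'w \<Rightarrow> 'a::euclidean_space measure)
    \<Rightarrow> real \<Rightarrow> real \<Rightarrow> real measure \<Rightarrow> bool" where
  "super_BM M X \<beta> \<alpha> n \<longleftrightarrow>
     prob_space M \<and>
     (\<forall>s \<omega>. 0 \<le> s \<longrightarrow> sets (X s \<omega>) = sets borel \<and> finite_measure (X s \<omega>)) \<and>
     (\<forall>\<omega>\<in>space M. X 0 \<omega> = return borel 0) \<and>
     (\<forall>s f. 0 \<le> s \<longrightarrow> pos_bdd f \<longrightarrow> (\<lambda>\<omega>. \<integral>x. f x \<partial>(X s \<omega>)) \<in> borel_measurable M) \<and>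
     (\<forall>\<omega>\<in>space M. \<forall>t\<ge>0. \<forall>f::'a \<Rightarrow> real. continuous_on UNIV f \<and> bounded (range f) \<longrightarrow>
        ((\<lambda>s. \<integral>x. f x \<partial>(X s \<omega>)) \<longlongrightarrow> (\<integral>x. f x \<partial>(X t \<omega>))) (at_right t)) \<and>
     (\<forall>s t g v (k::nat) r h. 0 \<le> s \<longrightarrow> 0 \<le> t \<longrightarrow> pos_bdd g \<longrightarrow> sbm_sol \<beta> \<alpha> n g v \<longrightarrow>
        (\<forall>i<k. 0 \<le> r i \<and> r i \<le> s \<and> pos_bdd (h i)) \<longrightarrow>
        (\<integral>\<omega>. exp (- (\<Sum>i<k. \<integral>x. h i x \<partial>(X (r i) \<omega>))) * exp (- (\<integral>x. g x \<partial>(X (s + t) \<omega>))) \<partial>M)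
        = (\<integral>\<omega>. exp (- (\<Sum>i<k. \<integral>x. h i x \<partial>(X (r i) \<omega>))) * exp (- (\<integral>x. v t x \<partial>(X s \<omega>))) \<partial>M))"

definition radius :: "(real \<Rightarrow> 'w \<Rightarrow> 'a::euclidean_space measure) \<Rightarrow> real \<Rightarrow> 'w \<Rightarrow> ereal" where
  "radius X t \<omega> = Inf {ereal r | r. 0 < r \<and> (\<forall>s\<in>{0..t}. measure (X s \<omega>) {x. norm x \<ge> r} = 0)}"

end

theory Submission
  imports Defs "HOL-Real_Asymp.Real_Asymp"
begin

text \<open>
  Everything is reduced to one space dimension: for a unit vector e, a mild solution v of the
  one-dimensional equation yields the solution v(t, x \<open>\<bullet>\<close> e) in d dimensions, because the Gaussian
  kernel is rotation invariant. Mild solutions between a classical sub- and supersolution are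
  obtained by monotone iteration, so only explicit barriers are needed.

  Lower bound: a bump moving with speed \<open>\<rho>\<close>, of height \<open>exp ((\<beta> - \<rho>\<^sup>2 / 2 - \<epsilon>) t)\<close> after time t, is a
  subsolution, since \<open>\<psi>(u) \<le> (- \<beta> + \<eta>) u\<close> for small u; hence \<open>X\<^sub>t\<close> charges a slab around \<open>x \<bullet> e = \<rho> t\<close>
  with at least that probability.

  Upper bound: since \<open>\<psi>(u) \<ge> - \<beta> u + \<alpha> u\<^sup>2\<close>, the exponential \<open>exp (\<rho> (x - r) + (\<beta> + \<rho>\<^sup>2 / 2) t)\<close>, a solution
  of the linearised equation, can be turned near r into a supersolution that is infinite beyond r.
  It controls the probability that mass is ever seen in the half space \<open>x \<bullet> e > r\<close>, first on
  dyadic time grids and then, by right continuity, at all times. Finitely many half spaces cover the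
  complement of a ball.
\<close>

text \<open>The Laplace identity in \<open>super_BM\<close> holds for every mild solution, so one
  solution squeezed between two barriers already bounds a probability. \<psi> is not monotone, but u
  -> c u - \<psi>(u) is increasing on a bounded range for large c; hence the iteration runs on a
  Duhamel formula with killing rate c, which is removed at the end.

  The lower bound uses the process at time t alone. The upper bound has to watch all of [0, t], and
  positivity of mass is detected only by letting a weight \<theta> tend to infinity. So the barrier
  must admit arbitrarily large data beyond r without growing at the origin. The reciprocal form 1 /
  (c + q) achieves this: decreasing c raises the plateau 1 / c beyond r, while the value at the
  origin stays below 1 / q. The term \<alpha> u^2 pays for the bending near r.

  A tilt \<lambda> and r = \<rho> t give the exponent (\<beta> + \<lambda>^2 / 2) t - \<lambda>
  \<rho> t at the origin; it is minimal at \<lambda> = \<rho>, which is why the tilt of both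
  barriers equals the speed.\<close>

section \<open>The Gaussian semigroup and the reduction to one dimension\<close>

abbreviation std_gauss :: "real measure" where
  "std_gauss \<equiv> density lborel std_normal_density"

text \<open>All times live on the single probability space \<open>std_gauss\<close>, so varying t
  changes only the integrand, and t = 0 is the identity without a case distinction.\<close>

definition bm_sg :: "real \<Rightarrow> (real \<Rightarrow> real) \<Rightarrow> real \<Rightarrow> real" where
  "bm_sg t f x = (\<integral>z. f (x + sqrt t * z) \<partial>std_gauss)"

interpretation gauss: prob_space std_gauss
  by (rule prob_space_normal_density) simp

lemma measure_std_gauss_UNIV [simp]: "measure std_gauss UNIV = 1"
  using gauss.prob_space by simp

lemma density_normal_eq_distr:
  assumes "0 < \<sigma>"
  shows "density lborel (normal_density \<mu> \<sigma>) = distr std_gauss borel (\<lambda>z. \<mu> + \<sigma> * z)"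
proof -
  have "distributed std_gauss lborel (\<lambda>x. x) std_normal_density"
    by (auto simp: distributed_def distr_id2)
  from gauss.normal_density_affine[OF this, of \<sigma> \<mu>] assms
  have "distributed std_gauss lborel (\<lambda>x. \<mu> + \<sigma> * x) (normal_density \<mu> \<sigma>)"
    by simp
  then show ?thesis
    by (simp add: distributed_def cong: distr_cong)
qed

lemma integral_normal_eq_bm_sg:
  assumes "0 < t" and [measurable]: "f \<in> borel_measurable borel"
  shows "(\<integral>y. f y \<partial>density lborel (normal_density x (sqrt t))) = bm_sg t f x"
  unfolding bm_sg_def using assms(1)
  by (subst density_normal_eq_distr) (auto simp: integral_distr)

text \<open>Turns the heat kernel, a product of one-dimensional normal densities, into the law of
  independent normal coordinates. Boxes determine a finite product measure, and on a box the
  integral factorises.\<close>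

lemma density_PiM_eq_PiM_density:
  fixes p :: "'i \<Rightarrow> real \<Rightarrow> real"
  assumes I: "finite I" and p: "\<And>i. p i \<in> borel_measurable borel"
    and prob: "\<And>i. prob_space (density lborel (p i))"
  shows "density (\<Pi>\<^sub>M i\<in>I. lborel) (\<lambda>\<omega>. \<Prod>i\<in>I. ennreal (p i (\<omega> i)))
    = (\<Pi>\<^sub>M i\<in>I. density lborel (p i))"
proof -
  interpret D: product_sigma_finite "\<lambda>i. density lborel (p i)"
    by (auto simp: product_sigma_finite_def intro!: prob_space_imp_sigma_finite prob)
  interpret L: product_sigma_finite "\<lambda>_::'i. lborel::real measure"
    by (auto simp: product_sigma_finite_def intro!: lborel.sigma_finite_measure_axioms)
  note p[measurable]
  show ?thesis
  proof (rule D.PiM_eqI[OF I])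
    show "sets (density (\<Pi>\<^sub>M i\<in>I. lborel) (\<lambda>\<omega>. \<Prod>i\<in>I. ennreal (p i (\<omega> i)))) =
      sets (\<Pi>\<^sub>M i\<in>I. density lborel (p i))"
      by (simp cong: sets_PiM_cong)
  next
    fix A assume A: "\<And>i. i \<in> I \<Longrightarrow> A i \<in> sets (density lborel (p i))"
    have B: "Pi\<^sub>E I A \<in> sets (\<Pi>\<^sub>M i\<in>I. lborel)"
      using A I by (intro sets_PiM_I_finite) auto
    have "emeasure (density (\<Pi>\<^sub>M i\<in>I. lborel) (\<lambda>\<omega>. \<Prod>i\<in>I. ennreal (p i (\<omega> i)))) (Pi\<^sub>E I A)
      = (\<integral>\<^sup>+\<omega>. (\<Prod>i\<in>I. ennreal (p i (\<omega> i))) * indicator (Pi\<^sub>E I A) \<omega> \<partial>(\<Pi>\<^sub>M i\<in>I. lborel))"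
      using B by (intro emeasure_density) auto
    also have "\<dots> = (\<integral>\<^sup>+\<omega>. (\<Prod>i\<in>I. ennreal (p i (\<omega> i)) * indicator (A i) (\<omega> i)) \<partial>(\<Pi>\<^sub>M i\<in>I. lborel))"
    proof (rule nn_integral_cong)
      fix \<omega> assume "\<omega> \<in> space (\<Pi>\<^sub>M i\<in>I. lborel :: real measure)"
      then have "indicator (Pi\<^sub>E I A) \<omega> = (\<Prod>i\<in>I. indicator (A i) (\<omega> i) :: ennreal)"
        using I by (auto simp: space_PiM PiE_iff indicator_def prod_zero_iff split: if_splits)
      then show "(\<Prod>i\<in>I. ennreal (p i (\<omega> i))) * indicator (Pi\<^sub>E I A) \<omega>
         = (\<Prod>i\<in>I. ennreal (p i (\<omega> i)) * indicator (A i) (\<omega> i))"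
        by (simp add: prod.distrib)
    qed
    also have "\<dots> = (\<Prod>i\<in>I. \<integral>\<^sup>+y. ennreal (p i y) * indicator (A i) y \<partial>lborel)"
      using A by (intro L.product_nn_integral_prod[OF I]) auto
    also have "\<dots> = (\<Prod>i\<in>I. emeasure (density lborel (p i)) (A i))"
      using A by (intro prod.cong refl) (simp add: emeasure_density)
    finally show "emeasure (density (\<Pi>\<^sub>M i\<in>I. lborel) (\<lambda>\<omega>. \<Prod>i\<in>I. ennreal (p i (\<omega> i)))) (Pi\<^sub>E I A)
      = (\<Prod>i\<in>I. emeasure (density lborel (p i)) (A i))" .
  qed
qed

lemma heat_kernel_eq_prod_normal_density:
  fixes x y :: "'a::euclidean_space"
  assumes "0 < t"
  shows "(2 * pi * t) powr (- real DIM('a) / 2) * exp (- (norm (x - y))\<^sup>2 / (2 * t))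
    = (\<Prod>b\<in>Basis. normal_density (x \<bullet> b) (sqrt t) (y \<bullet> b))"
proof -
  have n: "(norm (x - y))\<^sup>2 = (\<Sum>b\<in>Basis. (y \<bullet> b - x \<bullet> b)\<^sup>2)"
    unfolding power2_norm_eq_inner
    by (subst euclidean_inner) (simp add: inner_diff_left power2_eq_square algebra_simps)
  have "(\<Prod>b\<in>(Basis::'a set). normal_density (x \<bullet> b) (sqrt t) (y \<bullet> b))
    = (\<Prod>b\<in>(Basis::'a set). (2 * pi * t) powr (- 1/2) * exp (- (y \<bullet> b - x \<bullet> b)\<^sup>2 / (2 * t)))"
    using assms by (simp add: normal_density_def powr_minus_divide powr_half_sqrt)
  also have "\<dots> = ((2 * pi * t) powr (- 1/2)) ^ DIM('a) * exp (\<Sum>b\<in>(Basis::'a set). - (y \<bullet> b - x \<bullet> b)\<^sup>2 / (2 * t))"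
    by (simp add: prod.distrib exp_sum)
  also have "((2 * pi * t) powr (- 1/2)) ^ DIM('a) = (2 * pi * t) powr (- real DIM('a) / 2)"
    using assms by (simp add: powr_power)
  also have "(\<Sum>b\<in>(Basis::'a set). - (y \<bullet> b - x \<bullet> b)\<^sup>2 / (2 * t)) = - (norm (x - y))\<^sup>2 / (2 * t)"
    unfolding n by (simp add: sum_negf sum_divide_distrib[symmetric])
  finally show ?thesis by simp
qed

lemma bm_sg_0 [simp]: "f \<in> borel_measurable borel \<Longrightarrow> bm_sg 0 f x = f x"
  unfolding bm_sg_def by simp

text \<open>Under the heat kernel the coordinates are independent normals with means x \<bullet> b
  and variance t, so their combination with coefficients b \<bullet> e is normal with mean x
  \<bullet> e and variance t |e|^2 = t.\<close>

theorem heat_sg_inner: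
  fixes e x :: "'a::euclidean_space"
  assumes e: "norm e = 1" and t: "0 \<le> t" and f[measurable]: "f \<in> borel_measurable borel"
  shows "heat_sg t (\<lambda>y. f (y \<bullet> e)) x = bm_sg t f (x \<bullet> e)"
proof (cases "t = 0")
  case False
  with t have t: "0 < t" by simp
  define p where "p b = normal_density (x \<bullet> b) (sqrt t)" for b :: 'a
  have [measurable]: "p b \<in> borel_measurable borel" for b
    unfolding p_def by simp
  have prob_p: "prob_space (density lborel (p b))" for b
    unfolding p_def using t by (intro prob_space_normal_density) simp
  define N where "N = (\<Pi>\<^sub>M b\<in>(Basis::'a set). density lborel (p b))"
  have N_eq: "N = density (\<Pi>\<^sub>M b\<in>(Basis::'a set). lborel) (\<lambda>\<omega>. \<Prod>b\<in>Basis. ennreal (p b (\<omega> b)))"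
    unfolding N_def by (rule density_PiM_eq_PiM_density[symmetric]) (auto simp: prob_p)
  interpret N: prob_space N
    unfolding N_def by (intro prob_space_PiM prob_p)
  define S where "S \<omega> = (\<Sum>b\<in>(Basis::'a set). (b \<bullet> e) * \<omega> b)" for \<omega>
  have S_meas[measurable]: "S \<in> borel_measurable N"
    unfolding S_def N_def by measurable
  have 1: "heat_sg t (\<lambda>y. f (y \<bullet> e)) x = (\<integral>\<omega>. f (S \<omega>) \<partial>N)"
  proof -
    have pn: "p b y \<ge> 0" for b y by (simp add: p_def)
    have "heat_sg t (\<lambda>y. f (y \<bullet> e)) x = (\<integral>y. (\<Prod>b\<in>Basis. p b (y \<bullet> b)) * f (y \<bullet> e) \<partial>lborel)"
      using False t unfolding heat_sg_def p_def
      by (simp only: if_False heat_kernel_eq_prod_normal_density)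
    also have "\<dots> = (\<integral>\<omega>. (\<Prod>b\<in>Basis. p b (\<omega> b)) * f (S \<omega>) \<partial>(\<Pi>\<^sub>M b\<in>(Basis::'a set). lborel))"
      by (subst lborel_eq, subst integral_distr)
         (auto simp: S_def inner_sum_left mult.commute inner_Basis sum.delta if_distrib[where f = "(*) _"] cong: if_cong prod.cong)
    also have "\<dots> = (\<integral>\<omega>. f (S \<omega>) \<partial>density (\<Pi>\<^sub>M b\<in>(Basis::'a set). lborel) (\<lambda>\<omega>. ennreal (\<Prod>b\<in>Basis. p b (\<omega> b))))"
      by (subst integral_density) (auto intro!: prod_nonneg pn simp: S_def)
    also have "\<dots> = (\<integral>\<omega>. f (S \<omega>) \<partial>N)"
      unfolding N_eq by (simp add: prod_ennreal pn)
    finally show ?thesis .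
  qed
  have comp: "distr N (density lborel (p b)) (\<lambda>\<omega>. \<omega> b) = density lborel (p b)" if "b \<in> Basis" for b
    unfolding N_def by (intro distr_PiM_component prob_p finite_Basis that)
  have compb: "distr N borel (\<lambda>\<omega>. \<omega> b) = density lborel (p b)" if "b \<in> Basis" for b
    using comp[OF that] by (simp cong: distr_cong)
  have meas_comp: "(\<lambda>\<omega>. \<omega> b) \<in> borel_measurable N" if "b \<in> Basis" for b
    unfolding N_def using that by measurable
  have indep: "N.indep_vars (\<lambda>_. borel) (\<lambda>b \<omega>. \<omega> b) Basis"
  proof (subst N.indep_vars_iff_distr_eq_PiM')
    have "distr N (\<Pi>\<^sub>M b\<in>(Basis::'a set). borel) (\<lambda>\<omega>. \<lambda>b\<in>Basis. \<omega> b) = distr N N (\<lambda>\<omega>. \<omega>)"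
      by (intro distr_cong) (auto simp: N_def space_PiM PiE_iff extensional_restrict cong: sets_PiM_cong)
    also have "\<dots> = (\<Pi>\<^sub>M b\<in>Basis. distr N borel (\<lambda>\<omega>. \<omega> b))"
      by (simp add: N_def[symmetric] compb distr_id2 cong: PiM_cong)
    finally show "distr N (\<Pi>\<^sub>M b\<in>Basis. borel) (\<lambda>\<omega>. \<lambda>b\<in>Basis. \<omega> b) = (\<Pi>\<^sub>M b\<in>Basis. distr N borel (\<lambda>\<omega>. \<omega> b))" .
  qed (auto intro: meas_comp)
  \<comment> \<open>Degenerate summands are dropped: the rule for sums of independent normals asks
    for positive standard deviations.\<close>
  define I where "I = {b\<in>(Basis::'a set). b \<bullet> e \<noteq> 0}"
  have I: "finite I" "I \<subseteq> Basis" by (auto simp: I_def)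
  have sq: "(\<Sum>b\<in>I. (b \<bullet> e)\<^sup>2) = 1"
  proof -
    have "(\<Sum>b\<in>I. (b \<bullet> e)\<^sup>2) = (\<Sum>b\<in>Basis. (e \<bullet> b) * (e \<bullet> b))"
      unfolding I_def by (rule sum.mono_neutral_cong_left) (auto simp: power2_eq_square inner_commute)
    also have "\<dots> = 1"
      using e by (simp add: euclidean_inner[symmetric] power2_norm_eq_inner[symmetric])
    finally show ?thesis .
  qed
  then have "I \<noteq> {}" by auto
  have "distributed N lborel (\<lambda>\<omega>. \<Sum>b\<in>I. (b \<bullet> e) * \<omega> b)
     (normal_density (\<Sum>b\<in>I. (b \<bullet> e) * (x \<bullet> b)) (sqrt (\<Sum>b\<in>I. (\<bar>b \<bullet> e\<bar> * sqrt t)\<^sup>2)))"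
  proof (rule N.sum_indep_normal[OF I(1) \<open>I \<noteq> {}\<close>])
    have "N.indep_vars (\<lambda>_. borel) (\<lambda>b \<omega>. \<omega> b) I"
      using indep I(2) by (rule N.indep_vars_subset)
    then show "N.indep_vars (\<lambda>i. borel) (\<lambda>b \<omega>. (b \<bullet> e) * \<omega> b) I"
      by (rule N.indep_vars_compose2) measurable
  next
    fix b assume b: "b \<in> I"
    then show "0 < \<bar>b \<bullet> e\<bar> * sqrt t" using t by (auto simp: I_def)
    from b have bB: "b \<in> Basis" by (auto simp: I_def)
    have "distributed N lborel (\<lambda>\<omega>. \<omega> b) (normal_density (x \<bullet> b) (sqrt t))"
      using compb[OF bB] meas_comp[OF bB] by (auto simp: distributed_def p_def cong: distr_cong)
    from N.normal_density_affine[OF this, of "b \<bullet> e" 0] b t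
    show "distributed N lborel (\<lambda>\<omega>. (b \<bullet> e) * \<omega> b) (normal_density ((b \<bullet> e) * (x \<bullet> b)) (\<bar>b \<bullet> e\<bar> * sqrt t))"
      by (simp add: I_def)
  qed
  moreover have "(\<Sum>b\<in>I. (b \<bullet> e) * \<omega> b) = S \<omega>" for \<omega>
    unfolding S_def I_def by (rule sum.mono_neutral_left) auto
  moreover have "(\<Sum>b\<in>I. (b \<bullet> e) * (x \<bullet> b)) = x \<bullet> e"
  proof -
    have "(\<Sum>b\<in>I. (b \<bullet> e) * (x \<bullet> b)) = (\<Sum>b\<in>Basis. (x \<bullet> b) * (e \<bullet> b))"
      unfolding I_def by (rule sum.mono_neutral_cong_left) (auto simp: inner_commute)
    then show ?thesis by (simp add: euclidean_inner[symmetric])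
  qed
  moreover have "(\<Sum>b\<in>I. (\<bar>b \<bullet> e\<bar> * sqrt t)\<^sup>2) = t"
    using t by (simp add: power_mult_distrib sum_distrib_right[symmetric] sq)
  ultimately have "distributed N lborel S (normal_density (x \<bullet> e) (sqrt t))"
    by simp
  then have "distr N borel S = density lborel (normal_density (x \<bullet> e) (sqrt t))"
    by (simp add: distributed_def cong: distr_cong)
  then have "(\<integral>\<omega>. f (S \<omega>) \<partial>N) = bm_sg t f (x \<bullet> e)"
    using t integral_distr[OF S_meas f] by (simp add: integral_normal_eq_bm_sg[symmetric])
  with 1 show ?thesis by simp
qed (simp add: heat_sg_def)

section \<open>Order, linearity and the semigroup property\<close>

lemma bm_sg_measurable [measurable]:
  assumes [measurable]: "(\<lambda>(a, y). f a y) \<in> borel_measurable (N \<Otimes>\<^sub>M borel)"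
    "t \<in> borel_measurable N" "x \<in> borel_measurable N"
  shows "(\<lambda>a. bm_sg (t a) (f a) (x a)) \<in> borel_measurable N"
  unfolding bm_sg_def by measurable

lemma bm_sg_borel [measurable]:
  assumes [measurable]: "f \<in> borel_measurable borel"
  shows "bm_sg t f \<in> borel_measurable borel"
  unfolding bm_sg_def[abs_def] by measurable

lemma integrable_std_gauss_bounded:
  fixes f :: "real \<Rightarrow> real"
  assumes "f \<in> borel_measurable borel" "\<And>x. \<bar>f x\<bar> \<le> B"
  shows "integrable std_gauss f"
  using assms by (intro gauss.integrable_const_bound[where B = B]) auto

lemma bm_sg_mono:
  assumes "f \<in> borel_measurable borel" "\<And>x. \<bar>f x\<bar> \<le> B"
    and "g \<in> borel_measurable borel" "\<And>x. \<bar>g x\<bar> \<le> B"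
    and "\<And>x. f x \<le> g x"
  shows "bm_sg t f x \<le> bm_sg t g x"
  unfolding bm_sg_def using assms
  by (intro integral_mono integrable_std_gauss_bounded[where B = B]) auto

lemma bm_sg_const [simp]: "bm_sg t (\<lambda>_. c) x = c"
  unfolding bm_sg_def by simp

lemma bm_sg_abs_le:
  assumes "f \<in> borel_measurable borel" "\<And>x. \<bar>f x\<bar> \<le> B"
  shows "\<bar>bm_sg t f x\<bar> \<le> B"
proof -
  have "0 \<le> B" using assms(2)[of 0] by linarith
  have "bm_sg t f x \<le> bm_sg t (\<lambda>_. B) x" "bm_sg t (\<lambda>_. -B) x \<le> bm_sg t f x"
    using assms \<open>0 \<le> B\<close> by (intro bm_sg_mono[where B = B]; fastforce simp: abs_le_iff minus_le_iff)+
  then show ?thesis by simp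
qed

lemma bm_sg_diff:
  assumes "f \<in> borel_measurable borel" "\<And>x. \<bar>f x\<bar> \<le> B"
    and "g \<in> borel_measurable borel" "\<And>x. \<bar>g x\<bar> \<le> C"
  shows "bm_sg t (\<lambda>y. f y - g y) x = bm_sg t f x - bm_sg t g x"
  unfolding bm_sg_def using assms
  by (intro Bochner_Integration.integral_diff integrable_std_gauss_bounded[where B = B] integrable_std_gauss_bounded[where B = C]) auto

lemma bm_sg_add:
  assumes "f \<in> borel_measurable borel" "\<And>x. \<bar>f x\<bar> \<le> B"
    and "g \<in> borel_measurable borel" "\<And>x. \<bar>g x\<bar> \<le> C"
  shows "bm_sg t (\<lambda>y. f y + g y) x = bm_sg t f x + bm_sg t g x"
  unfolding bm_sg_def using assms
  by (intro Bochner_Integration.integral_add integrable_std_gauss_bounded[where B = B] integrable_std_gauss_bounded[where B = C]) auto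

lemma bm_sg_cmult [simp]: "bm_sg t (\<lambda>y. c * f y) x = c * bm_sg t f x"
  unfolding bm_sg_def by simp

lemma bm_sg_uminus [simp]: "bm_sg t (\<lambda>y. - f y) x = - bm_sg t f x"
  unfolding bm_sg_def by simp

theorem bm_sg_semigroup:
  assumes "0 \<le> a" "0 \<le> b" and f[measurable]: "f \<in> borel_measurable borel" and B: "\<And>x. \<bar>f x\<bar> \<le> B"
  shows "bm_sg a (bm_sg b f) x = bm_sg (a + b) f x"
proof (cases "a = 0 \<or> b = 0")
  case True
  moreover have "bm_sg 0 f = f" by (rule ext) simp
  ultimately show ?thesis by (auto simp: bm_sg_borel)
next
  case False
  with assms have ab: "0 < a" "0 < b" by auto
  let ?N = "\<lambda>t. density lborel (normal_density 0 (sqrt t))"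
  have "?N a \<star> ?N b = density lborel (\<lambda>x. \<integral>\<^sup>+y. ennreal (normal_density 0 (sqrt a) (x - y)) * ennreal (normal_density 0 (sqrt b) y) \<partial>lborel)"
    using ab by (intro convolution_density) (auto intro!: prob_space.finite_measure prob_space_normal_density)
  also have "\<dots> = ?N (a + b)"
    using conv_normal_density_zero_mean[of "sqrt a" "sqrt b"] ab
    by (simp add: ennreal_mult' normal_density_nonneg)
  finally have conv: "?N a \<star> ?N b = ?N (a + b)" .
  interpret Na: prob_space "?N a" using ab by (intro prob_space_normal_density) simp
  interpret Nb: prob_space "?N b" using ab by (intro prob_space_normal_density) simp
  interpret P: pair_prob_space "?N a" "?N b" ..
  have shift: "bm_sg t h y = (\<integral>w. h (y + w) \<partial>?N t)" if "0 < t" "h \<in> borel_measurable borel" for t h y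
    using that unfolding bm_sg_def
    by (subst density_normal_eq_distr) (auto simp: integral_distr)
  have bmb: "bm_sg b f \<in> borel_measurable borel"
    by (rule bm_sg_borel) fact
  have "bm_sg (a + b) f x = (\<integral>w. f (x + w) \<partial>(?N a \<star> ?N b))"
    unfolding conv using ab by (intro shift) auto
  also have "\<dots> = (\<integral>p. f (x + (fst p + snd p)) \<partial>(?N a \<Otimes>\<^sub>M ?N b))"
    unfolding convolution_def by (subst integral_distr) (auto simp: split_beta)
  also have "\<dots> = (\<integral>u. (\<integral>w. f (x + (u + w)) \<partial>?N b) \<partial>?N a)"
    using B by (subst P.integral_fst'[symmetric])
      (auto intro!: P.integrable_const_bound[where B = B])
  also have "\<dots> = (\<integral>u. bm_sg b f (x + u) \<partial>?N a)"
    using ab f by (simp add: shift add.assoc)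
  also have "\<dots> = bm_sg a (bm_sg b f) x"
    using ab bmb by (simp add: shift)
  finally show ?thesis by simp
qed

section \<open>Differentiation under the integral and Gaussian integration by parts\<close>

text \<open>The mean value inequality bounds the difference quotients by g, then dominated
  convergence applies along sequences. The hypotheses concern only an open interval around s0,
  because the derivative met below is singular at s = t.\<close>

lemma has_real_derivative_integral_dominated:
  fixes h h' :: "real \<Rightarrow> 'z \<Rightarrow> real"
  assumes s0: "a < s0" "s0 < b"
    and int: "\<And>s. a < s \<Longrightarrow> s < b \<Longrightarrow> integrable M (h s)"
    and deriv: "\<And>s z. a < s \<Longrightarrow> s < b \<Longrightarrow> ((\<lambda>s. h s z) has_real_derivative h' s z) (at s)"
    and bound: "\<And>s z. a < s \<Longrightarrow> s < b \<Longrightarrow> \<bar>h' s z\<bar> \<le> g z"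
    and g: "integrable M g" and meas: "h' s0 \<in> borel_measurable M"
  shows "((\<lambda>s. \<integral>z. h s z \<partial>M) has_real_derivative (\<integral>z. h' s0 z \<partial>M)) (at s0)"
proof -
  have "((\<lambda>s. ((\<integral>z. h s z \<partial>M) - (\<integral>z. h s0 z \<partial>M)) / (s - s0)) \<longlongrightarrow> (\<integral>z. h' s0 z \<partial>M))
      (at s0 within {a<..<b})"
    unfolding tendsto_at_iff_sequentially comp_def
  proof (intro allI impI)
    fix X :: "nat \<Rightarrow> real"
    assume X: "\<forall>i. X i \<in> {a<..<b} - {s0}" and lim: "X \<longlonglongrightarrow> s0"
    have int0: "integrable M (h s0)" using int s0 by auto
    have intX: "integrable M (h (X i))" for i using int X by auto
    have "(\<lambda>i. \<integral>z. (h (X i) z - h s0 z) / (X i - s0) \<partial>M) \<longlonglongrightarrow> (\<integral>z. h' s0 z \<partial>M)"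
    proof (rule integral_dominated_convergence[OF meas _ g])
      show "(\<lambda>z. (h (X i) z - h s0 z) / (X i - s0)) \<in> borel_measurable M" for i
        using int0 intX[of i] by auto
      show "AE z in M. (\<lambda>i. (h (X i) z - h s0 z) / (X i - s0)) \<longlonglongrightarrow> h' s0 z"
      proof (rule AE_I2)
        fix z
        have "((\<lambda>s. (h s z - h s0 z) / (s - s0)) \<longlongrightarrow> h' s0 z) (at s0)"
          using deriv[OF s0] by (simp add: has_field_derivative_iff)
        then show "(\<lambda>i. (h (X i) z - h s0 z) / (X i - s0)) \<longlonglongrightarrow> h' s0 z"
          using X lim unfolding tendsto_at_iff_sequentially comp_def by auto
      qed
      show "AE z in M. norm ((h (X i) z - h s0 z) / (X i - s0)) \<le> g z" for i
      proof (rule AE_I2)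
        fix z
        have "norm (h (X i) z - h s0 z) \<le> g z * norm (X i - s0)"
          using X s0 bound
          by (intro field_differentiable_bound[where S = "{a<..<b}" and f = "\<lambda>s. h s z" and f' = "\<lambda>s. h' s z"])
             (auto intro: deriv has_field_derivative_at_within)
        moreover have "X i - s0 \<noteq> 0" using X by auto
        ultimately show "norm ((h (X i) z - h s0 z) / (X i - s0)) \<le> g z"
          by (simp add: divide_simps norm_divide)
      qed
    qed
    moreover have "(\<integral>z. (h (X i) z - h s0 z) / (X i - s0) \<partial>M)
        = ((\<integral>z. h (X i) z \<partial>M) - (\<integral>z. h s0 z \<partial>M)) / (X i - s0)" for i
      using int0 intX by simp
    ultimately show "(\<lambda>i. ((\<integral>z. h (X i) z \<partial>M) - (\<integral>z. h s0 z \<partial>M)) / (X i - s0)) \<longlonglongrightarrow> (\<integral>z. h' s0 z \<partial>M)"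
      by (simp only:)
  qed
  then show ?thesis
    using s0 by (simp add: has_field_derivative_iff at_within_open[of s0 "{a<..<b}"])
qed

lemma set_integrable_Icc_bounded:
  fixes f :: "real \<Rightarrow> real"
  assumes "f \<in> borel_measurable borel" "\<And>s. s \<in> {a..b} \<Longrightarrow> \<bar>f s\<bar> \<le> B"
  shows "set_integrable lborel {a..b} f"
  unfolding set_integrable_def using assms
  by (intro integrableI_bounded_set_indicator[where B = B]) (auto simp: emeasure_lborel_Icc_eq)

lemma integrable_std_gauss_abs: "integrable std_gauss (\<lambda>z. \<bar>z\<bar>)"
  using integrable_std_normal_moment_abs[of 1]
  by (subst integrable_density) auto

text \<open>Integrates the derivative of - h \<phi>, where \<phi>' = - z \<phi>. It trades the
  factor z, produced by differentiating sqrt (t - s) * z in time, for one more space derivative;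
  this is how the heat equation enters.\<close>

lemma std_gauss_integral_by_parts:
  fixes h h' :: "real \<Rightarrow> real"
  assumes deriv: "\<And>z. (h has_real_derivative h' z) (at z)"
    and B: "\<And>z. \<bar>h z\<bar> \<le> B" and B': "\<And>z. \<bar>h' z\<bar> \<le> B'"
    and cont: "continuous_on UNIV h'"
  shows "(\<integral>z. h z * z \<partial>std_gauss) = (\<integral>z. h' z \<partial>std_gauss)"
proof -
  let ?\<phi> = "std_normal_density"
  have conth: "continuous_on UNIV h"
    using deriv by (meson DERIV_isCont continuous_at_imp_continuous_on)
  have [measurable]: "h \<in> borel_measurable borel" "h' \<in> borel_measurable borel"
    using cont conth by (auto intro: borel_measurable_continuous_onI)
  have d\<phi>: "(?\<phi> has_real_derivative - z * ?\<phi> z) (at z)" for z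
    unfolding std_normal_density_def[abs_def]
    by (auto intro!: derivative_eq_intros simp: field_simps)
  have contphi: "isCont ?\<phi> z" for z using d\<phi> by (rule DERIV_isCont)
  have i1: "integrable lborel (\<lambda>z. ?\<phi> z * (h z * z))"
  proof (rule Bochner_Integration.integrable_bound)
    show "integrable lborel (\<lambda>z. B * (?\<phi> z * \<bar>z\<bar>^1))"
      by (intro integrable_mult_right integrable_std_normal_moment_abs)
    have "\<bar>h z\<bar> * \<bar>z\<bar> \<le> B * \<bar>z\<bar>" for z by (intro mult_right_mono B) auto
    then have "?\<phi> z * (\<bar>h z\<bar> * \<bar>z\<bar>) \<le> ?\<phi> z * (B * \<bar>z\<bar>)" for z
      by (intro mult_left_mono) auto
    moreover have "0 \<le> B" using B[of 0] by linarith
    ultimately show "AE z in lborel. norm (?\<phi> z * (h z * z)) \<le> norm (B * (?\<phi> z * \<bar>z\<bar>^1))"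
      by (auto simp: abs_mult mult_ac)
  qed auto
  have i2: "integrable lborel (\<lambda>z. ?\<phi> z * h' z)"
    using integrable_std_gauss_bounded[of h' B'] B' by (subst (asm) integrable_density) auto
  have tend: "((\<lambda>z. - (h z * ?\<phi> z)) \<longlongrightarrow> 0) F" if "(?\<phi> \<longlongrightarrow> 0) F" for F
  proof -
    have "((\<lambda>z. B * ?\<phi> z) \<longlongrightarrow> 0) F" using that by (auto intro: tendsto_mult_right_zero)
    then show ?thesis
      by (rule Lim_null_comparison[rotated]) (auto simp: abs_mult intro!: always_eventually mult_right_mono B)
  qed
  have lim_top: "(?\<phi> \<longlongrightarrow> 0) at_top" and lim_bot: "(?\<phi> \<longlongrightarrow> 0) at_bot"
    unfolding std_normal_density_def[abs_def] by real_asymp+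
  have "(LBINT z=-\<infinity>..\<infinity>. ?\<phi> z * (h z * z) - ?\<phi> z * h' z) = 0 - 0"
  proof (rule interval_integral_FTC_integrable[where F = "\<lambda>z. - (h z * ?\<phi> z)"])
    fix z
    show "((\<lambda>z. - (h z * ?\<phi> z)) has_vector_derivative (?\<phi> z * (h z * z) - ?\<phi> z * h' z)) (at z)"
      unfolding has_real_derivative_iff_has_vector_derivative[symmetric]
      by (auto intro!: derivative_eq_intros deriv d\<phi> simp: algebra_simps)
    show "isCont (\<lambda>z. ?\<phi> z * (h z * z) - ?\<phi> z * h' z) z"
      using conth cont contphi by (auto intro!: continuous_intros simp: continuous_on_eq_continuous_at)
  next
    show "set_integrable lborel (einterval (-\<infinity>) \<infinity>) (\<lambda>z. ?\<phi> z * (h z * z) - ?\<phi> z * h' z)"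
      using i1 i2 by (simp add: set_integrable_def)
    show "(((\<lambda>z. - (h z * ?\<phi> z)) \<circ> real_of_ereal) \<longlongrightarrow> 0) (at_left \<infinity>)"
      using tend[OF lim_top] by (simp add: ereal_tendsto_simps)
    show "(((\<lambda>z. - (h z * ?\<phi> z)) \<circ> real_of_ereal) \<longlongrightarrow> 0) (at_right (-\<infinity>))"
      using tend[OF lim_bot] by (simp add: ereal_tendsto_simps)
  qed auto
  then have "(\<integral>z. ?\<phi> z * (h z * z) - ?\<phi> z * h' z \<partial>lborel) = 0"
    by (simp add: interval_lebesgue_integral_def set_lebesgue_integral_def)
  then have "(\<integral>z. ?\<phi> z * (h z * z) \<partial>lborel) = (\<integral>z. ?\<phi> z * h' z \<partial>lborel)"
    using i1 i2 by simp
  then show ?thesis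
    by (simp add: integral_density)
qed

section \<open>Duhamel's formula with a killing rate\<close>

text \<open>The mild form of v_t = v_xx / 2 - c v + h with initial value g.\<close>

definition duhamel :: "real \<Rightarrow> (real \<Rightarrow> real) \<Rightarrow> (real \<Rightarrow> real \<Rightarrow> real) \<Rightarrow> real \<Rightarrow> real \<Rightarrow> real" where
  "duhamel c g h t x = exp (- c * t) * bm_sg t g x
     + (LBINT s:{0..t}. exp (- c * (t - s)) * bm_sg (t - s) (h s) x)"

lemma duhamel_0: "g \<in> borel_measurable borel \<Longrightarrow> duhamel c g h 0 x = g x"
proof -
  have "(LBINT s:{0..0}. exp (- c * (0 - s)) * bm_sg (0 - s) (h s) x) = 0"
    unfolding set_lebesgue_integral_def using AE_lborel_singleton[of "0::real"]
    by (intro integral_eq_zero_AE) (erule eventually_mono, simp add: indicator_def)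
  moreover assume "g \<in> borel_measurable borel"
  ultimately show ?thesis by (simp add: duhamel_def)
qed

abbreviation jointly_borel :: "(real \<Rightarrow> real \<Rightarrow> real) \<Rightarrow> bool" where
  "jointly_borel f \<equiv> (\<lambda>(s, x). f s x) \<in> borel_measurable (borel \<Otimes>\<^sub>M borel)"

text \<open>Joint differentiability yields the chain rule along the curve s -> (s, x + sqrt (t - s)
  z). Measurability is asked for all real s, since the time integrals are taken over the line with
  an indicator; the analytic conditions concern s >= 0.\<close>

locale bounded_C12 =
  fixes W Ws Wx Wxx :: "real \<Rightarrow> real \<Rightarrow> real" and B :: real
  assumes W: "\<And>s x. 0 \<le> s \<Longrightarrow>
      ((\<lambda>p. W (fst p) (snd p)) has_derivative (\<lambda>p. Ws s x * fst p + Wx s x * snd p)) (at (s, x))"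
    and Wxx: "\<And>s x. 0 \<le> s \<Longrightarrow> (Wx s has_real_derivative Wxx s x) (at x)"
    and cont: "\<And>s. 0 \<le> s \<Longrightarrow> continuous_on UNIV (Wxx s)"
    and meas [measurable]: "jointly_borel W"
      "jointly_borel Ws"
      "jointly_borel Wxx"
    and B: "\<And>s x. 0 \<le> s \<Longrightarrow> \<bar>W s x\<bar> \<le> B" "\<And>s x. 0 \<le> s \<Longrightarrow> \<bar>Ws s x\<bar> \<le> B"
      "\<And>s x. 0 \<le> s \<Longrightarrow> \<bar>Wx s x\<bar> \<le> B" "\<And>s x. 0 \<le> s \<Longrightarrow> \<bar>Wxx s x\<bar> \<le> B"

text \<open>With P for the Brownian semigroup, F s = exp (c s) P_(t-s) W_s interpolates between P_t
  W_0 and exp (c t) W_t. Differentiating P contributes - W_xx / 2, so F' is the Duhamel integrand up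
  to the factor exp (c t).\<close>

theorem (in bounded_C12) classical_eq_duhamel:
  assumes t: "0 \<le> t"
  shows "W t x = duhamel c (W 0) (\<lambda>s y. Ws s y - Wxx s y / 2 + c * W s y) t x"
proof (cases "t = 0")
  case True
  have "(\<lambda>y. W 0 y) \<in> borel_measurable borel" by measurable
  with True show ?thesis by (simp add: duhamel_0)
next
  case False
  with t have t: "0 < t" by simp
  have B0: "0 \<le> B" using B(1)[of 0 0] by linarith
  have Wcomp: "((\<lambda>s. W (\<sigma> s) (\<xi> s)) has_real_derivative Ws (\<sigma> s) (\<xi> s) * \<sigma>' + Wx (\<sigma> s) (\<xi> s) * \<xi>') (at s)"
    if "0 \<le> \<sigma> s" "(\<sigma> has_real_derivative \<sigma>') (at s)" "(\<xi> has_real_derivative \<xi>') (at s)" for \<sigma> \<xi> \<sigma>' \<xi>' s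
  proof -
    have "((\<lambda>s. (\<sigma> s, \<xi> s)) has_derivative (\<lambda>h. (\<sigma>' * h, \<xi>' * h))) (at s)"
      using that by (intro has_derivative_Pair) (auto simp: has_field_derivative_def)
    from has_derivative_compose[OF this W[OF that(1)]]
    have "((\<lambda>s. W (\<sigma> s) (\<xi> s)) has_derivative
        (\<lambda>h. (Ws (\<sigma> s) (\<xi> s) * \<sigma>' + Wx (\<sigma> s) (\<xi> s) * \<xi>') * h)) (at s)"
      by (simp add: algebra_simps)
    then show ?thesis
      by (simp add: has_field_derivative_def)
  qed
  define D where "D s y = Ws s y - Wxx s y / 2 + c * W s y" for s y
  have D_meas[measurable]: "jointly_borel D"
    unfolding D_def by measurable
  have D_B: "\<bar>D s y\<bar> \<le> B + B / 2 + \<bar>c\<bar> * B" if "0 \<le> s" for s y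
  proof -
    have "\<bar>c * W s y\<bar> \<le> \<bar>c\<bar> * B" using B(1)[OF that] by (simp add: abs_mult mult_left_mono)
    then show ?thesis using B(2,4)[OF that, of y] unfolding D_def by linarith
  qed
  define F where "F s = exp (c * s) * bm_sg (t - s) (W s) x" for s
  define F' where "F' s = exp (c * s) * bm_sg (t - s) (D s) x" for s
  have W_borel[measurable]: "W s \<in> borel_measurable borel" "Ws s \<in> borel_measurable borel"
    "Wxx s \<in> borel_measurable borel" for s by measurable
  have Wx_borel: "Wx s \<in> borel_measurable borel" if "0 \<le> s" for s
    using Wxx[OF that] by (intro borel_measurable_continuous_onI)
      (meson DERIV_isCont continuous_at_imp_continuous_on)
  have derivF: "(F has_real_derivative F' s0) (at s0)" if s0: "0 < s0" "s0 < t" for s0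
  proof -
    \<comment> \<open>Strictly below t, so that 1 / sqrt (t - s) is bounded on (0, b) and an affine
      function of |z| dominates.\<close>
    define b where "b = (s0 + t) / 2"
    have b: "s0 < b" "b < t" using s0 by (auto simp: b_def)
    have [measurable]: "Wx s0 \<in> borel_measurable borel" using s0 by (intro Wx_borel) simp
    define k where "k s z = Ws s (x + sqrt (t - s) * z) * 1 + Wx s (x + sqrt (t - s) * z) * (- z / (2 * sqrt (t - s)))" for s z
    have "((\<lambda>s. \<integral>z. W s (x + sqrt (t - s) * z) \<partial>std_gauss) has_real_derivative (\<integral>z. k s0 z \<partial>std_gauss)) (at s0)"
    proof (rule has_real_derivative_integral_dominated[where g = "\<lambda>z. B + B * \<bar>z\<bar> / (2 * sqrt (t - b))", OF s0(1) b(1)])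
      fix s :: real assume s: "0 < s" "s < b"
      show "integrable std_gauss (\<lambda>z. W s (x + sqrt (t - s) * z))"
        using s B(1) by (intro integrable_std_gauss_bounded[where B = B]) auto
      fix z
      have "((\<lambda>s. x + sqrt (t - s) * z) has_real_derivative (- z / (2 * sqrt (t - s)))) (at s)"
        using s b by (auto intro!: derivative_eq_intros simp: field_simps)
      then show "((\<lambda>s. W s (x + sqrt (t - s) * z)) has_real_derivative k s z) (at s)"
        unfolding k_def using s by (intro Wcomp[where \<sigma> = "\<lambda>s. s"]) auto
      have "\<bar>- z / (2 * sqrt (t - s))\<bar> \<le> \<bar>z\<bar> / (2 * sqrt (t - b))"
        using s b by (auto simp: abs_mult intro!: frac_le)
      then have "\<bar>Wx s (x + sqrt (t - s) * z) * (- z / (2 * sqrt (t - s)))\<bar> \<le> B * (\<bar>z\<bar> / (2 * sqrt (t - b)))"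
        unfolding abs_mult[of "Wx s _"] using s B0 by (intro mult_mono B) auto
      moreover have "\<bar>Ws s (x + sqrt (t - s) * z)\<bar> \<le> B" using s by (intro B) auto
      ultimately show "\<bar>k s z\<bar> \<le> B + B * \<bar>z\<bar> / (2 * sqrt (t - b))"
        unfolding k_def mult_1_right times_divide_eq_right[of B, symmetric] by linarith
    next
      show "integrable std_gauss (\<lambda>z. B + B * \<bar>z\<bar> / (2 * sqrt (t - b)))"
        by (intro Bochner_Integration.integrable_add integrable_divide integrable_mult_right
              integrable_std_gauss_abs gauss.integrable_const)
      show "k s0 \<in> borel_measurable std_gauss"
        unfolding k_def[abs_def] by measurable
    qed
    also have "(\<integral>z. k s0 z \<partial>std_gauss) = bm_sg (t - s0) (\<lambda>y. Ws s0 y - Wxx s0 y / 2) x"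
    proof -
      define r where "r = sqrt (t - s0)"
      have r: "r > 0" using s0 by (simp add: r_def)
      \<comment> \<open>The inner derivative r cancels against the 1 / (2 r) coming from the time
        derivative and leaves Wxx / 2.\<close>
      have ibp: "(\<integral>z. Wx s0 (x + r * z) * z \<partial>std_gauss) = (\<integral>z. Wxx s0 (x + r * z) * r \<partial>std_gauss)"
      proof (rule std_gauss_integral_by_parts[where B = B and B' = "B * r"])
        fix z
        show "((\<lambda>z. Wx s0 (x + r * z)) has_real_derivative Wxx s0 (x + r * z) * r) (at z)"
          using s0 by (intro DERIV_chain2[where f = "Wx s0"] Wxx) (auto intro!: derivative_eq_intros)
        show "\<bar>Wx s0 (x + r * z)\<bar> \<le> B" using s0 by (intro B) auto
        show "\<bar>Wxx s0 (x + r * z) * r\<bar> \<le> B * r"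
          using s0 r B(4)[of s0] by (simp add: abs_mult mult_right_mono)
      next
        show "continuous_on UNIV (\<lambda>z. Wxx s0 (x + r * z) * r)"
          using s0 by (intro continuous_intros continuous_on_compose2[OF cont]) auto
      qed
      have i1: "integrable std_gauss (\<lambda>z. Ws s0 (x + r * z))"
        using s0 B by (intro integrable_std_gauss_bounded[where B = B]) auto
      have i3: "integrable std_gauss (\<lambda>z. Wxx s0 (x + r * z))"
        using s0 B by (intro integrable_std_gauss_bounded[where B = B]) auto
      have i2: "integrable std_gauss (\<lambda>z. Wx s0 (x + r * z) * z)"
      proof (rule Bochner_Integration.integrable_bound)
        show "integrable std_gauss (\<lambda>z. B * \<bar>z\<bar>)"
          by (intro integrable_mult_right integrable_std_gauss_abs)
        show "AE z in std_gauss. norm (Wx s0 (x + r * z) * z) \<le> norm (B * \<bar>z\<bar>)"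
          using s0 B0 B(3)[of s0] by (intro AE_I2) (auto simp: abs_mult intro!: mult_right_mono)
      qed measurable
      have "(\<integral>z. k s0 z \<partial>std_gauss) = (\<integral>z. Ws s0 (x + r * z) - (1 / (2 * r)) * (Wx s0 (x + r * z) * z) \<partial>std_gauss)"
        unfolding k_def r_def by (simp add: mult_ac)
      also have "\<dots> = (\<integral>z. Ws s0 (x + r * z) \<partial>std_gauss) - (1 / (2 * r)) * (\<integral>z. Wxx s0 (x + r * z) * r \<partial>std_gauss)"
        unfolding ibp[symmetric] using i1 i2 by simp
      also have "\<dots> = (\<integral>z. Ws s0 (x + r * z) - Wxx s0 (x + r * z) / 2 \<partial>std_gauss)"
        using i1 i3 r by simp
      finally show ?thesis unfolding bm_sg_def r_def .
    qed
    finally have G: "((\<lambda>s. bm_sg (t - s) (W s) x) has_real_derivative bm_sg (t - s0) (\<lambda>y. Ws s0 y - Wxx s0 y / 2) x) (at s0)"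
      unfolding bm_sg_def .
    have "bm_sg (t - s0) (D s0) x = bm_sg (t - s0) (\<lambda>y. Ws s0 y - Wxx s0 y / 2) x + bm_sg (t - s0) (\<lambda>y. c * W s0 y) x"
      unfolding D_def
    proof (intro bm_sg_add[where B = "B + B / 2" and C = "\<bar>c\<bar> * B"])
      fix y
      show "\<bar>Ws s0 y - Wxx s0 y / 2\<bar> \<le> B + B / 2"
        using B(2,4)[of s0 y] s0 by linarith
      show "\<bar>c * W s0 y\<bar> \<le> \<bar>c\<bar> * B" using B(1)[of s0] s0 by (simp add: abs_mult mult_left_mono)
    qed auto
    then have e: "F' s0 = exp (c * s0) * c * bm_sg (t - s0) (W s0) x
        + bm_sg (t - s0) (\<lambda>y. Ws s0 y - Wxx s0 y / 2) x * exp (c * s0)"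
      unfolding F'_def by (simp add: algebra_simps)
    have "((\<lambda>s. exp (c * s)) has_real_derivative exp (c * s0) * c) (at s0)"
      by (auto intro!: derivative_eq_intros)
    from DERIV_mult[OF this G] show ?thesis unfolding F_def[abs_def] e by simp
  qed
  \<comment> \<open>The derivative formula holds only for 0 < s < t, so the fundamental theorem is
    used in its interior form, with continuity up to the endpoints.\<close>
  have contF: "continuous_on {0..t} F"
  proof (intro continuous_on_sequentiallyI)
    fix u a assume u: "\<forall>n. u n \<in> {0..t}" and a: "a \<in> {0..t}" and lim: "u \<longlonglongrightarrow> a"
    have "(\<lambda>n. bm_sg (t - u n) (W (u n)) x) \<longlonglongrightarrow> bm_sg (t - a) (W a) x"
      unfolding bm_sg_def
    proof (rule integral_dominated_convergence[where w = "\<lambda>_. B"])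
      show "AE z in std_gauss. (\<lambda>n. W (u n) (x + sqrt (t - u n) * z)) \<longlonglongrightarrow> W a (x + sqrt (t - a) * z)"
      proof (rule AE_I2)
        fix z
        have "isCont (\<lambda>p. W (fst p) (snd p)) (a, x + sqrt (t - a) * z)"
          using has_derivative_continuous[OF W] a by auto
        moreover have "(\<lambda>n. (u n, x + sqrt (t - u n) * z)) \<longlonglongrightarrow> (a, x + sqrt (t - a) * z)"
          by (intro tendsto_intros lim)
        ultimately have "(\<lambda>n. (\<lambda>p. W (fst p) (snd p)) (u n, x + sqrt (t - u n) * z)) \<longlonglongrightarrow> (\<lambda>p. W (fst p) (snd p)) (a, x + sqrt (t - a) * z)"
          by (rule isCont_tendsto_compose)
        then show "(\<lambda>n. W (u n) (x + sqrt (t - u n) * z)) \<longlonglongrightarrow> W a (x + sqrt (t - a) * z)"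
          by simp
      qed
      show "AE z in std_gauss. norm (W (u n) (x + sqrt (t - u n) * z)) \<le> B" for n
        using u B by auto
    qed auto
    then show "(\<lambda>n. F (u n)) \<longlonglongrightarrow> F a"
      unfolding F_def by (intro tendsto_intros lim)
  qed
  have D1: "\<bar>bm_sg (t - s) (D s) x\<bar> \<le> B + B / 2 + \<bar>c\<bar> * B" if "0 \<le> s" for s
    using that by (intro bm_sg_abs_le D_B) auto
  have F'_int: "set_integrable lborel {0..t} F'"
  proof (rule set_integrable_Icc_bounded[where B = "exp (\<bar>c\<bar> * t) * (B + B / 2 + \<bar>c\<bar> * B)"])
    show "F' \<in> borel_measurable borel" unfolding F'_def by measurable
    fix s assume s: "s \<in> {0..t}"
    have "c * s \<le> \<bar>c\<bar> * t" using s t by (intro mult_mono) auto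
    then show "\<bar>F' s\<bar> \<le> exp (\<bar>c\<bar> * t) * (B + B / 2 + \<bar>c\<bar> * B)"
      unfolding F'_def abs_mult using s by (intro mult_mono D1) auto
  qed
  have "(F' has_integral (F t - F 0)) {0..t}"
    using t contF derivF
    by (intro fundamental_theorem_of_calculus_interior)
       (auto simp: has_real_derivative_iff_has_vector_derivative[symmetric])
  then have "F t - F 0 = (LBINT s:{0..t}. F' s)"
    using set_borel_integral_eq_integral(2)[OF F'_int] by (simp add: integral_unique)
  moreover have "F t = exp (c * t) * W t x" "F 0 = bm_sg t (W 0) x"
    unfolding F_def by simp_all
  ultimately have "exp (c * t) * W t x = bm_sg t (W 0) x + (LBINT s:{0..t}. F' s)" by simp
  then have "W t x = exp (- c * t) * (bm_sg t (W 0) x + (LBINT s:{0..t}. F' s))"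
    by (simp add: exp_minus field_simps)
  also have "\<dots> = exp (- c * t) * bm_sg t (W 0) x + (LBINT s:{0..t}. exp (- c * t) * F' s)"
    by (simp add: distrib_left)
  also have "\<dots> = duhamel c (W 0) D t x"
    unfolding duhamel_def F'_def by (simp add: mult.assoc[symmetric] exp_add[symmetric] algebra_simps)
  finally show ?thesis unfolding D_def .
qed

lemma duhamel_cong:
  assumes "\<And>s y. 0 \<le> s \<Longrightarrow> s \<le> t \<Longrightarrow> h s y = h' s y"
  shows "duhamel c g h t x = duhamel c g h' t x"
proof -
  have "h s = h' s" if "0 \<le> s" "s \<le> t" for s
    using assms that by auto
  then show ?thesis
    unfolding duhamel_def by (auto intro!: set_lebesgue_integral_cong)
qed

lemma duhamel_measurable:
  assumes [measurable]: "g \<in> borel_measurable borel" "jointly_borel h"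
  shows "jointly_borel (duhamel c g h)"
proof -
  \<comment> \<open>The time t varies as well; written as a conditional, the indicator is jointly
    measurable in (t, s).\<close>
  have i: "indicator {0..t} s = (if 0 \<le> s \<and> s \<le> t then 1 else 0 :: real)" for s t :: real
    by (simp add: indicator_def)
  show ?thesis
    unfolding duhamel_def set_lebesgue_integral_def i split_beta' by measurable
qed

lemma bm_sg_set_integral:
  fixes a b :: real
  assumes k[measurable]: "jointly_borel k"
    and kB: "\<And>s y. s \<in> {a..b} \<Longrightarrow> \<bar>k s y\<bar> \<le> K"
  shows "bm_sg t (\<lambda>y. LBINT s:{a..b}. k s y) x = (LBINT s:{a..b}. bm_sg t (k s) x)"
proof -
  interpret P: pair_sigma_finite std_gauss "lborel :: real measure" ..
  have "integrable (std_gauss \<Otimes>\<^sub>M lborel) (\<lambda>(z, s). indicator {a..b} s *\<^sub>R k s (x + sqrt t * z))"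
  proof -
    have "integrable (std_gauss \<Otimes>\<^sub>M lborel) (\<lambda>p. indicator (UNIV \<times> {a..b}) p *\<^sub>R (\<lambda>p. k (snd p) (x + sqrt t * fst p)) p)"
    proof (rule integrableI_bounded_set_indicator[where B = K])
      have "emeasure (std_gauss \<Otimes>\<^sub>M lborel) (UNIV \<times> {a..b}) = emeasure std_gauss UNIV * emeasure lborel {a..b}"
        by (intro lborel.emeasure_pair_measure_Times) auto
      also have "\<dots> < \<infinity>"
        using gauss.emeasure_space_1 by (auto simp: emeasure_lborel_Icc_eq)
      finally show "emeasure (std_gauss \<Otimes>\<^sub>M lborel) (UNIV \<times> {a..b}) < \<infinity>" .
    qed (use kB in auto)
    then show ?thesis
      by (simp add: split_beta' indicator_times)
  qed
  from P.Fubini_integral[OF this] show ?thesis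
    unfolding bm_sg_def set_lebesgue_integral_def by simp
qed

lemma set_integral_exp_Icc:
  fixes c r t :: real
  assumes "r \<le> t"
  shows "(LBINT s:{r..t}. c * exp (- c * (s - r))) = 1 - exp (- c * (t - r))"
proof -
  have "(LBINT s:{r..t}. c * exp (- c * (s - r))) = (- exp (- c * (t - r))) - (- exp (- c * (r - r)))"
    unfolding set_lebesgue_integral_def
  proof (rule integral_FTC_atLeastAtMost[where F = "\<lambda>s. - exp (- c * (s - r))"])
    show "((\<lambda>s. - exp (- c * (s - r))) has_vector_derivative c * exp (- c * (x - r))) (at x within {r..t})" for x
      unfolding has_real_derivative_iff_has_vector_derivative[symmetric]
      by (auto intro!: derivative_eq_intros)
    show "continuous_on {r..t} (\<lambda>s. c * exp (- c * (s - r)))"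
      by (intro continuous_intros)
  qed fact
  then show ?thesis by simp
qed

context
  fixes g :: "real \<Rightarrow> real" and h :: "real \<Rightarrow> real \<Rightarrow> real" and B :: real
  assumes g[measurable]: "g \<in> borel_measurable borel" and gB: "\<And>x. \<bar>g x\<bar> \<le> B"
    and h[measurable]: "jointly_borel h" and hB: "\<And>s x. \<bar>h s x\<bar> \<le> B"
begin

lemma duhamel_integrand_integrable:
  "set_integrable lborel {a..b} (\<lambda>s. exp (- c * (t - s)) * bm_sg (t - s) (h s) x)"
proof (rule set_integrable_Icc_bounded[where B = "exp (\<bar>c\<bar> * (\<bar>t\<bar> + (\<bar>a\<bar> + \<bar>b\<bar>))) * B"])
  fix s assume s: "s \<in> {a..b}"
  have "- c * (t - s) \<le> \<bar>- c\<bar> * \<bar>t - s\<bar>" by (metis abs_ge_self abs_mult)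
  also have "\<dots> \<le> \<bar>c\<bar> * (\<bar>t\<bar> + (\<bar>a\<bar> + \<bar>b\<bar>))"
    using s by (intro mult_mono) auto
  finally show "\<bar>exp (- c * (t - s)) * bm_sg (t - s) (h s) x\<bar> \<le> exp (\<bar>c\<bar> * (\<bar>t\<bar> + (\<bar>a\<bar> + \<bar>b\<bar>))) * B"
    unfolding abs_mult by (intro mult_mono bm_sg_abs_le hB) auto
qed measurable

text \<open>Removing the killing rate c: insert the killed equation into the unkilled Duhamel integral
  and exchange the two time integrals.\<close>

lemma duhamel_remove_killing:
  assumes v: "\<And>t x. 0 \<le> t \<Longrightarrow> v t x = duhamel c g h t x"
    and vm[measurable]: "jointly_borel v"
    and vB: "\<And>s x. \<bar>v s x\<bar> \<le> C"
    and t: "0 \<le> t"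
  shows "v t x = duhamel 0 g (\<lambda>s y. h s y - c * v s y) t x"
proof -
  define H where "H r = bm_sg (t - r) (h r) x" for r
  have H_meas[measurable]: "H \<in> borel_measurable borel" unfolding H_def by measurable
  have H_B: "\<bar>H r\<bar> \<le> B" for r
    unfolding H_def by (intro bm_sg_abs_le hB) measurable
  have B0: "0 \<le> B" using gB[of 0] by linarith
  \<comment> \<open>The kernel is extended by 0 outside 0 <= r <= s: the triangle of the double
    integral becomes a square, and the integrand is bounded on it, as Fubini requires.\<close>
  define E where "E = (\<lambda>s r. if 0 \<le> r \<and> r \<le> s then exp (- c * (s - r)) else 0)"
  have E_meas[measurable]: "jointly_borel E"
    unfolding E_def by measurable
  have E_B: "\<bar>E s r\<bar> \<le> exp (\<bar>c\<bar> * t)" if "s \<le> t" for s r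
  proof (cases "0 \<le> r \<and> r \<le> s")
    case True
    have "- c * (s - r) \<le> \<bar>- c\<bar> * \<bar>s - r\<bar>" by (metis abs_ge_self abs_mult)
    also have "\<dots> \<le> \<bar>c\<bar> * t" using True that by (intro mult_mono) auto
    finally show ?thesis using True by (simp add: E_def)
  qed (auto simp: E_def)
  have E_eq: "(LBINT r:{0..s}. exp (- c * (s - r)) * H r) = (LBINT r:{0..t}. E s r * H r)" if "s \<le> t" for s
    unfolding set_lebesgue_integral_def using that
    by (intro Bochner_Integration.integral_cong) (auto simp: E_def indicator_def)
  \<comment> \<open>The outer semigroup P_(t-s) combines with P_(s-r) to P_(t-r), so the spatial
    part \<open>H r\<close> no longer depends on s and only a scalar kernel in (s, r)
    remains.\<close>
  have key: "bm_sg (t - s) (v s) x = exp (- c * s) * bm_sg t g x + (LBINT r:{0..t}. E s r * H r)"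
    if s: "0 \<le> s" "s \<le> t" for s
  proof -
    define k where "k r y = E s r * bm_sg (s - r) (h r) y" for r y
    have k_meas[measurable]: "jointly_borel k"
      unfolding k_def split_beta' by measurable
    have k_B: "\<bar>k r y\<bar> \<le> exp (\<bar>c\<bar> * t) * B" for r y
      unfolding k_def abs_mult by (intro mult_mono E_B s bm_sg_abs_le hB) auto
    have vs: "v s y = exp (- c * s) * bm_sg s g y + (LBINT r:{0..s}. k r y)" for y
      unfolding v[OF s(1)] duhamel_def k_def E_def
      by (intro arg_cong2[where f = "(+)"] refl set_lebesgue_integral_cong) auto
    have m2: "(\<lambda>y. LBINT r:{0..s}. k r y) \<in> borel_measurable borel"
      unfolding set_lebesgue_integral_def by measurable
    have v1: "\<bar>exp (- c * s) * bm_sg s g y\<bar> \<le> exp (- c * s) * B" for y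
      unfolding abs_mult by (intro mult_mono bm_sg_abs_le gB) auto
    have "bm_sg (t - s) (v s) x = bm_sg (t - s) (\<lambda>y. exp (- c * s) * bm_sg s g y) x
        + bm_sg (t - s) (\<lambda>y. LBINT r:{0..s}. k r y) x"
      unfolding vs
    proof (rule bm_sg_add[OF _ v1 m2])
      fix y
      have "(LBINT r:{0..s}. k r y) = v s y - exp (- c * s) * bm_sg s g y" using vs by simp
      then show "\<bar>LBINT r:{0..s}. k r y\<bar> \<le> C + exp (- c * s) * B"
        using v1[of y] vB[of s y] by linarith
    qed measurable
    also have "bm_sg (t - s) (\<lambda>y. exp (- c * s) * bm_sg s g y) x = exp (- c * s) * bm_sg t g x"
      using s bm_sg_semigroup[of "t - s" s g B x] gB by simp
    also have "bm_sg (t - s) (\<lambda>y. LBINT r:{0..s}. k r y) x = (LBINT r:{0..s}. bm_sg (t - s) (k r) x)"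
      using k_B by (intro bm_sg_set_integral) auto
    also have "\<dots> = (LBINT r:{0..s}. exp (- c * (s - r)) * H r)"
    proof (intro set_lebesgue_integral_cong allI impI)
      fix r assume r: "r \<in> {0..s}"
      have "bm_sg (t - s) (k r) x = E s r * bm_sg (t - s) (bm_sg (s - r) (h r)) x"
        unfolding k_def[abs_def] by simp
      also have "bm_sg (t - s) (bm_sg (s - r) (h r)) x = H r"
        unfolding H_def using r s hB by (subst bm_sg_semigroup[where B = B]) auto
      finally show "bm_sg (t - s) (k r) x = exp (- c * (s - r)) * H r"
        using r by (simp add: E_def)
    qed simp
    finally show ?thesis using E_eq s by simp
  qed
  have int_H: "set_integrable lborel {0..t} H"
    by (rule set_integrable_Icc_bounded[OF H_meas H_B])
  have bv: "\<bar>bm_sg (t - s) (v s) x\<bar> \<le> C" for s by (intro bm_sg_abs_le vB) measurable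
  have int_v: "set_integrable lborel {0..t} (\<lambda>s. bm_sg (t - s) (v s) x)"
    using bv by (intro set_integrable_Icc_bounded[where B = C]) measurable
  have int_EH: "integrable (lborel \<Otimes>\<^sub>M lborel)
      (\<lambda>(s, r). indicator {0..t} s *\<^sub>R (indicator {0..t} r *\<^sub>R (c * (E s r * H r))))"
  proof -
    have "integrable (lborel \<Otimes>\<^sub>M lborel)
      (\<lambda>p. indicator ({0..t} \<times> {0..t}) p *\<^sub>R (\<lambda>p. c * (E (fst p) (snd p) * H (snd p))) p)"
    proof (rule integrableI_bounded_set_indicator[where B = "\<bar>c\<bar> * (exp (\<bar>c\<bar> * t) * B)"])
      have "emeasure (lborel \<Otimes>\<^sub>M lborel) ({0..t} \<times> {0..t}) = emeasure lborel {0..t} * emeasure lborel {0..t}"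
        by (intro lborel.emeasure_pair_measure_Times) auto
      also have "\<dots> < \<infinity>" by (auto simp: emeasure_lborel_Icc_eq ennreal_mult_less_top)
      finally show "emeasure (lborel \<Otimes>\<^sub>M lborel) ({0..t} \<times> {0..t}) < \<infinity>" .
      show "AE p in lborel \<Otimes>\<^sub>M lborel. p \<in> {0..t} \<times> {0..t} \<longrightarrow>
          norm (c * (E (fst p) (snd p) * H (snd p))) \<le> \<bar>c\<bar> * (exp (\<bar>c\<bar> * t) * B)"
        by (intro AE_I2 impI) (auto simp: abs_mult intro!: mult_mono E_B H_B)
    qed measurable
    then show ?thesis
      by (simp add: split_beta' indicator_times mult_ac)
  qed
  \<comment> \<open>For fixed r, s runs over [r, t], and the exponential density integrates to 1 -
    exp (- c (t - r)). Subtracting this from the unkilled integral of H leaves the killed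
    one.\<close>
  have swap: "(LBINT s:{0..t}. c * (LBINT r:{0..t}. E s r * H r)) = (LBINT r:{0..t}. (1 - exp (- c * (t - r))) * H r)"
  proof -
    have "(LBINT s:{0..t}. c * (LBINT r:{0..t}. E s r * H r))
      = (LBINT s. LBINT r. indicator {0..t} s *\<^sub>R (indicator {0..t} r *\<^sub>R (c * (E s r * H r))))"
      unfolding set_lebesgue_integral_def by (simp add: mult.left_commute[of _ c])
    also have "\<dots> = (LBINT r. LBINT s. indicator {0..t} s *\<^sub>R (indicator {0..t} r *\<^sub>R (c * (E s r * H r))))"
      by (rule lborel_pair.Fubini_integral[OF int_EH, symmetric])
    also have "\<dots> = (LBINT r. indicator {0..t} r *\<^sub>R (LBINT s:{r..t}. c * exp (- c * (s - r))) * H r)"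
    proof (rule Bochner_Integration.integral_cong[OF refl])
      fix r
      have "(LBINT s. indicator {0..t} s *\<^sub>R (indicator {0..t} r *\<^sub>R (c * (E s r * H r))))
         = (LBINT s. (indicator {0..t} r * H r) * (indicator {r..t} s *\<^sub>R (c * exp (- c * (s - r)))))"
        by (intro Bochner_Integration.integral_cong) (auto simp: E_def indicator_def)
      then show "(LBINT s. indicator {0..t} s *\<^sub>R (indicator {0..t} r *\<^sub>R (c * (E s r * H r))))
         = indicator {0..t} r *\<^sub>R (LBINT s:{r..t}. c * exp (- c * (s - r))) * H r"
        unfolding set_lebesgue_integral_def by simp
    qed
    also have "\<dots> = (LBINT r:{0..t}. (1 - exp (- c * (t - r))) * H r)"
      unfolding set_lebesgue_integral_def[of _ "{0..t}"]
      using set_integral_exp_Icc[of _ t c]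
      by (intro Bochner_Integration.integral_cong) (auto simp: indicator_def)
    finally show ?thesis .
  qed
  have int_E: "set_integrable lborel {0..t} (\<lambda>s. LBINT r:{0..t}. E s r * H r)"
  proof -
    have "set_integrable lborel {0..t} (\<lambda>s. bm_sg (t - s) (v s) x - exp (- c * s) * bm_sg t g x)"
      by (rule set_integral_diff(1)[OF int_v]) (auto intro!: borel_integrable_atLeastAtMost' continuous_intros)
    then show ?thesis
      by (rule set_integrable_cong[THEN iffD1, rotated -1]) (auto simp: key)
  qed
  have "(LBINT s:{0..t}. c * bm_sg (t - s) (v s) x)
     = (LBINT s:{0..t}. (c * exp (- c * (s - 0))) * bm_sg t g x + c * (LBINT r:{0..t}. E s r * H r))"
    by (intro set_lebesgue_integral_cong) (auto simp: key algebra_simps)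
  also have "\<dots> = (LBINT s:{0..t}. (c * exp (- c * (s - 0))) * bm_sg t g x) + (LBINT s:{0..t}. c * (LBINT r:{0..t}. E s r * H r))"
    by (rule set_integral_add(2)[OF borel_integrable_atLeastAtMost' set_integrable_mult_right])
       (auto intro!: continuous_intros int_E)
  also have "(LBINT s:{0..t}. (c * exp (- c * (s - 0))) * bm_sg t g x) = (1 - exp (- c * t)) * bm_sg t g x"
    using set_integral_exp_Icc[of 0 t c] t by simp
  also note swap
  finally have I: "(LBINT s:{0..t}. c * bm_sg (t - s) (v s) x)
     = (1 - exp (- c * t)) * bm_sg t g x + (LBINT r:{0..t}. (1 - exp (- c * (t - r))) * H r)" .
  have int_eH: "set_integrable lborel {0..t} (\<lambda>r. exp (- c * (t - r)) * H r)"
    unfolding H_def by (rule duhamel_integrand_integrable)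
  have II: "(LBINT r:{0..t}. (1 - exp (- c * (t - r))) * H r) = (LBINT r:{0..t}. H r) - (LBINT r:{0..t}. exp (- c * (t - r)) * H r)"
    unfolding left_diff_distrib mult_1_left using int_H int_eH by (rule set_integral_diff(2))
  have "duhamel 0 g (\<lambda>s y. h s y - c * v s y) t x = bm_sg t g x + (LBINT s:{0..t}. H s - c * bm_sg (t - s) (v s) x)"
  proof -
    have "bm_sg (t - s) (\<lambda>y. h s y - c * v s y) x = H s - c * bm_sg (t - s) (v s) x" for s
    proof -
      have "bm_sg (t - s) (\<lambda>y. h s y - c * v s y) x = bm_sg (t - s) (h s) x - bm_sg (t - s) (\<lambda>y. c * v s y) x"
        using vB by (intro bm_sg_diff[where B = B and C = "\<bar>c\<bar> * C"] hB) (auto simp: abs_mult mult_left_mono)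
      then show ?thesis by (simp add: H_def)
    qed
    then show ?thesis by (simp add: duhamel_def)
  qed
  also have "\<dots> = bm_sg t g x + ((LBINT s:{0..t}. H s) - (LBINT s:{0..t}. c * bm_sg (t - s) (v s) x))"
    using int_H int_v by (subst set_integral_diff(2)) auto
  also have "\<dots> = exp (- c * t) * bm_sg t g x + (LBINT r:{0..t}. exp (- c * (t - r)) * H r)"
    unfolding I II by (simp add: algebra_simps)
  also have "\<dots> = v t x"
    unfolding v[OF t] duhamel_def H_def ..
  finally show ?thesis by simp
qed

end

lemma duhamel_mono:
  assumes g: "g \<in> borel_measurable borel" "\<And>x. \<bar>g x\<bar> \<le> B"
    and g': "g' \<in> borel_measurable borel" "\<And>x. \<bar>g' x\<bar> \<le> B"
    and h: "jointly_borel h" "\<And>s x. \<bar>h s x\<bar> \<le> B"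
    and h': "jointly_borel h'" "\<And>s x. \<bar>h' s x\<bar> \<le> B"
    and le: "\<And>x. g x \<le> g' x" "\<And>s x. 0 \<le> s \<Longrightarrow> h s x \<le> h' s x"
  shows "duhamel c g h t x \<le> duhamel c g' h' t x"
  unfolding duhamel_def
proof (intro add_mono mult_left_mono bm_sg_mono[where B = B] set_integral_mono)
  show "set_integrable lborel {0..t} (\<lambda>s. exp (- c * (t - s)) * bm_sg (t - s) (h s) x)"
    using g h by (rule duhamel_integrand_integrable)
  show "set_integrable lborel {0..t} (\<lambda>s. exp (- c * (t - s)) * bm_sg (t - s) (h' s) x)"
    using g h' by (rule duhamel_integrand_integrable)
  note [measurable] = h(1) h'(1)
  show "h s \<in> borel_measurable borel" "h' s \<in> borel_measurable borel" for s by measurable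
qed (use assms in auto)

lemma duhamel_tendsto:
  assumes g: "g \<in> borel_measurable borel"
    and h[measurable]: "\<And>k. jointly_borel (h k)"
    and h'[measurable]: "jointly_borel h'"
    and hB: "\<And>k s x. \<bar>h k s x\<bar> \<le> B"
    and lim: "\<And>s x. (\<lambda>k. h k s x) \<longlonglongrightarrow> h' s x"
  shows "(\<lambda>k. duhamel c g (h k) t x) \<longlonglongrightarrow> duhamel c g h' t x"
proof -
  have hB': "\<bar>h' s x\<bar> \<le> B" for s x
    using lim[of s x] hB by (intro LIMSEQ_le_const2[OF tendsto_rabs]) auto
  have bm: "(\<lambda>k. bm_sg r (h k s) y) \<longlonglongrightarrow> bm_sg r (h' s) y" for r s y
    unfolding bm_sg_def
    by (rule integral_dominated_convergence[where w = "\<lambda>_. B"]) (auto simp: lim hB)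
  have "(\<lambda>k. LBINT s:{0..t}. exp (- c * (t - s)) * bm_sg (t - s) (h k s) x)
      \<longlonglongrightarrow> (LBINT s:{0..t}. exp (- c * (t - s)) * bm_sg (t - s) (h' s) x)"
    unfolding set_lebesgue_integral_def
  proof (rule integral_dominated_convergence[where w = "\<lambda>s. indicator {0..t} s *\<^sub>R (exp (- c * (t - s)) * B)"])
    show "integrable lborel (\<lambda>s. indicator {0..t} s *\<^sub>R (exp (- c * (t - s)) * B))"
      using borel_integrable_atLeastAtMost'[of 0 t "\<lambda>s. exp (- c * (t - s)) * B"]
      by (simp add: set_integrable_def continuous_intros)
    show "AE s in lborel. (\<lambda>k. indicat_real {0..t} s *\<^sub>R (exp (- c * (t - s)) * bm_sg (t - s) (h k s) x))
        \<longlonglongrightarrow> indicat_real {0..t} s *\<^sub>R (exp (- c * (t - s)) * bm_sg (t - s) (h' s) x)"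
      by (intro AE_I2 tendsto_intros bm)
    show "AE s in lborel. norm (indicat_real {0..t} s *\<^sub>R (exp (- c * (t - s)) * bm_sg (t - s) (h k s) x))
        \<le> indicator {0..t} s *\<^sub>R (exp (- c * (t - s)) * B)" for k
      using bm_sg_abs_le[OF _ hB[of k]] h by (intro AE_I2) (auto simp: indicator_def abs_mult)
  qed measurable
  then show ?thesis
    unfolding duhamel_def by (intro tendsto_intros)
qed

section \<open>Estimates for the branching mechanism\<close>

locale branching =
  fixes \<beta> \<alpha> :: real and n :: "real measure"
  assumes \<beta>_pos: "0 < \<beta>" and \<alpha>_pos: "0 < \<alpha>"
    and sets_n [measurable_cong, simp]: "sets n = sets borel"
    and sigma_finite_n: "sigma_finite_measure n"
    and n_nonpos: "emeasure n {..0} = 0"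
    and n_moment: "(\<integral>\<^sup>+ y. ennreal (min (y\<^sup>2) y) \<partial>n) < \<infinity>"
begin

sublocale n: sigma_finite_measure n by (rule sigma_finite_n)

abbreviation \<psi> :: "real \<Rightarrow> real" where "\<psi> \<equiv> psi \<beta> \<alpha> n"

lemma space_n [simp]: "space n = UNIV"
  using sets_eq_imp_space_eq[OF sets_n] by simp

lemma AE_n_pos: "AE y in n. 0 < y"
  using n_nonpos by (intro AE_I[where N = "{..0}"]) auto

lemma integrable_min: "integrable n (\<lambda>y. min (y\<^sup>2) y)"
proof (rule integrableI_nonneg)
  show "AE y in n. 0 \<le> min (y\<^sup>2) y" using AE_n_pos by eventually_elim auto
qed (use n_moment in \<open>auto simp: less_top\<close>)

definition n_mass :: real where "n_mass = (\<integral>y. min (y\<^sup>2) y \<partial>n)"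

lemma n_mass_nonneg: "0 \<le> n_mass"
  unfolding n_mass_def using AE_n_pos by (intro integral_nonneg_AE) auto

text \<open>The function u -> exp (- u y) - 1 + u y is increasing and convex, so an increment is at
  most the length times the derivative y (1 - exp (- v y)) at the right end. Both bounds reduce to
  exp z >= 1 + z with z = - d and z = d, d = (v - u) y.\<close>

lemma jump_diff_bounds:
  fixes u v y :: real
  assumes "0 \<le> u" "u \<le> v" "0 < y"
  shows "0 \<le> (exp (- v * y) - 1 + v * y) - (exp (- u * y) - 1 + u * y)"
    and "(exp (- v * y) - 1 + v * y) - (exp (- u * y) - 1 + u * y) \<le> (v - u) * (y * (1 - exp (- v * y)))"
proof -
  let ?d = "(v - u) * y"
  have d: "0 \<le> ?d" using assms by simp
  have "exp (- v * y) = exp (- u * y) * exp (- ?d)"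
    by (simp add: exp_add[symmetric] algebra_simps)
  moreover have "exp (- u * y) * (1 - ?d) \<le> exp (- u * y) * exp (- ?d)"
    using exp_ge_add_one_self[of "- ?d"] by (intro mult_left_mono) auto
  moreover have "exp (- u * y) * ?d \<le> 1 * ?d"
    using assms d by (intro mult_right_mono) auto
  ultimately show "0 \<le> (exp (- v * y) - 1 + v * y) - (exp (- u * y) - 1 + u * y)"
    by (simp add: algebra_simps)
  have "exp (- u * y) = exp (- v * y) * exp ?d"
    by (simp add: exp_add[symmetric] algebra_simps)
  moreover have "exp (- v * y) * (1 + ?d) \<le> exp (- v * y) * exp ?d"
    using exp_ge_add_one_self[of ?d] by (intro mult_left_mono) auto
  ultimately show "(exp (- v * y) - 1 + v * y) - (exp (- u * y) - 1 + u * y) \<le> (v - u) * (y * (1 - exp (- v * y)))"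
    by (simp add: algebra_simps)
qed

text \<open>1 - exp (- v y) is at most v y and at most 1, so the jump part of the derivative of
  \<psi> is controlled by the moment assumption on n; the factor 1 + v covers both cases.\<close>

lemma size_biased_bounds:
  fixes v y :: real
  assumes "0 \<le> v" "0 < y"
  shows "0 \<le> y * (1 - exp (- v * y))" and "y * (1 - exp (- v * y)) \<le> (1 + v) * min (y\<^sup>2) y"
proof -
  show "0 \<le> y * (1 - exp (- v * y))" using assms by simp
  have "1 - exp (- v * y) \<le> v * y" using exp_ge_add_one_self[of "- v * y"] by simp
  then have "y * (1 - exp (- v * y)) \<le> y * (v * y)" using assms by (intro mult_left_mono) auto
  also have "\<dots> = v * y\<^sup>2" by (simp add: power2_eq_square)
  also have "\<dots> \<le> (1 + v) * y\<^sup>2" using assms by (intro mult_right_mono) auto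
  finally have 1: "y * (1 - exp (- v * y)) \<le> (1 + v) * y\<^sup>2" .
  have "y * (1 - exp (- v * y)) \<le> y * 1" using assms by (intro mult_left_mono) auto
  also have "\<dots> \<le> (1 + v) * y" using assms by (simp add: algebra_simps)
  finally show "y * (1 - exp (- v * y)) \<le> (1 + v) * min (y\<^sup>2) y" using 1 by (simp add: min_def)
qed

lemma integrable_size_biased: "0 \<le> v \<Longrightarrow> integrable n (\<lambda>y. y * (1 - exp (- v * y)))"
proof (rule Bochner_Integration.integrable_bound[OF integrable_mult_right[OF integrable_min, of "1 + v"]])
  assume v: "0 \<le> v"
  show "AE y in n. norm (y * (1 - exp (- v * y))) \<le> norm ((1 + v) * min (y\<^sup>2) y)"
    using AE_n_pos
  proof eventually_elim
    fix y :: real assume "0 < y"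
    with size_biased_bounds[OF v] show "norm (y * (1 - exp (- v * y))) \<le> norm ((1 + v) * min (y\<^sup>2) y)"
      by (metis abs_ge_self abs_of_nonneg order_trans real_norm_def)
  qed
qed auto

lemma integrable_jump: "0 \<le> u \<Longrightarrow> integrable n (\<lambda>y. exp (- u * y) - 1 + u * y)"
proof (rule Bochner_Integration.integrable_bound[OF integrable_mult_right[OF integrable_size_biased, of u u]])
  assume "0 \<le> u"
  show "AE y in n. norm (exp (- u * y) - 1 + u * y) \<le> norm (u * (y * (1 - exp (- u * y))))"
    using AE_n_pos
  proof eventually_elim
    fix y :: real assume "0 < y"
    with jump_diff_bounds[of 0 u y] \<open>0 \<le> u\<close>
    show "norm (exp (- u * y) - 1 + u * y) \<le> norm (u * (y * (1 - exp (- u * y))))" by simp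
  qed
qed auto

lemma psi_diff_lower:
  assumes "0 \<le> u" "u \<le> v"
  shows "- \<beta> * (v - u) \<le> \<psi> v - \<psi> u"
proof -
  have "(\<integral>y. exp (- u * y) - 1 + u * y \<partial>n) \<le> (\<integral>y. exp (- v * y) - 1 + v * y \<partial>n)"
  proof (rule integral_mono_AE)
    show "AE y in n. exp (- u * y) - 1 + u * y \<le> exp (- v * y) - 1 + v * y"
      using AE_n_pos
    proof eventually_elim
      fix y :: real assume "0 < y"
      with jump_diff_bounds(1)[OF assms] show "exp (- u * y) - 1 + u * y \<le> exp (- v * y) - 1 + v * y"
        by (simp only: diff_ge_0_iff_ge)
    qed
  qed (intro integrable_jump, use assms in simp)+
  moreover have "\<alpha> * u\<^sup>2 \<le> \<alpha> * v\<^sup>2" using assms \<alpha>_pos by (simp add: power_mono)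
  ultimately show ?thesis unfolding psi_def by (simp add: algebra_simps)
qed

lemma psi_0 [simp]: "\<psi> 0 = 0"
  by (simp add: psi_def)

text \<open>Convexity, with the derivative taken at the upper end. The integral is left unestimated
  because it tends to 0 with v, which the cruder bound by \<open>n_mass\<close> would lose.\<close>

lemma psi_diff_upper_size_biased:
  assumes "0 \<le> u" "u \<le> v"
  shows "\<psi> v - \<psi> u
    \<le> (v - u) * (- \<beta> + \<alpha> * (u + v) + (\<integral>y. y * (1 - exp (- v * y)) \<partial>n))"
proof -
  have "(\<integral>y. exp (- v * y) - 1 + v * y \<partial>n) - (\<integral>y. exp (- u * y) - 1 + u * y \<partial>n)
      = (\<integral>y. (exp (- v * y) - 1 + v * y) - (exp (- u * y) - 1 + u * y) \<partial>n)"
    using assms by (intro Bochner_Integration.integral_diff[symmetric] integrable_jump) auto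
  also have "\<dots> \<le> (\<integral>y. (v - u) * (y * (1 - exp (- v * y))) \<partial>n)"
    using assms AE_n_pos jump_diff_bounds(2)[OF assms]
    by (intro integral_mono_AE integrable_mult_right integrable_size_biased Bochner_Integration.integrable_diff integrable_jump)
       (auto elim!: eventually_mono)
  also have "\<dots> = (v - u) * (\<integral>y. y * (1 - exp (- v * y)) \<partial>n)" by simp
  finally show ?thesis unfolding psi_def by (simp add: algebra_simps power2_eq_square)
qed

text \<open>A one-sided Lipschitz constant of \<psi> on [0, \<Lambda>]; it becomes the killing rate
  of the iteration.\<close>

definition psi_lip :: "real \<Rightarrow> real" where
  "psi_lip \<Lambda> = 2 * \<alpha> * \<Lambda> + (1 + \<Lambda>) * n_mass"

lemma psi_lip_nonneg: "0 \<le> \<Lambda> \<Longrightarrow> 0 \<le> psi_lip \<Lambda>"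
  unfolding psi_lip_def using \<alpha>_pos n_mass_nonneg by auto

lemma psi_diff_upper:
  assumes "0 \<le> u" "u \<le> v" "v \<le> \<Lambda>"
  shows "\<psi> v - \<psi> u \<le> psi_lip \<Lambda> * (v - u)"
proof -
  have "(\<integral>y. y * (1 - exp (- v * y)) \<partial>n) \<le> (\<integral>y. (1 + v) * min (y\<^sup>2) y \<partial>n)"
    using assms AE_n_pos size_biased_bounds(2)[of v]
    by (intro integral_mono_AE integrable_size_biased integrable_mult_right integrable_min) (auto elim!: eventually_mono)
  also have "\<dots> = (1 + v) * n_mass" by (simp add: n_mass_def)
  also have "\<dots> \<le> (1 + \<Lambda>) * n_mass" using assms n_mass_nonneg by (intro mult_right_mono) auto
  finally have "(v - u) * (- \<beta> + \<alpha> * (u + v) + (\<integral>y. y * (1 - exp (- v * y)) \<partial>n)) \<le> (v - u) * psi_lip \<Lambda>"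
  proof (intro mult_left_mono)
    assume I: "(\<integral>y. y * (1 - exp (- v * y)) \<partial>n) \<le> (1 + \<Lambda>) * n_mass"
    have "\<alpha> * (u + v) \<le> \<alpha> * (2 * \<Lambda>)" using assms \<alpha>_pos by (intro mult_left_mono) auto
    then have "\<alpha> * (u + v) \<le> 2 * \<alpha> * \<Lambda>" by (simp only: mult_ac)
    with I \<beta>_pos show "- \<beta> + \<alpha> * (u + v) + (\<integral>y. y * (1 - exp (- v * y)) \<partial>n) \<le> psi_lip \<Lambda>"
      unfolding psi_lip_def by linarith
  qed (use assms in simp)
  with psi_diff_upper_size_biased[OF assms(1,2)] show ?thesis by (simp add: mult.commute)
qed

lemma psi_ge_logistic:
  assumes "0 \<le> u"
  shows "- \<beta> * u + \<alpha> * u\<^sup>2 \<le> \<psi> u"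
proof -
  have "0 \<le> (\<integral>y. exp (- u * y) - 1 + u * y \<partial>n)"
  proof (rule integral_nonneg_AE)
    show "AE y in n. 0 \<le> exp (- u * y) - 1 + u * y"
      using AE_n_pos
    proof eventually_elim
      fix y :: real assume "0 < y"
      with jump_diff_bounds(1)[of 0 u y] assms show "0 \<le> exp (- u * y) - 1 + u * y" by simp
    qed
  qed
  then show ?thesis unfolding psi_def by simp
qed

text \<open>The right derivative of \<psi> at 0 is - \<beta>: by dominated convergence the jump part
  K v of the derivative vanishes as v decreases to 0.\<close>

lemma psi_le_linear_near_0:
  assumes "0 < \<eta>"
  obtains \<epsilon> where "0 < \<epsilon>" "\<And>u. 0 \<le> u \<Longrightarrow> u \<le> \<epsilon> \<Longrightarrow> \<psi> u \<le> (- \<beta> + \<eta>) * u"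
proof -
  define K where "K v = (\<integral>y. y * (1 - exp (- v * y)) \<partial>n)" for v
  have "(\<lambda>k. K (1 / Suc k)) \<longlonglongrightarrow> (\<integral>y. y * (1 - exp (- 0 * y)) \<partial>n)"
    unfolding K_def
  proof (rule integral_dominated_convergence[where w = "\<lambda>y. 2 * min (y\<^sup>2) y"])
    show "integrable n (\<lambda>y. 2 * min (y\<^sup>2) y)" by (intro integrable_mult_right integrable_min)
    have "(\<lambda>k. 1 / real (Suc k)) \<longlonglongrightarrow> 0" by (rule LIMSEQ_Suc[OF lim_1_over_n])
    then show "AE y in n. (\<lambda>k. y * (1 - exp (- (1 / Suc k) * y))) \<longlonglongrightarrow> y * (1 - exp (- 0 * y))"
      by (intro AE_I2 tendsto_intros)
    show "AE y in n. norm (y * (1 - exp (- (1 / Suc k) * y))) \<le> 2 * min (y\<^sup>2) y" for k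
      using AE_n_pos
    proof eventually_elim
      fix y :: real assume y: "0 < y"
      have "y * (1 - exp (- (1 / Suc k) * y)) \<le> (1 + 1 / Suc k) * min (y\<^sup>2) y"
        using y by (intro size_biased_bounds) auto
      also have "\<dots> \<le> 2 * min (y\<^sup>2) y"
        using y by (intro mult_right_mono) (auto simp: divide_simps)
      finally show "norm (y * (1 - exp (- (1 / Suc k) * y))) \<le> 2 * min (y\<^sup>2) y"
        using size_biased_bounds(1)[of "1 / Suc k" y] y by simp
    qed
  qed auto
  then have "(\<lambda>k. K (1 / Suc k)) \<longlonglongrightarrow> 0" by simp
  then have "\<forall>\<^sub>F k in sequentially. K (1 / Suc k) < \<eta> / 2"
    using assms by (intro order_tendstoD(2)) auto
  then obtain k where k: "K (1 / Suc k) < \<eta> / 2"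
    by (auto simp: eventually_sequentially)
  \<comment> \<open>Half of \<eta> is spent on the jump part, which is monotone in u, and half on
    \<alpha> u.\<close>
  define \<epsilon> where "\<epsilon> = min (1 / Suc k) (\<eta> / (2 * \<alpha>))"
  show thesis
  proof (rule that)
    show "0 < \<epsilon>" using assms \<alpha>_pos by (simp add: \<epsilon>_def)
    fix u assume u: "0 \<le> u" "u \<le> \<epsilon>"
    have "K u \<le> K (1 / Suc k)"
      unfolding K_def
    proof (rule integral_mono_AE)
      show "AE y in n. y * (1 - exp (- u * y)) \<le> y * (1 - exp (- (1 / Suc k) * y))"
        using AE_n_pos
      proof eventually_elim
        fix y :: real assume "0 < y"
        moreover have "u \<le> 1 / Suc k" using u by (simp add: \<epsilon>_def)
        ultimately have "u * y \<le> 1 / Suc k * y" by (intro mult_right_mono) auto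
        then show "y * (1 - exp (- u * y)) \<le> y * (1 - exp (- (1 / Suc k) * y))"
          using \<open>0 < y\<close> by (intro mult_left_mono) auto
      qed
    qed (intro integrable_size_biased, use u in simp)+
    moreover have "\<alpha> * u \<le> \<eta> / 2"
      using u \<alpha>_pos by (simp add: \<epsilon>_def field_simps)
    ultimately have "- \<beta> + \<alpha> * (0 + u) + K u \<le> - \<beta> + \<eta>" using k by simp
    then have "(u - 0) * (- \<beta> + \<alpha> * (0 + u) + K u) \<le> u * (- \<beta> + \<eta>)"
      using u by (simp add: mult_left_mono)
    with psi_diff_upper_size_biased[of 0 u, folded K_def] u show "\<psi> u \<le> (- \<beta> + \<eta>) * u"
      by (simp add: mult.commute)
  qed
qed

lemma psi_measurable [measurable]: "\<psi> \<in> borel_measurable borel"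
  unfolding psi_def[abs_def] by measurable

lemma psi_abs_le:
  assumes "0 \<le> u" "u \<le> \<Lambda>"
  shows "\<bar>\<psi> u\<bar> \<le> (\<beta> + psi_lip \<Lambda>) * \<Lambda>"
proof -
  have L: "0 \<le> psi_lip \<Lambda>" using assms by (intro psi_lip_nonneg) simp
  have "- \<beta> * u \<le> \<psi> u" "\<psi> u \<le> psi_lip \<Lambda> * u"
    using psi_diff_lower[of 0 u] psi_diff_upper[of 0 u \<Lambda>] assms by auto
  moreover have "\<beta> * u \<le> \<beta> * \<Lambda>" "psi_lip \<Lambda> * u \<le> psi_lip \<Lambda> * \<Lambda>"
    using assms \<beta>_pos L by (auto intro!: mult_left_mono)
  moreover have "0 \<le> \<beta> * \<Lambda>" "0 \<le> psi_lip \<Lambda> * \<Lambda>" using assms \<beta>_pos L by auto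
  ultimately show ?thesis by (simp add: distrib_right abs_le_iff)
qed

section \<open>Mild solutions by monotone iteration\<close>

text \<open>Set to 0 at negative times, where v is uncontrolled, so that it is bounded on the whole
  plane, as the monotonicity and convergence lemmas for \<open>duhamel\<close> require.\<close>

definition source :: "real \<Rightarrow> (real \<Rightarrow> real \<Rightarrow> real) \<Rightarrow> real \<Rightarrow> real \<Rightarrow> real" where
  "source c v s y = (if 0 \<le> s then c * v s y - \<psi> (v s y) else 0)"

definition mild_step :: "real \<Rightarrow> (real \<Rightarrow> real) \<Rightarrow> (real \<Rightarrow> real \<Rightarrow> real) \<Rightarrow> real \<Rightarrow> real \<Rightarrow> real" where
  "mild_step \<Lambda> g v = duhamel (psi_lip \<Lambda>) g (source (psi_lip \<Lambda>) v)"

definition admissible :: "real \<Rightarrow> (real \<Rightarrow> real \<Rightarrow> real) \<Rightarrow> bool" where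
  "admissible \<Lambda> v \<longleftrightarrow> jointly_borel v
     \<and> (\<forall>s y. 0 \<le> s \<longrightarrow> 0 \<le> v s y \<and> v s y \<le> \<Lambda>)"

lemma source_measurable:
  assumes "admissible \<Lambda> v"
  shows "jointly_borel (source c v)"
proof -
  have [measurable]: "jointly_borel v"
    using assms by (simp add: admissible_def)
  show ?thesis unfolding source_def split_beta' by measurable
qed

text \<open>The last summand \<Lambda> lets one constant bound both the source and the initial
  datum.\<close>

definition source_bound :: "real \<Rightarrow> real" where
  "source_bound \<Lambda> = psi_lip \<Lambda> * \<Lambda> + (\<beta> + psi_lip \<Lambda>) * \<Lambda> + \<Lambda>"

lemma source_abs_le:
  assumes "admissible \<Lambda> v" "0 \<le> \<Lambda>"
  shows "\<bar>source (psi_lip \<Lambda>) v s y\<bar> \<le> source_bound \<Lambda>"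
proof (cases "0 \<le> s")
  case True
  have v: "0 \<le> v s y" "v s y \<le> \<Lambda>" using assms True by (auto simp: admissible_def)
  have "\<bar>psi_lip \<Lambda> * v s y\<bar> \<le> psi_lip \<Lambda> * \<Lambda>"
    using v psi_lip_nonneg[OF assms(2)] by (simp add: abs_mult mult_left_mono)
  with psi_abs_le[OF v] True assms(2) show ?thesis by (simp add: source_def source_bound_def)
next
  case False
  then show ?thesis using assms(2) psi_lip_nonneg[OF assms(2)] \<beta>_pos by (simp add: source_def source_bound_def)
qed

text \<open>Here the killing rate pays off: the increase of \<psi> is at most c (w - v), so c u -
  \<psi>(u) is increasing.\<close>

lemma source_mono:
  assumes "admissible \<Lambda> v" "admissible \<Lambda> w" "\<And>s y. 0 \<le> s \<Longrightarrow> v s y \<le> w s y"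
  shows "source (psi_lip \<Lambda>) v s y \<le> source (psi_lip \<Lambda>) w s y"
  using assms psi_diff_upper[of "v s y" "w s y" \<Lambda>]
  by (auto simp: source_def admissible_def algebra_simps)

lemma Lambda_le_source_bound: "0 \<le> \<Lambda> \<Longrightarrow> \<Lambda> \<le> source_bound \<Lambda>"
  using psi_lip_nonneg[of \<Lambda>] \<beta>_pos by (simp add: source_bound_def)

lemma mild_step_mono:
  assumes "admissible \<Lambda> v" "admissible \<Lambda> w" "\<And>s y. 0 \<le> s \<Longrightarrow> v s y \<le> w s y" "0 \<le> \<Lambda>"
    and g: "g \<in> borel_measurable borel" "\<And>x. 0 \<le> g x" "\<And>x. g x \<le> \<Lambda>"
  shows "mild_step \<Lambda> g v t x \<le> mild_step \<Lambda> g w t x"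
proof -
  have gB: "\<bar>g x\<bar> \<le> source_bound \<Lambda>" for x
    using g(2,3)[of x] Lambda_le_source_bound[OF assms(4)] by linarith
  show ?thesis unfolding mild_step_def
    by (intro duhamel_mono[where B = "source_bound \<Lambda>"] source_measurable[of \<Lambda>] source_abs_le source_mono assms g gB order_refl)
qed

text \<open>The bound C also covers negative times; the solutions constructed below are 0
  there.\<close>

definition mild_solution :: "(real \<Rightarrow> real) \<Rightarrow> (real \<Rightarrow> real \<Rightarrow> real) \<Rightarrow> real \<Rightarrow> bool" where
  "mild_solution g v C \<longleftrightarrow> g \<in> borel_measurable borel
     \<and> jointly_borel v
     \<and> (\<forall>s y. \<bar>v s y\<bar> \<le> C) \<and> (\<forall>s y. 0 \<le> s \<longrightarrow> 0 \<le> v s y)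
     \<and> (\<forall>t x. 0 \<le> t \<longrightarrow> v t x = duhamel 0 g (\<lambda>s y. - \<psi> (v s y)) t x)"

lemma mild_solutionD:
  assumes "mild_solution g v C"
  shows "g \<in> borel_measurable borel" "jointly_borel v"
    "\<And>s y. \<bar>v s y\<bar> \<le> C" "\<And>s y. 0 \<le> s \<Longrightarrow> 0 \<le> v s y"
    "\<And>t x. 0 \<le> t \<Longrightarrow> v t x = duhamel 0 g (\<lambda>s y. - \<psi> (v s y)) t x"
    "v t \<in> borel_measurable borel"
proof -
  show v: "jointly_borel v" using assms by (simp add: mild_solution_def)
  note v[measurable]
  show "v t \<in> borel_measurable borel" by measurable
qed (use assms in \<open>unfold mild_solution_def, blast\<close>)+

text \<open>Monotone iteration: with the killing rate psi_lip the source term is increasing in the solution,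
  so a mild subsolution iterates upwards to a fixed point below every mild supersolution.\<close>

theorem ex_mild_solution_between:
  assumes lo: "admissible \<Lambda> lo" and hi: "admissible \<Lambda> hi" and \<Lambda>: "0 \<le> \<Lambda>"
    and le: "\<And>s y. 0 \<le> s \<Longrightarrow> lo s y \<le> hi s y"
    and g: "g \<in> borel_measurable borel" "\<And>x. 0 \<le> g x" "\<And>x. g x \<le> \<Lambda>"
    and sub: "\<And>t x. 0 \<le> t \<Longrightarrow> lo t x \<le> mild_step \<Lambda> g lo t x"
    and super: "\<And>t x. 0 \<le> t \<Longrightarrow> mild_step \<Lambda> g hi t x \<le> hi t x"
  obtains v where "mild_solution g v \<Lambda>"
    "\<And>s y. 0 \<le> s \<Longrightarrow> lo s y \<le> v s y" "\<And>s y. 0 \<le> s \<Longrightarrow> v s y \<le> hi s y"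
proof -
  define V where "V = rec_nat lo (\<lambda>_ v. mild_step \<Lambda> g v)"
  have V0: "V 0 = lo" and VS: "V (Suc k) = mild_step \<Lambda> g (V k)" for k by (auto simp: V_def)
  have step_adm: "admissible \<Lambda> (mild_step \<Lambda> g v)"
    if "admissible \<Lambda> v" "\<And>s y. 0 \<le> s \<Longrightarrow> lo s y \<le> v s y" "\<And>s y. 0 \<le> s \<Longrightarrow> v s y \<le> hi s y" for v
    unfolding admissible_def
  proof (intro conjI allI impI)
    show "jointly_borel (mild_step \<Lambda> g v)"
      unfolding mild_step_def by (intro duhamel_measurable g source_measurable[of \<Lambda>] that)
    fix s y :: real assume s: "0 \<le> s"
    have "0 \<le> lo s y" using lo s by (simp add: admissible_def)
    also have "\<dots> \<le> mild_step \<Lambda> g lo s y" using sub s by simp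
    also have "\<dots> \<le> mild_step \<Lambda> g v s y" by (intro mild_step_mono lo that \<Lambda> g)
    finally show "0 \<le> mild_step \<Lambda> g v s y" .
    have "mild_step \<Lambda> g v s y \<le> mild_step \<Lambda> g hi s y" by (intro mild_step_mono hi that \<Lambda> g)
    also have "\<dots> \<le> hi s y" using super s by simp
    also have "\<dots> \<le> \<Lambda>" using hi s by (simp add: admissible_def)
    finally show "mild_step \<Lambda> g v s y \<le> \<Lambda>" .
  qed
  have V: "admissible \<Lambda> (V k) \<and> (\<forall>s y. 0 \<le> s \<longrightarrow> lo s y \<le> V k s y \<and> V k s y \<le> hi s y)" for k
  proof (induction k)
    case 0
    show ?case using lo le by (simp add: V0)
  next
    case (Suc k)
    have "lo s y \<le> V (Suc k) s y \<and> V (Suc k) s y \<le> hi s y" if s: "0 \<le> s" for s y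
    proof
      have "lo s y \<le> mild_step \<Lambda> g lo s y" using sub s by simp
      also have "\<dots> \<le> mild_step \<Lambda> g (V k) s y" using Suc by (intro mild_step_mono lo \<Lambda> g) auto
      finally show "lo s y \<le> V (Suc k) s y" by (simp add: VS)
      have "mild_step \<Lambda> g (V k) s y \<le> mild_step \<Lambda> g hi s y" using Suc by (intro mild_step_mono hi \<Lambda> g) auto
      also have "\<dots> \<le> hi s y" using super s by simp
      finally show "V (Suc k) s y \<le> hi s y" by (simp add: VS)
    qed
    moreover have "admissible \<Lambda> (V (Suc k))"
      unfolding VS using Suc by (intro step_adm) auto
    ultimately show ?case by blast
  qed
  have Vinc: "V k s y \<le> V (Suc k) s y" if "0 \<le> s" for k s y
    using that
  proof (induction k arbitrary: s y)
    case 0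
    then show ?case using sub by (simp add: V0 VS)
  next
    case (Suc k)
    show ?case unfolding VS[of "Suc k"]
      by (subst VS) (intro mild_step_mono Suc.IH V[THEN conjunct1] \<Lambda> g)
  qed
  have V_le: "V k s y \<le> \<Lambda>" "0 \<le> V k s y" if "0 \<le> s" for k s y
    using V[of k] that by (auto simp: admissible_def)
  define v where "v s y = (if 0 \<le> s then lim (\<lambda>k. V k s y) else 0)" for s y
  have conv: "(\<lambda>k. V k s y) \<longlonglongrightarrow> v s y" if "0 \<le> s" for s y
  proof -
    have "\<exists>L. (\<lambda>k. V k s y) \<longlonglongrightarrow> L"
      using incseq_convergent[of "\<lambda>k. V k s y" \<Lambda>] V_le(1)[OF that] Vinc[OF that]
      by (metis incseq_SucI)
    then have "convergent (\<lambda>k. V k s y)" by (simp add: convergent_def)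
    then show ?thesis using that by (simp add: v_def convergent_LIMSEQ_iff)
  qed
  have V_meas[measurable]: "jointly_borel (V k)" for k
    using V by (simp add: admissible_def)
  have v_meas[measurable]: "jointly_borel v"
    unfolding v_def split_beta' by measurable
  have v_lo: "lo s y \<le> v s y" if "0 \<le> s" for s y
    using V that by (intro LIMSEQ_le_const[OF conv]) auto
  have v_hi: "v s y \<le> hi s y" if "0 \<le> s" for s y
    using V that by (intro LIMSEQ_le_const2[OF conv]) auto
  have v_adm: "admissible \<Lambda> v"
    unfolding admissible_def using v_meas v_lo v_hi lo hi
    by (meson admissible_def order_trans)
  have vB: "\<bar>v s y\<bar> \<le> \<Lambda>" for s y
    using v_adm \<Lambda> by (cases "0 \<le> s") (auto simp: admissible_def v_def)
  have gB: "\<bar>g x\<bar> \<le> source_bound \<Lambda>" for x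
    using g(2,3)[of x] Lambda_le_source_bound[OF \<Lambda>] by linarith
  let ?c = "psi_lip \<Lambda>"
  have fp: "v t x = duhamel ?c g (source ?c v) t x" if t: "0 \<le> t" for t x
  proof (rule LIMSEQ_unique)
    show "(\<lambda>k. V (Suc k) t x) \<longlonglongrightarrow> v t x" using conv[OF t] by (rule LIMSEQ_Suc)
    show "(\<lambda>k. V (Suc k) t x) \<longlonglongrightarrow> duhamel ?c g (source ?c v) t x"
      unfolding VS mild_step_def
    proof (rule duhamel_tendsto[where B = "source_bound \<Lambda>"])
      fix s y :: real
      show "(\<lambda>k. source ?c (V k) s y) \<longlonglongrightarrow> source ?c v s y"
      proof (cases "0 \<le> s")
        case True
        \<comment> \<open>\<open>psi_diff_upper\<close> gives the sign and
          \<open>psi_diff_lower\<close> the rate, so the sources converge along with the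
          iterates.\<close>
        have bnd: "0 \<le> source ?c v s y - source ?c (V k) s y \<and>
            source ?c v s y - source ?c (V k) s y \<le> (?c + \<beta>) * (v s y - V k s y)" for k
        proof -
          have le: "V k s y \<le> v s y"
            using Vinc[OF True] by (intro incseq_le[of "\<lambda>k. V k s y", OF _ conv[OF True]] incseq_SucI)
          then show ?thesis
            using True psi_diff_lower[of "V k s y" "v s y"] psi_diff_upper[of "V k s y" "v s y" \<Lambda>]
              V_le[OF True, of k y] abs_le_D1[OF vB[of s y]]
            unfolding source_def by (simp add: algebra_simps)
        qed
        have "(\<lambda>k. (?c + \<beta>) * (v s y - V k s y)) \<longlonglongrightarrow> (?c + \<beta>) * (v s y - v s y)"
          by (intro tendsto_intros conv True)
        then have lim0: "(\<lambda>k. (?c + \<beta>) * (v s y - V k s y)) \<longlonglongrightarrow> 0" by simp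
        have "(\<lambda>k. source ?c v s y - source ?c (V k) s y) \<longlonglongrightarrow> 0"
          by (rule tendsto_sandwich[OF always_eventually always_eventually tendsto_const lim0])
             (use bnd in blast)+
        from tendsto_diff[OF tendsto_const[of "source ?c v s y"] this] show ?thesis by simp
      qed (simp add: source_def)
    qed (intro g source_measurable[of \<Lambda>] source_abs_le v_adm V[THEN conjunct1] \<Lambda>)+
  qed
  show thesis
  proof (rule that[OF _ v_lo v_hi], unfold mild_solution_def, intro conjI allI impI g(1) v_meas vB)
    show "0 \<le> v s y" if "0 \<le> s" for s y using v_adm that by (simp add: admissible_def)
    fix t x :: real assume t: "0 \<le> t"
    \<comment> \<open>The limit solves the killed equation; removing the killing cancels the c v
      inside the source and leaves - \<psi>(v).\<close>
    have "v t x = duhamel 0 g (\<lambda>s y. source ?c v s y - ?c * v s y) t x"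
      by (rule duhamel_remove_killing[OF g(1) gB source_measurable[OF v_adm] source_abs_le[OF v_adm \<Lambda>] fp v_meas vB t])
    also have "\<dots> = duhamel 0 g (\<lambda>s y. - \<psi> (v s y)) t x"
      by (intro duhamel_cong) (auto simp: source_def)
    finally show "v t x = duhamel 0 g (\<lambda>s y. - \<psi> (v s y)) t x" .
  qed
qed

lemma sbm_sol_of_mild_1d:
  fixes e :: "'a::euclidean_space"
  assumes e: "norm e = 1" and sol: "mild_solution g v C"
  shows "sbm_sol \<beta> \<alpha> n (\<lambda>x::'a. g (x \<bullet> e)) (\<lambda>t x. v t (x \<bullet> e))"
  unfolding sbm_sol_def
proof (intro conjI allI impI)
  note v = mild_solutionD(3,4)[OF sol] and mild = mild_solutionD(5)[OF sol]
    and g[measurable] = mild_solutionD(1)[OF sol] and v_meas[measurable] = mild_solutionD(2)[OF sol]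
  have "(\<lambda>p::real \<times> 'a. (\<lambda>(s, y). v s y) (fst p, snd p \<bullet> e)) \<in> borel_measurable (borel \<Otimes>\<^sub>M borel)"
    by measurable
  then show "(\<lambda>p::real \<times> 'a. v (fst p) (snd p \<bullet> e)) \<in> borel_measurable borel"
    by (simp add: borel_prod)
  show "\<exists>C. \<forall>t\<in>{0..T}. \<forall>x::'a. \<bar>v t (x \<bullet> e)\<bar> \<le> C" for T using v(1) by blast
  fix t :: real and x :: 'a assume t: "0 \<le> t"
  show "0 \<le> v t (x \<bullet> e)" using v(2) t by simp
  have "(LBINT s=0..t. heat_sg (t - s) (\<lambda>y::'a. \<psi> (v s (y \<bullet> e))) x)
     = (LBINT s:{0..t}. heat_sg (t - s) (\<lambda>y::'a. \<psi> (v s (y \<bullet> e))) x)"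
    using t by (simp add: interval_integral_Icc zero_ereal_def)
  also have "\<dots> = (LBINT s:{0..t}. bm_sg (t - s) (\<lambda>y. \<psi> (v s y)) (x \<bullet> e))"
  proof (intro set_lebesgue_integral_cong allI impI)
    fix s assume "s \<in> {0..t}"
    then show "heat_sg (t - s) (\<lambda>y::'a. \<psi> (v s (y \<bullet> e))) x = bm_sg (t - s) (\<lambda>y. \<psi> (v s y)) (x \<bullet> e)"
      by (intro heat_sg_inner[OF e]) auto
  qed simp
  finally show "v t (x \<bullet> e) = heat_sg t (\<lambda>x::'a. g (x \<bullet> e)) x
      - (LBINT s=0..t. heat_sg (t - s) (\<lambda>y::'a. \<psi> (v s (y \<bullet> e))) x)"
    unfolding mild[OF t] duhamel_def by (simp add: heat_sg_inner[OF e t g] set_lebesgue_integral_def)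
qed

end

section \<open>Classical sub- and supersolutions as barriers\<close>

text \<open>W satisfies its own Duhamel formula with source Ws - Wxx / 2 + c W. The differential
  inequality compares this with c W - \<psi>(W), the source of \<open>mild_step\<close>, and
  \<open>duhamel\<close> is monotone in datum and source.\<close>

lemma (in branching) classical_vs_mild_step:
  assumes C12: "bounded_C12 W Ws Wx Wxx B" and \<Lambda>: "0 \<le> \<Lambda>"
    and range: "\<And>s x. 0 \<le> s \<Longrightarrow> 0 \<le> W s x" "\<And>s x. 0 \<le> s \<Longrightarrow> W s x \<le> \<Lambda>"
    and g: "g \<in> borel_measurable borel" "\<And>x. 0 \<le> g x" "\<And>x. g x \<le> \<Lambda>"
    and t: "0 \<le> t"
  shows "(\<And>s x. 0 \<le> s \<Longrightarrow> 0 \<le> Ws s x - Wxx s x / 2 + \<psi> (W s x)) \<Longrightarrow> (\<And>x. g x \<le> W 0 x)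
      \<Longrightarrow> mild_step \<Lambda> g W t x \<le> W t x"
    and "(\<And>s x. 0 \<le> s \<Longrightarrow> Ws s x - Wxx s x / 2 + \<psi> (W s x) \<le> 0) \<Longrightarrow> (\<And>x. W 0 x \<le> g x)
      \<Longrightarrow> W t x \<le> mild_step \<Lambda> g W t x"
    and "admissible \<Lambda> W"
proof -
  interpret bounded_C12 W Ws Wx Wxx B by fact
  show adm: "admissible \<Lambda> W" using meas range by (auto simp: admissible_def)
  let ?c = "psi_lip \<Lambda>"
  define h where "h s y = (if 0 \<le> s then Ws s y - Wxx s y / 2 + ?c * W s y else 0)" for s y
  have h_meas: "jointly_borel h"
    unfolding h_def split_beta' by measurable
  have B0: "0 \<le> B" using B(1)[of 0 0] by linarith
  define D where "D = B + B / 2 + ?c * B + source_bound \<Lambda> + \<Lambda>"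
  have sb: "0 \<le> source_bound \<Lambda>" using Lambda_le_source_bound[OF \<Lambda>] \<Lambda> by linarith
  have c0: "0 \<le> ?c * B" using psi_lip_nonneg[OF \<Lambda>] B0 by simp
  have h_B: "\<bar>h s y\<bar> \<le> D" for s y
  proof (cases "0 \<le> s")
    case True
    have "\<bar>?c * W s y\<bar> \<le> ?c * B" using B(1)[OF True] psi_lip_nonneg[OF \<Lambda>] by (simp add: abs_mult mult_left_mono)
    with B(2,4)[OF True, of y] sb True \<Lambda> show ?thesis unfolding h_def D_def by (simp add: abs_le_iff)
  next
    case False
    with B0 sb c0 \<Lambda> show ?thesis by (simp add: h_def D_def)
  qed
  have W_eq: "W t x = duhamel ?c (W 0) h t x"
    unfolding classical_eq_duhamel[OF t, of x ?c]
    by (intro duhamel_cong) (auto simp: h_def)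
  have W0: "W 0 \<in> borel_measurable borel" by measurable
  have W0_B: "\<bar>W 0 y\<bar> \<le> D" for y using range[of 0 y] B0 sb c0 by (simp add: D_def)
  have g_B: "\<bar>g y\<bar> \<le> D" for y using g(2,3)[of y] B0 sb c0 by (simp add: D_def)
  have s_B: "\<bar>source ?c W s y\<bar> \<le> D" for s y
    using source_abs_le[OF adm \<Lambda>, of s y] B0 c0 \<Lambda> by (simp add: D_def)
  show "mild_step \<Lambda> g W t x \<le> W t x"
    if "\<And>s x. 0 \<le> s \<Longrightarrow> 0 \<le> Ws s x - Wxx s x / 2 + \<psi> (W s x)" "\<And>x. g x \<le> W 0 x"
    unfolding W_eq mild_step_def
  proof (rule duhamel_mono[OF g(1) g_B W0 W0_B source_measurable[OF adm] s_B h_meas h_B that(2)])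
    fix s y :: real assume "0 \<le> s"
    with that(1)[of s y] show "source ?c W s y \<le> h s y" by (simp add: source_def h_def)
  qed
  show "W t x \<le> mild_step \<Lambda> g W t x"
    if "\<And>s x. 0 \<le> s \<Longrightarrow> Ws s x - Wxx s x / 2 + \<psi> (W s x) \<le> 0" "\<And>x. W 0 x \<le> g x"
    unfolding W_eq mild_step_def
  proof (rule duhamel_mono[OF W0 W0_B g(1) g_B h_meas h_B source_measurable[OF adm] s_B that(2)])
    fix s y :: real assume "0 \<le> s"
    with that(1)[of s y] show "h s y \<le> source ?c W s y" by (simp add: source_def h_def)
  qed
qed

text \<open>Supplies the trivial partner of each barrier: 0 below, or a large constant
  above.\<close>

lemma bounded_C12_const: "bounded_C12 (\<lambda>_ _. c) (\<lambda>_ _. 0) (\<lambda>_ _. 0) (\<lambda>_ _. 0) \<bar>c\<bar>"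
  by standard auto

theorem (in branching) ex_mild_solution_between_classical:
  assumes lo: "bounded_C12 lo los lox loxx B" and hi: "bounded_C12 hi his hix hixx B'"
    and \<Lambda>: "0 \<le> \<Lambda>"
    and range: "\<And>s x. 0 \<le> s \<Longrightarrow> 0 \<le> lo s x" "\<And>s x. 0 \<le> s \<Longrightarrow> lo s x \<le> hi s x" "\<And>s x. 0 \<le> s \<Longrightarrow> hi s x \<le> \<Lambda>"
    and sub: "\<And>s x. 0 \<le> s \<Longrightarrow> los s x - loxx s x / 2 + \<psi> (lo s x) \<le> 0"
    and super: "\<And>s x. 0 \<le> s \<Longrightarrow> 0 \<le> his s x - hixx s x / 2 + \<psi> (hi s x)"
    and g: "g \<in> borel_measurable borel" "\<And>x. lo 0 x \<le> g x" "\<And>x. g x \<le> hi 0 x"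
  obtains v where "mild_solution g v \<Lambda>"
    "\<And>s y. 0 \<le> s \<Longrightarrow> lo s y \<le> v s y" "\<And>s y. 0 \<le> s \<Longrightarrow> v s y \<le> hi s y"
proof -
  have lo': "\<And>s x. 0 \<le> s \<Longrightarrow> 0 \<le> lo s x" "\<And>s x. 0 \<le> s \<Longrightarrow> lo s x \<le> \<Lambda>"
    and hi': "\<And>s x. 0 \<le> s \<Longrightarrow> 0 \<le> hi s x" "\<And>s x. 0 \<le> s \<Longrightarrow> hi s x \<le> \<Lambda>"
    using range by (meson order_trans)+
  have g': "0 \<le> g x" "g x \<le> \<Lambda>" for x
    using g(2,3)[of x] lo'(1)[of 0 x] hi'(2)[of 0 x] by linarith+
  show thesis
    using ex_mild_solution_between[OF classical_vs_mild_step(3)[OF lo \<Lambda> lo' g(1) g', of 0]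
        classical_vs_mild_step(3)[OF hi \<Lambda> hi' g(1) g', of 0] \<Lambda> range(2) g(1) g'
        classical_vs_mild_step(2)[OF lo \<Lambda> lo' g(1) g' _ sub g(2)]
        classical_vs_mild_step(1)[OF hi \<Lambda> hi' g(1) g' _ super g(3)]] that
    by blast
qed

section \<open>A smooth cut-off and the reciprocal exponential barrier\<close>

lemma DERIV_max_0_power:
  fixes u :: real
  assumes "2 \<le> k"
  shows "((\<lambda>u. (max 0 u) ^ k) has_real_derivative real k * (max 0 u) ^ (k - 1)) (at u)"
proof -
  consider "u < 0" | "u > 0" | "u = 0" by linarith
  then show ?thesis
  proof cases
    case 1
    have "((\<lambda>u. 0) has_real_derivative 0) (at u)" by simp
    then have "((\<lambda>u. (max 0 u) ^ k) has_real_derivative 0) (at u)"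
      by (rule has_field_derivative_transform_within_open[where S = "{..<0}"]) (use 1 assms in auto)
    with 1 assms show ?thesis by (simp add: power_0_left)
  next
    case 2
    have "((\<lambda>u. u ^ k) has_real_derivative real k * u ^ (k - 1)) (at u)"
      by (auto intro!: derivative_eq_intros)
    then have "((\<lambda>u. (max 0 u) ^ k) has_real_derivative real k * u ^ (k - 1)) (at u)"
      by (rule has_field_derivative_transform_within_open[where S = "{0<..}"]) (use 2 in auto)
    with 2 show ?thesis by simp
  next
    case 3
    have "((\<lambda>h::real. (max 0 h) ^ k / h) \<longlongrightarrow> 0) (at 0)"
    proof (rule Lim_null_comparison)
      have "((\<lambda>h::real. \<bar>h\<bar> ^ (k - 1)) \<longlongrightarrow> \<bar>0\<bar> ^ (k - 1)) (at 0)" by (intro tendsto_intros)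
      then show "((\<lambda>h::real. \<bar>h\<bar> ^ (k - 1)) \<longlongrightarrow> 0) (at 0)" using assms by (simp add: power_0_left)
      have "norm ((max 0 h) ^ k / h) \<le> \<bar>h\<bar> ^ (k - 1)" for h :: real
      proof (cases "0 < h")
        case True
        then show ?thesis using assms by (simp add: power_diff)
      qed (use assms in \<open>simp add: max_def power_0_left\<close>)
      then show "\<forall>\<^sub>F h in at 0. norm ((max 0 h) ^ k / h) \<le> \<bar>h\<bar> ^ (k - 1)" by simp
    qed
    then show ?thesis using 3 assms by (simp add: has_field_derivative_iff power_0_left)
  qed
qed

lemma DERIV_max_0_power_chain:
  fixes f :: "real \<Rightarrow> real"
  assumes "(f has_real_derivative f') (at x)" "2 \<le> k"
  shows "((\<lambda>x. (max 0 (f x)) ^ k) has_real_derivative real k * (max 0 (f x)) ^ (k - 1) * f') (at x)"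
  using DERIV_chain2[OF DERIV_max_0_power[OF assms(2)] assms(1)] .

text \<open>The fourth powers make \<open>ramp\<close> twice continuously differentiable, with the square of the
  derivative bounded by a multiple of \<open>ramp\<close> itself.\<close>

definition ramp_in :: "real \<Rightarrow> real" where "ramp_in z = max 0 (1 - z)"
definition ramp_out :: "real \<Rightarrow> real" where "ramp_out z = max 0 (1 - ramp_in z ^ 4)"
definition ramp :: "real \<Rightarrow> real" where "ramp z = ramp_out z ^ 4"
definition ramp' :: "real \<Rightarrow> real" where "ramp' z = 16 * ramp_out z ^ 3 * ramp_in z ^ 3"
definition ramp'' :: "real \<Rightarrow> real" where
  "ramp'' z = 192 * ramp_out z ^ 2 * ramp_in z ^ 6 - 48 * ramp_out z ^ 3 * ramp_in z ^ 2"

lemma ramp_in_deriv: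
  "2 \<le> k \<Longrightarrow> ((\<lambda>z. ramp_in z ^ k) has_real_derivative - real k * ramp_in z ^ (k - 1)) (at z)"
  unfolding ramp_in_def
  by (rule DERIV_cong[OF DERIV_max_0_power_chain]) (auto intro!: derivative_eq_intros)

lemma ramp_out_deriv:
  "2 \<le> k \<Longrightarrow> ((\<lambda>z. ramp_out z ^ k) has_real_derivative real k * ramp_out z ^ (k - 1) * (4 * ramp_in z ^ 3)) (at z)"
  unfolding ramp_out_def
  by (rule DERIV_cong[OF DERIV_max_0_power_chain[OF DERIV_diff[OF DERIV_const ramp_in_deriv]]]) auto

lemma ramp_deriv: "(ramp has_real_derivative ramp' z) (at z)"
  unfolding ramp_def[abs_def] ramp'_def
  by (rule DERIV_cong[OF ramp_out_deriv]) auto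

lemma ramp'_deriv: "(ramp' has_real_derivative ramp'' z) (at z)"
  unfolding ramp'_def[abs_def] ramp''_def
  by (rule DERIV_cong[OF DERIV_mult[OF DERIV_cmult[OF ramp_out_deriv] ramp_in_deriv]])
     (auto simp: algebra_simps power_add[symmetric])

lemma continuous_ramp: "continuous_on UNIV ramp" "continuous_on UNIV ramp'" "continuous_on UNIV ramp''"
  unfolding ramp_def[abs_def] ramp'_def[abs_def] ramp''_def[abs_def] ramp_out_def ramp_in_def
  by (intro continuous_intros)+

lemma ramp_measurable [measurable]: "ramp \<in> borel_measurable borel" "ramp' \<in> borel_measurable borel"
  "ramp'' \<in> borel_measurable borel"
  using continuous_ramp by (auto intro: borel_measurable_continuous_onI)

lemma ramp_nonpos: "z \<le> 0 \<Longrightarrow> ramp z = 0"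
  unfolding ramp_def ramp_out_def ramp_in_def by simp

lemma ramp_ge_1: "1 \<le> z \<Longrightarrow> ramp z = 1"
  unfolding ramp_def ramp_out_def ramp_in_def by simp

lemma ramp_nonneg: "0 \<le> ramp z"
  unfolding ramp_def ramp_out_def by simp

lemma ramp_out_range: "0 \<le> ramp_out z" "ramp_out z \<le> 1"
  unfolding ramp_out_def by (auto simp: ramp_in_def)

lemma ramp_in_range: "0 \<le> ramp_in z" "ramp_out z \<noteq> 0 \<Longrightarrow> ramp_in z \<le> 1"
proof -
  show "0 \<le> ramp_in z" by (simp add: ramp_in_def)
  show "ramp_in z \<le> 1" if "ramp_out z \<noteq> 0"
  proof (rule ccontr)
    assume "\<not> ramp_in z \<le> 1"
    then have "1 \<le> ramp_in z ^ 4" by (intro one_le_power) auto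
    with that show False by (simp add: ramp_out_def)
  qed
qed

text \<open>\<open>ramp_in\<close> is unbounded at minus infinity, but \<open>ramp_out\<close>
  vanishes wherever \<open>ramp_in\<close> exceeds 1; hence one factor of \<open>ramp_out\<close>
  suffices. The numerical constants in the bounds below are then just the coefficients of
  \<open>ramp'\<close> and \<open>ramp''\<close>.\<close>

lemma ramp_monomial_le_1:
  assumes "0 < j"
  shows "ramp_out z ^ j * ramp_in z ^ k \<le> 1"
proof (cases "ramp_out z = 0")
  case False
  have "ramp_out z ^ j * ramp_in z ^ k \<le> 1 * 1"
    using ramp_out_range[of z] ramp_in_range[of z] False by (intro mult_mono power_le_one) auto
  then show ?thesis by simp
qed (use assms in \<open>simp add: power_0_left\<close>)

lemma ramp_bounds:
  "0 \<le> ramp' z" "ramp' z \<le> 16" "-48 \<le> ramp'' z" "ramp'' z \<le> 192" "(ramp' z)\<^sup>2 \<le> 256 * ramp z"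
  "1 \<le> z \<Longrightarrow> ramp' z = 0" "1 \<le> z \<Longrightarrow> ramp'' z = 0"
proof -
  have n: "0 \<le> ramp_out z ^ j * ramp_in z ^ k" for j k
    using ramp_out_range(1)[of z] ramp_in_range(1)[of z] by simp
  show "0 \<le> ramp' z" unfolding ramp'_def using ramp_out_range(1)[of z] ramp_in_range(1)[of z] by simp
  show "ramp' z \<le> 16" unfolding ramp'_def using ramp_monomial_le_1[of 3 z 3] by simp
  show "-48 \<le> ramp'' z" "ramp'' z \<le> 192" unfolding ramp''_def mult.assoc
    using ramp_monomial_le_1[of 3 z 2] ramp_monomial_le_1[of 2 z 6] n[of 2 6] n[of 3 2] by linarith+
  have "(ramp' z)\<^sup>2 = 256 * (ramp_out z ^ 4 * (ramp_out z ^ 2 * ramp_in z ^ 6))"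
    unfolding ramp'_def by (simp add: power_mult_distrib power_mult[symmetric] power_add[symmetric] mult.assoc[symmetric])
  also have "\<dots> \<le> 256 * (ramp_out z ^ 4 * 1)"
    using ramp_out_range(1)[of z] by (intro mult_left_mono ramp_monomial_le_1) auto
  finally show "(ramp' z)\<^sup>2 \<le> 256 * ramp z" by (simp add: ramp_def)
  show "1 \<le> z \<Longrightarrow> ramp' z = 0" "1 \<le> z \<Longrightarrow> ramp'' z = 0"
    unfolding ramp'_def ramp''_def ramp_in_def by auto
qed

text \<open>The reciprocal of the barrier is a small constant plus \<open>bar_q\<close>, which vanishes beyond r.
  Without the cut-off, 1 / \<open>bar_q\<close> is the travelling exponential solution of the linearised equation.\<close>

locale barrier =
  fixes \<rho> r \<kappa> K c :: real
  assumes \<rho>: "0 < \<rho>" and \<kappa>: "0 \<le> \<kappa>" and K: "0 < K" and c: "0 < c"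
begin

definition bar_E :: "real \<Rightarrow> real \<Rightarrow> real" where
  "bar_E s x = exp (\<rho> * (r - x) - \<kappa> * s) / K"
definition bar_q :: "real \<Rightarrow> real \<Rightarrow> real" where
  "bar_q s x = bar_E s x * ramp (r - x)"
definition bar_W :: "real \<Rightarrow> real \<Rightarrow> real" where
  "bar_W s x = inverse (c + bar_q s x)"
definition bar_qx :: "real \<Rightarrow> real \<Rightarrow> real" where
  "bar_qx s x = bar_E s x * (\<rho> * ramp (r - x) + ramp' (r - x))"
definition bar_qxx :: "real \<Rightarrow> real \<Rightarrow> real" where
  "bar_qxx s x = bar_E s x * (\<rho>\<^sup>2 * ramp (r - x) + 2 * \<rho> * ramp' (r - x) + ramp'' (r - x))"
definition bar_Ws :: "real \<Rightarrow> real \<Rightarrow> real" where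
  "bar_Ws s x = \<kappa> * bar_q s x * (bar_W s x)\<^sup>2"
definition bar_Wx :: "real \<Rightarrow> real \<Rightarrow> real" where
  "bar_Wx s x = (bar_W s x)\<^sup>2 * bar_qx s x"
definition bar_Wxx :: "real \<Rightarrow> real \<Rightarrow> real" where
  "bar_Wxx s x = 2 * bar_W s x * bar_Wx s x * bar_qx s x - (bar_W s x)\<^sup>2 * bar_qxx s x"

lemma bar_E_pos: "0 < bar_E s x"
  using K by (simp add: bar_E_def)

lemma bar_q_nonneg: "0 \<le> bar_q s x"
  using bar_E_pos[of s x] ramp_nonneg by (simp add: bar_q_def)

lemma bar_W_pos: "0 < bar_W s x"
  using bar_q_nonneg[of s x] c by (simp add: bar_W_def)

lemma bar_W_le: "bar_W s x \<le> inverse c"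
  unfolding bar_W_def using bar_q_nonneg[of s x] c by (intro le_imp_inverse_le) auto

lemma bar_W_q: "bar_W s x * bar_q s x = 1 - c * bar_W s x"
  using bar_q_nonneg[of s x] c unfolding bar_W_def by (simp add: field_simps)

lemma bar_E_le:
  assumes "0 \<le> s" "r - x \<le> 1"
  shows "bar_E s x \<le> exp \<rho> / K"
proof -
  have "\<rho> * (r - x) \<le> \<rho> * 1" using assms \<rho> by (intro mult_left_mono) auto
  moreover have "0 \<le> \<kappa> * s" using assms \<kappa> by simp
  ultimately show ?thesis unfolding bar_E_def using K by (intro divide_right_mono) auto
qed

text \<open>\<open>bar_E\<close> grows without bound to the left, but derivatives of the cut-off
  vanish once r - x >= 1, so only its values on r - x <= 1 matter.\<close>

lemma bar_E_times_le:
  assumes "0 \<le> s" "1 \<le> r - x \<Longrightarrow> y = 0" "0 \<le> y"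
  shows "bar_E s x * y \<le> exp \<rho> / K * y"
proof (cases "1 \<le> r - x")
  case False
  then show ?thesis using assms by (intro mult_right_mono bar_E_le) auto
qed (simp add: assms)

lemma bar_E_deriv: "((\<lambda>x. bar_E s x) has_real_derivative - \<rho> * bar_E s x) (at x)"
  unfolding bar_E_def using K by (auto intro!: derivative_eq_intros simp: field_simps)

lemma ramp_comp_deriv:
  "((\<lambda>x. ramp (r - x)) has_real_derivative - ramp' (r - x)) (at x)"
  "((\<lambda>x. ramp' (r - x)) has_real_derivative - ramp'' (r - x)) (at x)"
proof -
  have "((\<lambda>x. r - x) has_real_derivative - 1) (at x)" by (auto intro!: derivative_eq_intros)
  from DERIV_chain2[OF ramp_deriv this] DERIV_chain2[OF ramp'_deriv this]
  show "((\<lambda>x. ramp (r - x)) has_real_derivative - ramp' (r - x)) (at x)"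
    "((\<lambda>x. ramp' (r - x)) has_real_derivative - ramp'' (r - x)) (at x)" by simp_all
qed

lemma bar_q_deriv: "(bar_q s has_real_derivative - bar_qx s x) (at x)"
  unfolding bar_q_def[abs_def] bar_qx_def
  by (rule DERIV_cong[OF DERIV_mult[OF bar_E_deriv ramp_comp_deriv(1)]]) (simp add: algebra_simps)

lemma bar_qx_deriv: "(bar_qx s has_real_derivative - bar_qxx s x) (at x)"
  unfolding bar_qx_def[abs_def] bar_qxx_def
  by (rule DERIV_cong[OF DERIV_mult[OF bar_E_deriv DERIV_add[OF DERIV_cmult[OF ramp_comp_deriv(1)] ramp_comp_deriv(2)]]])
     (simp add: algebra_simps power2_eq_square)

lemma bar_W_deriv: "(bar_W s has_real_derivative bar_Wx s x) (at x)"
proof -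
  have "c + bar_q s x \<noteq> 0" using bar_q_nonneg[of s x] c by linarith
  then have "((\<lambda>x. inverse (c + bar_q s x)) has_real_derivative
     - (inverse (c + bar_q s x) * (0 + - bar_qx s x) * inverse (c + bar_q s x))) (at x)"
    by (intro DERIV_inverse' DERIV_add DERIV_const bar_q_deriv)
  then show ?thesis
    unfolding bar_W_def[abs_def] bar_Wx_def by (simp add: power2_eq_square mult_ac)
qed

lemma bar_Wx_deriv: "(bar_Wx s has_real_derivative bar_Wxx s x) (at x)"
proof -
  have "((\<lambda>x. (bar_W s x)\<^sup>2 * bar_qx s x) has_real_derivative
      (of_nat 2 * (bar_Wx s x * bar_W s x ^ (2 - Suc 0))) * bar_qx s x + (- bar_qxx s x) * (bar_W s x)\<^sup>2) (at x)"
    by (rule DERIV_mult[OF DERIV_power[OF bar_W_deriv] bar_qx_deriv])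
  moreover have "(of_nat 2 * (bar_Wx s x * bar_W s x ^ (2 - Suc 0))) * bar_qx s x + (- bar_qxx s x) * (bar_W s x)\<^sup>2
    = bar_Wxx s x"
    by (simp add: bar_Wxx_def algebra_simps)
  ultimately show ?thesis by (simp add: bar_Wx_def[abs_def])
qed

lemma bar_W_has_derivative:
  "((\<lambda>p. bar_W (fst p) (snd p)) has_derivative (\<lambda>p. bar_Ws s x * fst p + bar_Wx s x * snd p)) (at (s, x))"
proof -
  have E: "((\<lambda>p. bar_E (fst p) (snd p)) has_derivative
      (\<lambda>h. bar_E s x * (- \<rho> * snd h - \<kappa> * fst h))) (at (s, x))"
    unfolding bar_E_def using K by (auto intro!: derivative_eq_intros simp: field_simps)
  have "((\<lambda>p::real \<times> real. r - snd p) has_derivative (\<lambda>h. - snd h)) (at (s, x))"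
    by (auto intro!: derivative_eq_intros)
  then have C: "((\<lambda>p::real \<times> real. ramp (r - snd p)) has_derivative (\<lambda>h. (- snd h) * ramp' (r - x))) (at (s, x))"
    by (rule DERIV_compose_FDERIV[rotated]) (simp add: ramp_deriv)
  have q: "((\<lambda>p. bar_q (fst p) (snd p)) has_derivative (\<lambda>h. - (\<kappa> * bar_q s x * fst h) - bar_qx s x * snd h)) (at (s, x))"
    unfolding bar_q_def bar_qx_def
    by (rule has_derivative_eq_rhs[OF has_derivative_mult[OF E C]]) (auto simp: algebra_simps)
  have nz: "c + bar_q (fst (s, x)) (snd (s, x)) \<noteq> 0" using bar_q_nonneg[of s x] c by simp
  show ?thesis
    unfolding bar_W_def
    by (rule has_derivative_eq_rhs[OF Deriv.has_derivative_inverse[OF nz has_derivative_add[OF has_derivative_const q]]])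
       (auto simp: bar_Ws_def bar_Wx_def bar_W_def algebra_simps power2_eq_square)
qed

lemma bar_measurable:
  "jointly_borel bar_W"
  "jointly_borel bar_Ws"
  "jointly_borel bar_Wxx"
  unfolding bar_W_def bar_Ws_def bar_Wxx_def bar_Wx_def bar_qx_def bar_qxx_def bar_q_def bar_E_def split_beta'
  by measurable

lemma continuous_bar_Wxx: "continuous_on UNIV (bar_Wxx s)"
proof -
  have W: "continuous_on UNIV (bar_W s)" and qx: "continuous_on UNIV (bar_qx s)" and Wx: "continuous_on UNIV (bar_Wx s)"
    using bar_W_deriv bar_qx_deriv bar_Wx_deriv by (meson DERIV_isCont continuous_at_imp_continuous_on)+
  have "continuous_on UNIV (bar_qxx s)"
    unfolding bar_qxx_def[abs_def] bar_E_def
    using K by (intro continuous_intros continuous_on_compose2[OF continuous_ramp(1)]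
        continuous_on_compose2[OF continuous_ramp(2)] continuous_on_compose2[OF continuous_ramp(3)]) auto
  with W qx Wx show ?thesis
    unfolding bar_Wxx_def[abs_def] by (intro continuous_intros)
qed

text \<open>In terms of a = W q, b = W E ramp' and b' = W E ramp'' all derivatives of W are
  W times a polynomial.\<close>

definition bar_a :: "real \<Rightarrow> real \<Rightarrow> real" where "bar_a s x = bar_W s x * bar_q s x"
definition bar_b :: "real \<Rightarrow> real \<Rightarrow> real" where "bar_b s x = bar_W s x * (bar_E s x * ramp' (r - x))"
definition bar_b' :: "real \<Rightarrow> real \<Rightarrow> real" where "bar_b' s x = bar_W s x * (bar_E s x * ramp'' (r - x))"

lemma bar_poly:
  "bar_Ws s x = bar_W s x * (\<kappa> * bar_a s x)"
  "bar_Wx s x = bar_W s x * (\<rho> * bar_a s x + bar_b s x)"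
  "bar_Wxx s x = bar_W s x * (2 * (\<rho> * bar_a s x + bar_b s x)\<^sup>2 - (\<rho>\<^sup>2 * bar_a s x + 2 * \<rho> * bar_b s x + bar_b' s x))"
  unfolding bar_Ws_def bar_Wxx_def bar_Wx_def bar_a_def bar_b_def bar_b'_def bar_qx_def bar_qxx_def bar_q_def
  by (simp_all add: power2_eq_square algebra_simps)

lemma bar_a_range: "0 \<le> bar_a s x" "bar_a s x \<le> 1"
  using bar_W_q[of s x] mult_pos_pos[OF c bar_W_pos[of s x]]
    mult_nonneg_nonneg[OF less_imp_le[OF bar_W_pos[of s x]] bar_q_nonneg[of s x]]
  unfolding bar_a_def by linarith+

text \<open>Every error term of the cut-off is O(W) with a constant proportional to 1 / K, so after
  the common factor W it can be absorbed by \<alpha> W^2 for large K. For b^2 = (W E ramp')^2 this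
  uses ramp'^2 <= 256 ramp, which reassembles one factor a = W E ramp <= 1.\<close>

lemma bar_b_bounds:
  assumes "0 \<le> s"
  shows "0 \<le> bar_b s x" "bar_b s x \<le> exp \<rho> / K * 16 * bar_W s x"
    "- (exp \<rho> / K * 48 * bar_W s x) \<le> bar_b' s x" "bar_b' s x \<le> exp \<rho> / K * 192 * bar_W s x"
    "(bar_b s x)\<^sup>2 \<le> exp \<rho> / K * 256 * bar_W s x"
proof -
  let ?z = "r - x"
  have W: "0 < bar_W s x" by (rule bar_W_pos)
  have e0: "0 < exp \<rho> / K" using K by simp
  have E0: "0 < bar_E s x" by (rule bar_E_pos)
  have le: "bar_E s x * y \<le> exp \<rho> / K * y" if "1 \<le> ?z \<Longrightarrow> y = 0" "0 \<le> y" for y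
    using that assms by (intro bar_E_times_le) auto
  show "0 \<le> bar_b s x" using W E0 ramp_bounds(1)[of ?z] by (simp add: bar_b_def)
  have "bar_E s x * ramp' ?z \<le> exp \<rho> / K * ramp' ?z" by (intro le ramp_bounds)
  also have "\<dots> \<le> exp \<rho> / K * 16" using e0 by (intro mult_left_mono ramp_bounds) auto
  finally show "bar_b s x \<le> exp \<rho> / K * 16 * bar_W s x"
    unfolding bar_b_def using mult_left_mono[of _ _ "bar_W s x"] W by (metis less_imp_le mult.commute)
  have E2: "- (exp \<rho> / K * 48) \<le> bar_E s x * ramp'' ?z \<and> bar_E s x * ramp'' ?z \<le> exp \<rho> / K * 192"
  proof (cases "0 \<le> ramp'' ?z")
    case True
    have "bar_E s x * ramp'' ?z \<le> exp \<rho> / K * ramp'' ?z" by (intro le ramp_bounds True)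
    also have "\<dots> \<le> exp \<rho> / K * 192" using e0 by (intro mult_left_mono ramp_bounds) auto
    finally have "bar_E s x * ramp'' ?z \<le> exp \<rho> / K * 192" .
    moreover have "0 \<le> bar_E s x * ramp'' ?z" using E0 True by simp
    ultimately show ?thesis using e0 by auto
  next
    case False
    have "bar_E s x * - ramp'' ?z \<le> exp \<rho> / K * - ramp'' ?z"
      using False ramp_bounds(7)[of ?z] by (intro le) auto
    also have "\<dots> \<le> exp \<rho> / K * 48" using e0 ramp_bounds(3)[of ?z] by (intro mult_left_mono) auto
    finally have "bar_E s x * - ramp'' ?z \<le> exp \<rho> / K * 48" .
    moreover have "0 \<le> bar_E s x * - ramp'' ?z" using E0 False by (intro mult_nonneg_nonneg) auto
    moreover have "0 \<le> exp \<rho> / K * 192" using e0 by (intro mult_nonneg_nonneg) auto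
    ultimately show ?thesis unfolding mult_minus_right by (intro conjI) linarith+
  qed
  have "bar_W s x * - (exp \<rho> / K * 48) \<le> bar_b' s x" "bar_b' s x \<le> bar_W s x * (exp \<rho> / K * 192)"
    unfolding bar_b'_def using E2 W by (meson less_imp_le mult_left_mono)+
  then show "- (exp \<rho> / K * 48 * bar_W s x) \<le> bar_b' s x" "bar_b' s x \<le> exp \<rho> / K * 192 * bar_W s x"
    by (simp_all add: mult_ac)
  show "(bar_b s x)\<^sup>2 \<le> exp \<rho> / K * 256 * bar_W s x"
  proof (cases "1 \<le> ?z")
    case True
    then show ?thesis using ramp_bounds(6)[OF True] W K by (simp add: bar_b_def)
  next
    case False
    have "(bar_b s x)\<^sup>2 = (bar_W s x)\<^sup>2 * (bar_E s x)\<^sup>2 * (ramp' ?z)\<^sup>2"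
      by (simp add: bar_b_def power_mult_distrib)
    also have "\<dots> \<le> (bar_W s x)\<^sup>2 * (bar_E s x)\<^sup>2 * (256 * ramp ?z)"
      by (intro mult_left_mono ramp_bounds) auto
    also have "\<dots> = bar_a s x * (bar_E s x * (256 * bar_W s x))"
      by (simp add: bar_a_def bar_q_def power2_eq_square)
    also have "\<dots> \<le> 1 * (exp \<rho> / K * (256 * bar_W s x))"
      using bar_a_range[of s x] W E0 e0 False assms by (intro mult_mono bar_E_le) auto
    finally show ?thesis by simp
  qed
qed

lemma bar_bounded_C12: "\<exists>B. bounded_C12 bar_W bar_Ws bar_Wx bar_Wxx B"
proof -
  define b where "b = exp \<rho> / K * 192 * inverse c"
  have e0: "0 < exp \<rho> / K" using K by simp
  have b0: "0 \<le> b" unfolding b_def using e0 c by (intro mult_nonneg_nonneg) auto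
  have bb: "\<bar>bar_b s x\<bar> \<le> b" "\<bar>bar_b' s x\<bar> \<le> b" if "0 \<le> s" for s x
  proof -
    have m: "exp \<rho> / K * k * bar_W s x \<le> b" if "0 \<le> k" "k \<le> 192" for k
      unfolding b_def using that e0 bar_W_le[of s x] bar_W_pos[of s x]
      by (intro mult_mono mult_nonneg_nonneg) auto
    show "\<bar>bar_b s x\<bar> \<le> b" "\<bar>bar_b' s x\<bar> \<le> b"
      using bar_b_bounds[OF that, of x] m[of 16] m[of 48] m[of 192] by auto
  qed
  define B1 where "B1 = 1 + \<kappa> + (\<rho> + b) + (2 * (\<rho> + b)\<^sup>2 + (\<rho>\<^sup>2 + 2 * \<rho> * b + b))"
  have W_times: "\<bar>bar_W s x * y\<bar> \<le> inverse c * B1" if "\<bar>y\<bar> \<le> B1" for s x y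
    unfolding abs_mult using that bar_W_le[of s x] bar_W_pos[of s x] c by (intro mult_mono) auto
  have sum_le: "\<bar>\<rho> * bar_a s x + bar_b s x\<bar> \<le> \<rho> + b" if "0 \<le> s" for s x
  proof -
    have "\<bar>\<rho> * bar_a s x\<bar> \<le> \<rho> * 1"
      using \<rho> bar_a_range[of s x] by (simp add: abs_mult)
    with bb(1)[OF that, of x] show ?thesis by linarith
  qed
  have nn: "0 \<le> \<rho> * b" "0 \<le> \<rho>\<^sup>2" "0 \<le> (\<rho> + b)\<^sup>2" using \<rho> b0 by auto
  show ?thesis
  proof (rule exI, unfold_locales)
    fix s x :: real assume s: "0 \<le> s"
    show "((\<lambda>p. bar_W (fst p) (snd p)) has_derivative (\<lambda>p. bar_Ws s x * fst p + bar_Wx s x * snd p)) (at (s, x))"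
      by (rule bar_W_has_derivative)
    show "(bar_Wx s has_real_derivative bar_Wxx s x) (at x)" by (rule bar_Wx_deriv)
    show "continuous_on UNIV (bar_Wxx s)" by (rule continuous_bar_Wxx)
    have "\<bar>1\<bar> \<le> B1" unfolding B1_def using nn \<rho> \<kappa> b0 by simp
    from W_times[OF this, of s x] show "\<bar>bar_W s x\<bar> \<le> inverse c * B1" by simp
    have "\<bar>\<kappa> * bar_a s x\<bar> \<le> \<kappa> * 1"
      using \<kappa> bar_a_range[of s x] by (simp add: abs_mult mult_left_le)
    then have "\<bar>\<kappa> * bar_a s x\<bar> \<le> B1" unfolding B1_def using nn \<rho> \<kappa> b0 by linarith
    from W_times[OF this, of s x] show "\<bar>bar_Ws s x\<bar> \<le> inverse c * B1" by (simp only: bar_poly)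
    have "\<bar>\<rho> * bar_a s x + bar_b s x\<bar> \<le> B1"
      unfolding B1_def using sum_le[OF s, of x] nn \<rho> \<kappa> b0 by linarith
    from W_times[OF this, of s x] show "\<bar>bar_Wx s x\<bar> \<le> inverse c * B1" by (simp only: bar_poly)
    have "(\<rho> * bar_a s x + bar_b s x)\<^sup>2 \<le> (\<rho> + b)\<^sup>2"
      using sum_le[OF s, of x] \<rho> b0 by (intro abs_le_square_iff[THEN iffD1]) auto
    moreover have "\<bar>\<rho>\<^sup>2 * bar_a s x\<bar> \<le> \<rho>\<^sup>2 * 1"
      using bar_a_range[of s x] by (simp add: abs_mult mult_left_le)
    moreover have "\<bar>2 * \<rho> * bar_b s x\<bar> \<le> 2 * \<rho> * b"
      using bb(1)[OF s, of x] \<rho> by (simp add: abs_mult mult_left_mono)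
    moreover have "0 \<le> (\<rho> * bar_a s x + bar_b s x)\<^sup>2" by simp
    ultimately have "\<bar>2 * (\<rho> * bar_a s x + bar_b s x)\<^sup>2 - (\<rho>\<^sup>2 * bar_a s x + 2 * \<rho> * bar_b s x + bar_b' s x)\<bar> \<le> B1"
      unfolding B1_def using bb(2)[OF s, of x] nn \<rho> \<kappa> b0 by linarith
    from W_times[OF this, of s x] show "\<bar>bar_Wxx s x\<bar> \<le> inverse c * B1" by (simp only: bar_poly)
  qed (use bar_measurable in auto)
qed

text \<open>After dividing by W, the choice of \<kappa> turns the terms without cut-off derivatives
  into \<rho>^2 a (1 - a) - \<beta> (1 - a) + \<alpha> W, and 1 - a = c W. One half of \<alpha> W
  absorbs \<beta> c W, the other half the cut-off errors.\<close>

lemma bar_W_supersolution: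
  assumes \<beta>: "\<kappa> = \<beta> + \<rho>\<^sup>2 / 2" "0 \<le> \<beta>" and c': "\<beta> * c \<le> \<alpha> / 2"
    and K': "exp \<rho> / K * (16 * \<rho> + 280) \<le> \<alpha> / 2" and s: "0 \<le> s"
  shows "0 \<le> bar_Ws s x - bar_Wxx s x / 2 + (- \<beta> * bar_W s x + \<alpha> * (bar_W s x)\<^sup>2)"
proof -
  define a b b' W where "a = bar_a s x" and "b = bar_b s x" and "b' = bar_b' s x" and "W = bar_W s x"
  define e where "e = exp \<rho> / K"
  have W0: "0 < W" using bar_W_pos by (simp add: W_def)
  have a: "0 \<le> a" "a \<le> 1" "a = 1 - c * W"
    using bar_a_range[of s x] bar_W_q[of s x] by (auto simp: a_def W_def bar_a_def)
  have b: "0 \<le> b" "b \<le> e * 16 * W" "- (e * 48 * W) \<le> b'" "b\<^sup>2 \<le> e * 256 * W"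
    using bar_b_bounds[OF s, of x] by (auto simp: b_def b'_def W_def e_def)
  have "bar_Ws s x - bar_Wxx s x / 2 + (- \<beta> * W + \<alpha> * W\<^sup>2)
      = W * (\<kappa> * a - (\<rho> * a + b)\<^sup>2 + (\<rho>\<^sup>2 * a + 2 * \<rho> * b + b') / 2 - \<beta> + \<alpha> * W)"
    unfolding bar_poly a_def[symmetric] b_def[symmetric] b'_def[symmetric] W_def[symmetric]
    by (simp add: algebra_simps power2_eq_square add_divide_distrib diff_divide_distrib)
  also have "\<kappa> * a - (\<rho> * a + b)\<^sup>2 + (\<rho>\<^sup>2 * a + 2 * \<rho> * b + b') / 2 - \<beta> + \<alpha> * W
      = \<rho>\<^sup>2 * (a * (1 - a)) + 2 * \<rho> * (b * (1 - a)) - \<rho> * b + b' / 2 - b\<^sup>2 - \<beta> * (1 - a) + \<alpha> * W"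
    unfolding \<beta> by (simp add: algebra_simps power2_eq_square add_divide_distrib)
  also have "\<beta> * (1 - a) = \<beta> * c * W" using a by simp
  finally have eq: "bar_Ws s x - bar_Wxx s x / 2 + (- \<beta> * W + \<alpha> * W\<^sup>2)
      = W * (\<rho>\<^sup>2 * (a * (1 - a)) + 2 * \<rho> * (b * (1 - a)) - \<rho> * b + b' / 2 - b\<^sup>2 - \<beta> * c * W + \<alpha> * W)" .
  have "0 \<le> \<rho>\<^sup>2 * (a * (1 - a))" "0 \<le> 2 * \<rho> * (b * (1 - a))" using a b \<rho> by auto
  moreover have "\<rho> * b \<le> \<rho> * (e * 16 * W)" using b \<rho> by (intro mult_left_mono) auto
  moreover have "\<beta> * c * W \<le> \<alpha> / 2 * W" using c' W0 by (intro mult_right_mono) auto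
  moreover have "e * (16 * \<rho> + 280) * W \<le> \<alpha> / 2 * W" using K' W0 unfolding e_def by (intro mult_right_mono) auto
  \<comment> \<open>280 = 48 / 2 + 256: half the bound on - b' plus the bound on b^2; the summand 16
    \<rho> belongs to \<rho> b.\<close>
  moreover have "e * (16 * \<rho> + 280) * W = \<rho> * (e * 16 * W) + e * 48 * W / 2 + e * 256 * W" by (simp add: algebra_simps)
  ultimately have "0 \<le> \<rho>\<^sup>2 * (a * (1 - a)) + 2 * \<rho> * (b * (1 - a)) - \<rho> * b + b' / 2 - b\<^sup>2 - \<beta> * c * W + \<alpha> * W"
    using b(3,4) by linarith
  then show ?thesis using eq W0 unfolding W_def by simp
qed

lemma bar_W_eq_inverse: "r \<le> x \<Longrightarrow> bar_W s x = inverse c"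
  by (simp add: bar_W_def bar_q_def ramp_nonpos)

lemma bar_W_le_exp: "x \<le> r - 1 \<Longrightarrow> bar_W s x \<le> K * exp (\<kappa> * s - \<rho> * (r - x))"
proof -
  assume "x \<le> r - 1"
  then have q: "bar_q s x = bar_E s x" by (simp add: bar_q_def ramp_ge_1)
  have "bar_W s x \<le> inverse (bar_E s x)"
    unfolding bar_W_def q using c bar_E_pos[of s x] by (intro le_imp_inverse_le) auto
  also have "\<dots> = K * exp (\<kappa> * s - \<rho> * (r - x))"
    unfolding bar_E_def using K by (simp add: exp_diff field_simps)
  finally show ?thesis .
qed

end

text \<open>Starting the barrier at time s0 amounts to replacing K by K exp (\<kappa> s0), which is
  larger and so keeps the smallness condition. The solution can thus be restarted at every grid time
  under one and the same barrier; 0 is the lower barrier.\<close>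

theorem (in branching) ex_mild_solution_below_barrier:
  assumes bar: "barrier \<rho> \<kappa> K c"
    and \<kappa>: "\<kappa> = \<beta> + \<rho>\<^sup>2 / 2" and c: "\<beta> * c \<le> \<alpha> / 2"
    and K: "exp \<rho> / K * (16 * \<rho> + 280) \<le> \<alpha> / 2" and s0: "0 \<le> s0"
    and g: "g \<in> borel_measurable borel" "\<And>x. 0 \<le> g x" "\<And>x. g x \<le> barrier.bar_W \<rho> r \<kappa> K c s0 x"
  obtains v C where "mild_solution g v C"
    "\<And>s y. 0 \<le> s \<Longrightarrow> v s y \<le> barrier.bar_W \<rho> r \<kappa> K c (s0 + s) y"
proof -
  interpret b0: barrier \<rho> r \<kappa> K c by fact
  define K' where "K' = K * exp (\<kappa> * s0)"
  have K': "K \<le> K'" "0 < K'" unfolding K'_def using b0.K b0.\<kappa> s0 by auto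
  interpret b: barrier \<rho> r \<kappa> K' c
    using b0.\<rho> b0.\<kappa> b0.c K' by unfold_locales auto
  have "b.bar_E s x = b0.bar_E (s0 + s) x" for s x
    unfolding b.bar_E_def b0.bar_E_def by (simp add: K'_def exp_diff exp_add distrib_left)
  then have shift: "b.bar_W s x = b0.bar_W (s0 + s) x" for s x
    unfolding b.bar_W_def b0.bar_W_def b.bar_q_def b0.bar_q_def by simp
  have "exp \<rho> / K' * (16 * \<rho> + 280) \<le> exp \<rho> / K * (16 * \<rho> + 280)"
    using b0.\<rho> b0.K K' by (intro mult_right_mono divide_left_mono) auto
  with K have K'': "exp \<rho> / K' * (16 * \<rho> + 280) \<le> \<alpha> / 2" by linarith
  obtain B where B: "bounded_C12 b.bar_W b.bar_Ws b.bar_Wx b.bar_Wxx B" using b.bar_bounded_C12 by blast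
  have c0: "0 \<le> inverse c" using b0.c by simp
  have super: "0 \<le> b.bar_Ws s x - b.bar_Wxx s x / 2 + \<psi> (b.bar_W s x)" if "0 \<le> s" for s x
    using b.bar_W_supersolution[OF \<kappa> less_imp_le[OF \<beta>_pos] c K'' that, of x]
      psi_ge_logistic[OF less_imp_le[OF b.bar_W_pos[of s x]]] by linarith
  show thesis
  proof (rule ex_mild_solution_between_classical[OF bounded_C12_const[of 0] B c0])
    fix s x :: real
    show "0 \<le> b.bar_W s x" using b.bar_W_pos[of s x] by simp
    show "b.bar_W s x \<le> inverse c" by (rule b.bar_W_le)
    show "g x \<le> b.bar_W 0 x" using g(3)[of x] by (simp add: shift)
  next
    fix v
    assume "mild_solution g v (inverse c)" "\<And>s y. 0 \<le> s \<Longrightarrow> v s y \<le> b.bar_W s y"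
    then show thesis unfolding shift by (rule that)
  qed (use g super in simp_all)
qed

section \<open>The moving bump\<close>

lemma continuous_vanishing_outside_Icc_bounded:
  fixes f :: "real \<Rightarrow> real"
  assumes "continuous_on UNIV f" "\<And>z. R < \<bar>z\<bar> \<Longrightarrow> f z = 0"
  obtains B where "\<And>z. \<bar>f z\<bar> \<le> B"
proof -
  have "bounded (f ` {-R..R})"
    using assms(1) by (intro compact_imp_bounded compact_continuous_image) (auto intro: continuous_on_subset)
  then obtain B where B: "\<And>y. y \<in> f ` {-R..R} \<Longrightarrow> norm y \<le> B" unfolding bounded_iff by blast
  have "\<bar>f z\<bar> \<le> max B 0" for z
    using B[of "f z"] assms(2)[of z] by (cases "\<bar>z\<bar> \<le> R") (auto simp: abs_le_iff)
  then show thesis by (rule that)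
qed

text \<open>The second derivative of \<open>hump ^ 4\<close> is bounded below by a small negative multiple of \<open>hump ^ 4\<close>,
  so the moving bump is a subsolution with growth rate close to \<open>\<beta> - \<rho>\<^sup>2 / 2\<close>.\<close>

locale moving_bump =
  fixes \<rho> a \<mu> \<delta> x0 :: real
  assumes \<rho>: "0 < \<rho>" and a: "0 < a" and \<mu>: "\<mu> \<le> 0" and \<delta>: "0 < \<delta>"
begin

definition hump :: "real \<Rightarrow> real" where "hump z = max 0 (1 - (a * z)\<^sup>2)"
text \<open>The tilt matches the speed: in \<rho> bump' - bump'' / 2 the first-order terms cancel,
  leaving exp (\<rho> z) (\<rho>^2 hump^4 - hump'') / 2. Here \<open>hump'\<close> and
  \<open>hump''\<close> denote the derivatives of the fourth power of \<open>hump\<close>.\<close>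

definition bump :: "real \<Rightarrow> real" where "bump z = exp (\<rho> * z) * hump z ^ 4"
definition hump' :: "real \<Rightarrow> real" where "hump' z = - 8 * a\<^sup>2 * z * hump z ^ 3"
definition hump'' :: "real \<Rightarrow> real" where "hump'' z = - 8 * a\<^sup>2 * hump z ^ 3 + 48 * a ^ 4 * z\<^sup>2 * hump z ^ 2"
definition bump' :: "real \<Rightarrow> real" where "bump' z = exp (\<rho> * z) * (\<rho> * hump z ^ 4 + hump' z)"
definition bump'' :: "real \<Rightarrow> real" where
  "bump'' z = exp (\<rho> * z) * (\<rho>\<^sup>2 * hump z ^ 4 + 2 * \<rho> * hump' z + hump'' z)"

lemma hump_deriv:
  "2 \<le> k \<Longrightarrow> ((\<lambda>z. hump z ^ k) has_real_derivative real k * hump z ^ (k - 1) * (- 2 * a\<^sup>2 * z)) (at z)"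
  unfolding hump_def
  by (rule DERIV_max_0_power_chain) (auto intro!: derivative_eq_intros simp: power2_eq_square)

lemma hump4_deriv: "((\<lambda>z. hump z ^ 4) has_real_derivative hump' z) (at z)"
  by (rule DERIV_cong[OF hump_deriv]) (auto simp: hump'_def)

lemma hump'_deriv: "(hump' has_real_derivative hump'' z) (at z)"
proof -
  have "((\<lambda>z. (- 8 * a\<^sup>2 * z) * hump z ^ 3) has_real_derivative
      (- 8 * a\<^sup>2) * hump z ^ 3 + (real 3 * hump z ^ (3 - 1) * (- 2 * a\<^sup>2 * z)) * (- 8 * a\<^sup>2 * z)) (at z)"
    by (rule DERIV_mult[OF _ hump_deriv]) (auto intro!: derivative_eq_intros)
  moreover have "(- 8 * a\<^sup>2) * hump z ^ 3 + (real 3 * hump z ^ (3 - 1) * (- 2 * a\<^sup>2 * z)) * (- 8 * a\<^sup>2 * z) = hump'' z"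
    by (simp add: hump''_def algebra_simps power2_eq_square power4_eq_xxxx)
  ultimately show ?thesis unfolding hump'_def[abs_def] by simp
qed

lemma exp_deriv: "((\<lambda>z. exp (\<rho> * z)) has_real_derivative \<rho> * exp (\<rho> * z)) (at z)"
  by (auto intro!: derivative_eq_intros)

lemma bump_deriv: "(bump has_real_derivative bump' z) (at z)"
  unfolding bump_def[abs_def] bump'_def
  by (rule DERIV_cong[OF DERIV_mult[OF exp_deriv hump4_deriv]]) (simp add: algebra_simps)

lemma bump'_deriv: "(bump' has_real_derivative bump'' z) (at z)"
  unfolding bump'_def[abs_def] bump''_def
  by (rule DERIV_cong[OF DERIV_mult[OF exp_deriv DERIV_add[OF DERIV_cmult[OF hump4_deriv] hump'_deriv]]])
     (simp add: algebra_simps power2_eq_square)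

lemma continuous_bump: "continuous_on UNIV bump" "continuous_on UNIV bump'" "continuous_on UNIV bump''"
  unfolding bump_def[abs_def] bump'_def[abs_def] bump''_def[abs_def] hump'_def hump''_def hump_def
  by (intro continuous_intros)+

lemma hump_outside: "1 / a < \<bar>z\<bar> \<Longrightarrow> hump z = 0"
proof -
  assume "1 / a < \<bar>z\<bar>"
  then have "1 < \<bar>a * z\<bar>" using a by (simp add: field_simps abs_mult)
  then have "1 \<le> (a * z)\<^sup>2" by (metis abs_1 abs_le_square_iff less_imp_le one_power2)
  then show ?thesis by (simp add: hump_def)
qed

lemma bump_outside:
  assumes "1 / a < \<bar>z\<bar>" shows "bump z = 0" "bump' z = 0" "bump'' z = 0"
  using hump_outside[OF assms] by (auto simp: bump_def bump'_def bump''_def hump'_def hump''_def)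

lemma bump_nonneg: "0 \<le> bump z"
  by (simp add: bump_def hump_def)

lemma hump_le_1: "0 \<le> hump z" "hump z \<le> 1"
  by (auto simp: hump_def)

lemma bump_le: "bump z \<le> exp (\<rho> / a)"
proof (cases "1 / a < \<bar>z\<bar>")
  case False
  then have "\<rho> * z \<le> \<rho> * (1 / a)" using \<rho> by (intro mult_left_mono) auto
  then have "exp (\<rho> * z) * hump z ^ 4 \<le> exp (\<rho> / a) * 1"
    using hump_le_1[of z] by (intro mult_mono power_le_one) auto
  then show ?thesis by (simp add: bump_def)
qed (simp add: bump_outside)

text \<open>Where m = hump z is positive, a^2 z^2 = 1 - m; the difference of the two sides is then
  a^2 m^2 times a quadratic in m that factors as 8 (3 - 2 m) (2 - m), nonnegative on [0, 1].\<close>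

lemma hump''_ge: "- 16 * a\<^sup>2 * hump z ^ 4 \<le> hump'' z"
proof (cases "hump z = 0")
  case False
  define m where "m = hump z"
  have m: "0 \<le> m" "m \<le> 1" "a\<^sup>2 * z\<^sup>2 = 1 - m"
    using hump_le_1[of z] False by (auto simp: m_def hump_def power_mult_distrib split: if_splits)
  have "hump'' z + 16 * a\<^sup>2 * m ^ 4 = a\<^sup>2 * m\<^sup>2 * (- 8 * m + 48 * (a\<^sup>2 * z\<^sup>2) + 16 * m\<^sup>2)"
    unfolding hump''_def m_def[symmetric] by (simp add: algebra_simps power2_eq_square power3_eq_cube power4_eq_xxxx)
  also have "- 8 * m + 48 * (a\<^sup>2 * z\<^sup>2) + 16 * m\<^sup>2 = 8 * ((3 - 2 * m) * (2 - m))"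
    unfolding m(3) by (simp add: algebra_simps power2_eq_square)
  also have "0 \<le> a\<^sup>2 * m\<^sup>2 * (8 * ((3 - 2 * m) * (2 - m)))" using m by (intro mult_nonneg_nonneg) auto
  finally show ?thesis by (simp add: m_def)
qed (simp add: hump''_def)

text \<open>The bump starts at x0 and travels left, because the dual equation runs backwards along
  the process; with x0 = \<rho> t its centre reaches the origin at time t.\<close>

definition bump_U :: "real \<Rightarrow> real \<Rightarrow> real" where
  "bump_U s x = \<delta> * exp (\<mu> * s) * bump (x + \<rho> * s - x0)"
definition bump_Us :: "real \<Rightarrow> real \<Rightarrow> real" where
  "bump_Us s x = \<delta> * exp (\<mu> * s) * (\<mu> * bump (x + \<rho> * s - x0) + \<rho> * bump' (x + \<rho> * s - x0))"
definition bump_Ux :: "real \<Rightarrow> real \<Rightarrow> real" where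
  "bump_Ux s x = \<delta> * exp (\<mu> * s) * bump' (x + \<rho> * s - x0)"
definition bump_Uxx :: "real \<Rightarrow> real \<Rightarrow> real" where
  "bump_Uxx s x = \<delta> * exp (\<mu> * s) * bump'' (x + \<rho> * s - x0)"

lemma bump_bounded_C12: "\<exists>B. bounded_C12 bump_U bump_Us bump_Ux bump_Uxx B"
proof -
  obtain B0 B1 B2 where b: "\<And>z. \<bar>bump z\<bar> \<le> B0" "\<And>z. \<bar>bump' z\<bar> \<le> B1" "\<And>z. \<bar>bump'' z\<bar> \<le> B2"
    using continuous_vanishing_outside_Icc_bounded[OF continuous_bump(1) bump_outside(1)]
      continuous_vanishing_outside_Icc_bounded[OF continuous_bump(2) bump_outside(2)]
      continuous_vanishing_outside_Icc_bounded[OF continuous_bump(3) bump_outside(3)] by metis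
  have B_nonneg: "0 \<le> B0" "0 \<le> B1" "0 \<le> B2" using b[of 0] by linarith+
  define B where "B = B0 + B1 + B2 + \<bar>\<mu>\<bar> * B0 + \<rho> * B1"
  have prod: "0 \<le> \<bar>\<mu>\<bar> * B0" "0 \<le> \<rho> * B1" using B_nonneg \<rho> by auto
  have scale: "\<bar>\<delta> * exp (\<mu> * s) * y\<bar> \<le> \<delta> * B" if "0 \<le> s" "\<bar>y\<bar> \<le> B" for s y
  proof -
    have "\<mu> * s \<le> 0" using \<mu> that by (simp add: mult_nonpos_nonneg)
    then have "\<bar>\<delta> * exp (\<mu> * s) * y\<bar> \<le> \<delta> * 1 * B"
      unfolding abs_mult using that \<delta> by (intro mult_mono) auto
    then show ?thesis by simp
  qed
  note [measurable] = continuous_bump[THEN borel_measurable_continuous_onI]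
  show ?thesis
  proof (rule exI, unfold_locales)
    fix s x :: real assume s: "0 \<le> s"
    let ?z = "x + \<rho> * s - x0"
    have z: "((\<lambda>p::real \<times> real. snd p + \<rho> * fst p - x0) has_derivative (\<lambda>h. snd h + \<rho> * fst h)) (at (s, x))"
      by (auto intro!: derivative_eq_intros)
    have G: "((\<lambda>p::real \<times> real. bump (snd p + \<rho> * fst p - x0)) has_derivative (\<lambda>h. (snd h + \<rho> * fst h) * bump' ?z)) (at (s, x))"
      by (rule DERIV_compose_FDERIV[OF _ z]) (simp add: bump_deriv)
    have E: "((\<lambda>p::real \<times> real. \<delta> * exp (\<mu> * fst p)) has_derivative (\<lambda>h. \<delta> * exp (\<mu> * s) * (\<mu> * fst h))) (at (s, x))"
      by (auto intro!: derivative_eq_intros)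
    show "((\<lambda>p. bump_U (fst p) (snd p)) has_derivative (\<lambda>p. bump_Us s x * fst p + bump_Ux s x * snd p)) (at (s, x))"
      unfolding bump_U_def bump_Us_def bump_Ux_def
      by (rule has_derivative_eq_rhs[OF has_derivative_mult[OF E G]]) (auto simp: algebra_simps)
    have zx: "((\<lambda>x. x + \<rho> * s - x0) has_real_derivative 1) (at x)" by (auto intro!: derivative_eq_intros)
    show "(bump_Ux s has_real_derivative bump_Uxx s x) (at x)"
      unfolding bump_Ux_def[abs_def] bump_Uxx_def
      by (rule DERIV_cong[OF DERIV_cmult[OF DERIV_chain2[OF bump'_deriv zx]]]) simp
    show "continuous_on UNIV (bump_Uxx s)"
      unfolding bump_Uxx_def[abs_def]
      by (intro continuous_intros continuous_on_compose2[OF continuous_bump(3)]) auto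
    show "\<bar>bump_U s x\<bar> \<le> \<delta> * B" unfolding bump_U_def
      using b(1)[of ?z] B_nonneg prod by (intro scale s) (unfold B_def, linarith)
    show "\<bar>bump_Ux s x\<bar> \<le> \<delta> * B" unfolding bump_Ux_def
      using b(2)[of ?z] B_nonneg prod by (intro scale s) (unfold B_def, linarith)
    show "\<bar>bump_Uxx s x\<bar> \<le> \<delta> * B" unfolding bump_Uxx_def
      using b(3)[of ?z] B_nonneg prod by (intro scale s) (unfold B_def, linarith)
    have "\<bar>\<mu> * bump ?z\<bar> \<le> \<bar>\<mu>\<bar> * B0" "\<bar>\<rho> * bump' ?z\<bar> \<le> \<rho> * B1"
      using b(1,2)[of ?z] \<rho> by (auto simp: abs_mult intro!: mult_left_mono)
    then have "\<bar>\<mu> * bump ?z + \<rho> * bump' ?z\<bar> \<le> B"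
      unfolding B_def using B_nonneg by linarith
    then show "\<bar>bump_Us s x\<bar> \<le> \<delta> * B" unfolding bump_Us_def by (intro scale s)
  next
    show "jointly_borel bump_U"
      "jointly_borel bump_Us"
      "jointly_borel bump_Uxx"
      unfolding bump_U_def bump_Us_def bump_Uxx_def split_beta' by measurable
  qed
qed

lemma bump_U_range: "0 \<le> s \<Longrightarrow> 0 \<le> bump_U s x" "0 \<le> s \<Longrightarrow> bump_U s x \<le> \<delta> * exp (\<rho> / a)"
proof -
  assume s: "0 \<le> s"
  show "0 \<le> bump_U s x" unfolding bump_U_def using \<delta> bump_nonneg by simp
  have "\<mu> * s \<le> 0" using \<mu> s by (simp add: mult_nonpos_nonneg)
  then have "bump_U s x \<le> \<delta> * 1 * exp (\<rho> / a)"
    unfolding bump_U_def using \<delta> bump_nonneg by (intro mult_mono bump_le) auto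
  then show "bump_U s x \<le> \<delta> * exp (\<rho> / a)" by simp
qed

text \<open>By the choice of the tilt only 8 a^2 hump^4 + hump'' / 2 survives, with a minus sign;
  the 8 a^2 in \<mu> is half of the 16 a^2 in the lower bound for \<open>hump''\<close>.\<close>

lemma bump_subsolution:
  assumes "\<mu> = \<beta> - \<rho>\<^sup>2 / 2 - \<eta> - 8 * a\<^sup>2"
  shows "bump_Us s x - bump_Uxx s x / 2 + (- \<beta> + \<eta>) * bump_U s x \<le> 0"
proof -
  define z where "z = x + \<rho> * s - x0"
  have "bump_Us s x - bump_Uxx s x / 2 + (- \<beta> + \<eta>) * bump_U s x
     = \<delta> * exp (\<mu> * s) * (\<mu> * bump z + \<rho> * bump' z - bump'' z / 2 + (- \<beta> + \<eta>) * bump z)"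
    unfolding bump_Us_def bump_Uxx_def bump_U_def z_def[symmetric] by (simp add: algebra_simps)
  also have "\<mu> * bump z + \<rho> * bump' z - bump'' z / 2 + (- \<beta> + \<eta>) * bump z
     = exp (\<rho> * z) * (- (8 * a\<^sup>2 * hump z ^ 4 + hump'' z / 2))"
    unfolding assms bump_def bump'_def bump''_def
    by (simp add: algebra_simps power2_eq_square add_divide_distrib)
  also have "\<delta> * exp (\<mu> * s) * \<dots> \<le> 0"
    using \<delta> hump''_ge[of z] by (intro mult_nonneg_nonpos) auto
  finally show ?thesis .
qed

end

theorem (in branching) ex_mild_solution_above_bump:
  assumes \<rho>: "0 < \<rho>" and a: "0 < a" and \<eta>: "0 < \<eta>" and rate: "\<mu> = \<beta> - \<rho>\<^sup>2 / 2 - \<eta> - 8 * a\<^sup>2" "\<mu> \<le> 0"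
  obtains \<delta> where "0 < \<delta>"
    "\<And>t. 0 \<le> t \<Longrightarrow> \<exists>g v C. mild_solution g v C \<and> (\<forall>x. 0 \<le> g x \<and> g x \<le> C)
      \<and> (\<forall>x < \<rho> * t - 1 / a. g x = 0) \<and> \<delta> * exp (\<mu> * t) \<le> v t 0"
proof -
  obtain \<epsilon> where \<epsilon>: "0 < \<epsilon>" "\<And>u. 0 \<le> u \<Longrightarrow> u \<le> \<epsilon> \<Longrightarrow> \<psi> u \<le> (- \<beta> + \<eta>) * u"
    using psi_le_linear_near_0[OF \<eta>] by blast
  \<comment> \<open>\<open>bump\<close> is at most exp (\<rho> / a) and \<mu> <= 0, so the bump
    never exceeds \<epsilon>, the range of the linear bound on \<psi>. The choice does not depend on
    t.\<close>
  define \<delta> where "\<delta> = \<epsilon> * exp (- (\<rho> / a))"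
  have \<delta>_eq: "0 < \<delta>" "\<delta> * exp (\<rho> / a) = \<epsilon>" using \<epsilon>(1) by (auto simp: \<delta>_def exp_minus field_simps)
  show thesis
  proof (rule that[OF \<delta>_eq(1)])
    fix t :: real assume t: "0 \<le> t"
    interpret moving_bump \<rho> a \<mu> \<delta> "\<rho> * t" using \<rho> a rate \<delta>_eq by unfold_locales auto
    obtain B where B: "bounded_C12 bump_U bump_Us bump_Ux bump_Uxx B" using bump_bounded_C12 by blast
    \<comment> \<open>At least \<beta> / \<alpha>, so that \<psi>(\<Lambda>) >= 0 and the constant
      is a supersolution; at least \<epsilon>, so that it lies above the bump.\<close>
    define \<Lambda> where "\<Lambda> = max \<epsilon> (\<beta> / \<alpha>)"
    have \<Lambda>: "0 \<le> \<Lambda>" "\<epsilon> \<le> \<Lambda>" "\<beta> / \<alpha> \<le> \<Lambda>" using \<epsilon> by (auto simp: \<Lambda>_def)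
    have U: "0 \<le> bump_U s x" "bump_U s x \<le> \<epsilon>" if "0 \<le> s" for s x
      using bump_U_range[OF that, of x] unfolding \<delta>_eq(2) by auto
    have sub: "bump_Us s x - bump_Uxx s x / 2 + \<psi> (bump_U s x) \<le> 0" if "0 \<le> s" for s x
      using bump_subsolution[OF rate(1), of s x] \<epsilon>(2)[OF U(1)[OF that, of x] U(2)[OF that, of x]] by linarith
    have "\<beta> \<le> \<alpha> * \<Lambda>" using \<Lambda>(3) \<alpha>_pos by (simp add: field_simps)
    then have "0 \<le> \<Lambda> * (\<alpha> * \<Lambda> - \<beta>)" using \<Lambda> by simp
    then have super: "0 \<le> 0 - 0 / 2 + \<psi> \<Lambda>"
      using psi_ge_logistic[OF \<Lambda>(1)] by (simp add: algebra_simps power2_eq_square)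
    have g_meas: "bump_U 0 \<in> borel_measurable borel"
    proof -
      interpret bounded_C12 bump_U bump_Us bump_Ux bump_Uxx B by fact
      show ?thesis by measurable
    qed
    have U\<Lambda>: "bump_U s x \<le> \<Lambda>" if "0 \<le> s" for s x using U(2)[OF that, of x] \<Lambda>(2) by linarith
    obtain v where v: "mild_solution (bump_U 0) v \<Lambda>" "\<And>s y. 0 \<le> s \<Longrightarrow> bump_U s y \<le> v s y"
      by (rule ex_mild_solution_between_classical[OF B bounded_C12_const[of \<Lambda>] \<Lambda>(1) U(1) U\<Lambda> order_refl sub
            super g_meas order_refl U\<Lambda>[OF order_refl]]) (assumption+, rule that)
    have "bump_U t 0 = \<delta> * exp (\<mu> * t)"
      by (simp add: bump_U_def bump_def hump_def)
    with v(2)[OF t, of 0] have vt: "\<delta> * exp (\<mu> * t) \<le> v t 0" by simp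
    have g0: "bump_U 0 x = 0" if "x < \<rho> * t - 1 / a" for x
      unfolding bump_U_def using that a by (subst bump_outside(1)) auto
    show "\<exists>g v C. mild_solution g v C \<and> (\<forall>x. 0 \<le> g x \<and> g x \<le> C)
      \<and> (\<forall>x < \<rho> * t - 1 / a. g x = 0) \<and> \<delta> * exp (\<mu> * t) \<le> v t 0"
      using U(1)[of 0] U\<Lambda>[of 0] g0 v(1) vt
      by (intro exI[of _ "bump_U 0"] exI[of _ v] exI[of _ \<Lambda>]) (auto simp only: order_refl)
  qed
qed

section \<open>From all times to dyadic times; measurability of the radius event\<close>

text \<open>Positivity at s persists on a small interval to the right of s, which every sufficiently
  fine grid meets.\<close>

lemma right_continuous_pos_iff_dyadic:
  fixes F :: "real \<Rightarrow> real"
  assumes rc: "\<And>s. 0 \<le> s \<Longrightarrow> (F \<longlongrightarrow> F s) (at_right s)" and t: "0 < t"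
  shows "(\<exists>s\<in>{0..t}. 0 < F s) \<longleftrightarrow> (\<exists>N. \<exists>i\<le>(2::nat) ^ N. 0 < F (real i * (t / 2 ^ N)))"
proof
  assume "\<exists>N. \<exists>i\<le>(2::nat) ^ N. 0 < F (real i * (t / 2 ^ N))"
  then obtain N i where i: "i \<le> (2::nat) ^ N" "0 < F (real i * (t / 2 ^ N))" by blast
  have "real i \<le> 2 ^ N" using i(1) by (metis of_nat_le_iff of_nat_numeral of_nat_power)
  then have "real i * (t / 2 ^ N) \<le> 2 ^ N * (t / 2 ^ N)" using t by (intro mult_right_mono) auto
  then have "real i * (t / 2 ^ N) \<in> {0..t}" using t by simp
  with i(2) show "\<exists>s\<in>{0..t}. 0 < F s" by blast
next
  assume "\<exists>s\<in>{0..t}. 0 < F s"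
  then obtain s where s: "0 \<le> s" "s \<le> t" "0 < F s" by auto
  show "\<exists>N. \<exists>i\<le>(2::nat) ^ N. 0 < F (real i * (t / 2 ^ N))"
  proof (cases "s = t")
    case True
    \<comment> \<open>At s = t no room is left on the right, but t itself is a grid point, already
      for N = 0 and i = 1.\<close>
    then show ?thesis using s by (intro exI[of _ 0] exI[of _ 1]) auto
  next
    case False
    with s have st: "s < t" by simp
    have "\<forall>\<^sub>F y in at_right s. 0 < F y"
      using rc[OF s(1)] s(3) by (rule order_tendstoD(1))
    then obtain b where b: "s < b" "\<And>y. s < y \<Longrightarrow> y < b \<Longrightarrow> 0 < F y"
      unfolding eventually_at_right[OF st] by blast
    define d where "d = min b t - s"
    have d: "0 < d" using b st by (simp add: d_def)
    obtain N where N: "t / d < 2 ^ N" using real_arch_pow[of 2 "t / d"] by auto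
    define h where "h = t / 2 ^ N"
    have h: "0 < h" "h < d" using t d N by (auto simp: h_def field_simps)
    \<comment> \<open>The first grid point strictly after s; it exceeds s by at most h < d and so
      stays below both b and t.\<close>
    define i where "i = nat \<lfloor>s / h\<rfloor> + 1"
    have fl: "real (nat \<lfloor>s / h\<rfloor>) \<le> s / h" "s / h < real (nat \<lfloor>s / h\<rfloor>) + 1"
      using s(1) h(1) by (auto simp: of_nat_nat floor_le_iff)
    have ih: "s < real i * h" "real i * h \<le> s + h"
      using fl h(1) by (auto simp: i_def field_simps)
    then have lt: "real i * h < b" "real i * h < t" using h(2) by (auto simp: d_def)
    have "real i * h < 2 ^ N * h" using lt(2) by (simp add: h_def)
    then have "real i < 2 ^ N" using h(1) by simp
    then have "i \<le> (2::nat) ^ N" by (metis less_imp_le of_nat_less_iff of_nat_numeral of_nat_power)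
    moreover have "0 < F (real i * (t / 2 ^ N))" using b(2)[OF ih(1) lt(1)] by (simp add: h_def)
    ultimately show ?thesis by blast
  qed
qed

lemma integral_pos_iff_measure_pos:
  fixes f :: "'a::euclidean_space \<Rightarrow> real"
  assumes "finite_measure \<mu>" "sets \<mu> = sets borel" and f: "pos_bdd f"
  shows "0 < (\<integral>x. f x \<partial>\<mu>) \<longleftrightarrow> 0 < measure \<mu> {x. 0 < f x}"
proof -
  interpret finite_measure \<mu> by fact
  have sp: "space \<mu> = UNIV" using sets_eq_imp_space_eq[OF assms(2)] by simp
  have [measurable]: "f \<in> borel_measurable \<mu>" using f assms(2) by (simp add: pos_bdd_def cong: measurable_cong_sets)
  obtain C where C: "\<And>x. \<bar>f x\<bar> \<le> C" using f unfolding pos_bdd_def bounded_iff by (metis rangeI real_norm_def)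
  have f0: "0 \<le> f x" for x using f by (simp add: pos_bdd_def)
  have int: "integrable \<mu> f" using C by (intro integrable_const_bound[where B = C]) auto
  have S: "{x. 0 < f x} \<in> sets \<mu>" using assms(2) f by (simp add: pos_bdd_def)
  have "(\<integral>x. f x \<partial>\<mu>) = 0 \<longleftrightarrow> (AE x in \<mu>. f x = 0)"
    using f0 by (intro integral_nonneg_eq_0_iff_AE int) auto
  also have "\<dots> \<longleftrightarrow> (AE x in \<mu>. x \<notin> {x. 0 < f x})"
    using f0 by (intro AE_cong) (auto simp: less_le)
  also have "\<dots> \<longleftrightarrow> measure \<mu> {x. 0 < f x} = 0"
    using S by (simp add: AE_iff_null null_sets_def sp emeasure_eq_measure)
  finally show ?thesis
    using Bochner_Integration.integral_nonneg[of \<mu> f] f0 measure_nonneg[of \<mu> "{x. 0 < f x}"] by (auto simp: less_le)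
qed

lemma pos_bdd_clip:
  fixes h :: "'a::euclidean_space \<Rightarrow> real"
  assumes "h \<in> borel_measurable borel"
  shows "pos_bdd (\<lambda>x. min 1 (max 0 (h x)))"
  unfolding pos_bdd_def bounded_iff using assms by (auto intro!: exI[of _ 1])

locale super_brownian = branching +
  fixes M :: "'w measure" and X :: "real \<Rightarrow> 'w \<Rightarrow> 'a::euclidean_space measure"
  assumes super_BM: "super_BM M X \<beta> \<alpha> n"
begin

sublocale prob_space M using super_BM by (simp add: super_BM_def)

lemma sets_X: "0 \<le> s \<Longrightarrow> sets (X s \<omega>) = sets borel"
  and finite_X: "0 \<le> s \<Longrightarrow> finite_measure (X s \<omega>)"
  and X_0: "\<omega> \<in> space M \<Longrightarrow> X 0 \<omega> = return borel 0"
  and X_measurable: "0 \<le> s \<Longrightarrow> pos_bdd f \<Longrightarrow> (\<lambda>\<omega>. \<integral>x. f x \<partial>(X s \<omega>)) \<in> borel_measurable M"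
  using super_BM by (auto simp: super_BM_def)

lemma X_right_continuous:
  fixes f :: "'a \<Rightarrow> real"
  assumes "\<omega> \<in> space M" "0 \<le> t" "continuous_on UNIV f" "bounded (range f)"
  shows "((\<lambda>s. \<integral>x. f x \<partial>(X s \<omega>)) \<longlongrightarrow> (\<integral>x. f x \<partial>(X t \<omega>))) (at_right t)"
  using super_BM assms unfolding super_BM_def by blast

lemma markov:
  fixes k :: nat
  assumes "0 \<le> s" "0 \<le> t" "pos_bdd g" "sbm_sol \<beta> \<alpha> n g v" "\<forall>i<k. 0 \<le> r i \<and> r i \<le> s \<and> pos_bdd (h i)"
  shows "(\<integral>\<omega>. exp (- (\<Sum>i<k. \<integral>x. h i x \<partial>(X (r i) \<omega>))) * exp (- (\<integral>x. g x \<partial>(X (s + t) \<omega>))) \<partial>M)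
    = (\<integral>\<omega>. exp (- (\<Sum>i<k. \<integral>x. h i x \<partial>(X (r i) \<omega>))) * exp (- (\<integral>x. v t x \<partial>(X s \<omega>))) \<partial>M)"
  using super_BM assms unfolding super_BM_def by blast

lemma integrable_X:
  assumes "0 \<le> s" "f \<in> borel_measurable borel" "\<And>x. \<bar>f x\<bar> \<le> C"
  shows "integrable (X s \<omega>) (f :: 'a \<Rightarrow> real)"
proof -
  interpret finite_measure "X s \<omega>" using finite_X assms by simp
  show ?thesis using assms sets_X[OF assms(1), of \<omega>]
    by (intro integrable_const_bound[where B = C]) (auto cong: measurable_cong_sets)
qed

text \<open>Clipping h to [0, 1] keeps the set where it is positive and gives a bounded continuous
  test function, to which the weak right continuity of X applies.\<close>

lemma mass_pos_iff_dyadic: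
  fixes h :: "'a \<Rightarrow> real"
  assumes h: "continuous_on UNIV h" and t: "0 < t" and \<omega>: "\<omega> \<in> space M"
  shows "(\<exists>s\<in>{0..t}. 0 < measure (X s \<omega>) {x. 0 < h x}) \<longleftrightarrow>
    (\<exists>N. \<exists>i\<le>(2::nat) ^ N. 0 < (\<integral>x. min 1 (max 0 (h x)) \<partial>(X (real i * (t / 2 ^ N)) \<omega>)))"
proof -
  define f where "f x = min 1 (max 0 (h x))" for x
  have f: "pos_bdd f" unfolding f_def using h by (intro pos_bdd_clip borel_measurable_continuous_onI)
  have f_cont: "continuous_on UNIV f" unfolding f_def by (intro continuous_intros h)
  have eq: "{x. 0 < h x} = {x. 0 < f x}" by (auto simp: f_def)
  have "0 < measure (X s \<omega>) {x. 0 < h x} \<longleftrightarrow> 0 < (\<integral>x. f x \<partial>(X s \<omega>))" if "s \<in> {0..t}" for s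
    unfolding eq using that f by (intro integral_pos_iff_measure_pos[symmetric] finite_X sets_X) auto
  then have "(\<exists>s\<in>{0..t}. 0 < measure (X s \<omega>) {x. 0 < h x}) \<longleftrightarrow> (\<exists>s\<in>{0..t}. 0 < (\<integral>x. f x \<partial>(X s \<omega>)))"
    by blast
  also have "\<dots> \<longleftrightarrow> (\<exists>N. \<exists>i\<le>(2::nat) ^ N. 0 < (\<integral>x. f x \<partial>(X (real i * (t / 2 ^ N)) \<omega>)))"
    using f f_cont \<omega> by (intro right_continuous_pos_iff_dyadic t X_right_continuous) (auto simp: pos_bdd_def)
  finally show ?thesis unfolding f_def .
qed

lemma mass_pos_measurable:
  fixes h :: "'a \<Rightarrow> real"
  assumes h: "continuous_on UNIV h" and t: "0 < t"
  shows "{\<omega> \<in> space M. \<exists>s\<in>{0..t}. 0 < measure (X s \<omega>) {x. 0 < h x}} \<in> sets M"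
proof -
  define Y where "Y N i \<omega> = (\<integral>x. min 1 (max 0 (h x)) \<partial>(X (real i * (t / 2 ^ N)) \<omega>))" for N i :: nat and \<omega>
  have [measurable]: "Y N i \<in> borel_measurable M" for N i
    unfolding Y_def using h t by (intro X_measurable pos_bdd_clip borel_measurable_continuous_onI) auto
  have "{\<omega> \<in> space M. \<exists>s\<in>{0..t}. 0 < measure (X s \<omega>) {x. 0 < h x}}
      = {\<omega> \<in> space M. \<exists>N. \<exists>i\<le>(2::nat) ^ N. 0 < Y N i \<omega>}"
    unfolding Y_def by (intro Collect_cong conj_cong refl) (simp only: mass_pos_iff_dyadic[OF h t])
  also have "\<dots> \<in> sets M" by measurable
  finally show ?thesis .
qed

text \<open>Measurability is available only for the charging of sets {0 < h} with h continuous. The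
  closed sets in \<open>radius\<close> are therefore traded for open complements of balls with
  rational radii, which also makes the intersection countable.\<close>

lemma radius_ge_iff:
  assumes \<omega>: "\<omega> \<in> space M" and R: "0 < R" and t: "0 \<le> t"
  shows "ereal R \<le> radius X t \<omega> \<longleftrightarrow>
    (\<forall>q::rat. 0 \<le> q \<and> of_rat q < R \<longrightarrow> (\<exists>s\<in>{0..t}. 0 < measure (X s \<omega>) {x. 0 < norm x - of_rat q}))"
proof
  assume ge: "ereal R \<le> radius X t \<omega>"
  show "\<forall>q::rat. 0 \<le> q \<and> of_rat q < R \<longrightarrow> (\<exists>s\<in>{0..t}. 0 < measure (X s \<omega>) {x. 0 < norm x - of_rat q})"
  proof (intro allI impI)
    fix q :: rat assume q: "0 \<le> q \<and> of_rat q < R"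
    define r where "r = (of_rat q + R) / 2"
    have q0: "(0::real) \<le> of_rat q" using q by simp
    have "of_rat q < r" "r < R" using q by (auto simp: r_def)
    moreover from this(1) q0 have "0 < r" by linarith
    ultimately have r: "of_rat q < r" "r < R" "0 < r" by blast+
    have "\<not> (\<forall>s\<in>{0..t}. measure (X s \<omega>) {x. norm x \<ge> r} = 0)"
    proof
      assume "\<forall>s\<in>{0..t}. measure (X s \<omega>) {x. norm x \<ge> r} = 0"
      then have "radius X t \<omega> \<le> ereal r"
        unfolding radius_def using r by (intro Inf_lower) blast
      with ge have "ereal R \<le> ereal r" by (rule order_trans)
      with r show False by simp
    qed
    then obtain s where s: "s \<in> {0..t}" "measure (X s \<omega>) {x. norm x \<ge> r} \<noteq> 0" by blast
    interpret finite_measure "X s \<omega>" using s finite_X by auto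
    have "measure (X s \<omega>) {x. norm x \<ge> r} \<le> measure (X s \<omega>) {x. 0 < norm x - of_rat q}"
      using r s sets_X[of s \<omega>] by (intro finite_measure_mono) auto
    moreover have "0 < measure (X s \<omega>) {x. norm x \<ge> r}" using s(2) by (simp add: zero_less_measure_iff)
    ultimately have "0 < measure (X s \<omega>) {x. 0 < norm x - of_rat q}" by linarith
    with s(1) show "\<exists>s\<in>{0..t}. 0 < measure (X s \<omega>) {x. 0 < norm x - of_rat q}" by blast
  qed
next
  assume A: "\<forall>q::rat. 0 \<le> q \<and> of_rat q < R \<longrightarrow> (\<exists>s\<in>{0..t}. 0 < measure (X s \<omega>) {x. 0 < norm x - of_rat q})"
  show "ereal R \<le> radius X t \<omega>"
    unfolding radius_def
  proof (rule Inf_greatest, clarify)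
    fix r :: real assume r: "0 < r" "\<forall>s\<in>{0..t}. measure (X s \<omega>) {x. norm x \<ge> r} = 0"
    show "ereal R \<le> ereal r"
    proof (rule ccontr)
      assume "\<not> ereal R \<le> ereal r"
      then obtain q where q: "r < of_rat q" "of_rat q < R" using of_rat_dense[of r R] by auto
      then have "0 \<le> q" using r by (metis less_eq_real_def less_trans of_rat_less_0_iff not_less)
      with A q obtain s where s: "s \<in> {0..t}" "0 < measure (X s \<omega>) {x. 0 < norm x - of_rat q}" by blast
      interpret finite_measure "X s \<omega>" using s finite_X by auto
      have "measure (X s \<omega>) {x. 0 < norm x - of_rat q} \<le> measure (X s \<omega>) {x. norm x \<ge> r}"
        using q s sets_X[of s \<omega>] by (intro finite_measure_mono) auto
      with s r show False by auto
    qed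
  qed
qed

definition radius_ge :: "real \<Rightarrow> real \<Rightarrow> 'w set" where
  "radius_ge R t = {\<omega> \<in> space M. ereal R \<le> radius X t \<omega>}"

lemma radius_measurable:
  assumes "0 < R" "0 < t"
  shows "radius_ge R t \<in> sets M"
proof -
  have [measurable]: "Measurable.pred M (\<lambda>\<omega>. \<exists>s\<in>{0..t}. 0 < measure (X s \<omega>) {x. 0 < norm x - of_rat q})" for q :: rat
    unfolding pred_def using assms by (intro mass_pos_measurable continuous_intros)
  have "radius_ge R t = {\<omega> \<in> space M. \<forall>q::rat. 0 \<le> q \<and> of_rat q < R \<longrightarrow>
      (\<exists>s\<in>{0..t}. 0 < measure (X s \<omega>) {x. 0 < norm x - of_rat q})}"
    unfolding radius_ge_def using radius_ge_iff assms by auto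
  also have "\<dots> \<in> sets M" by measurable
  finally show ?thesis .
qed

section \<open>Probability estimate from a single Laplace functional\<close>

lemma integral_X_0:
  fixes f :: "'a \<Rightarrow> real"
  assumes "\<omega> \<in> space M" "f \<in> borel_measurable borel"
  shows "(\<integral>x. f x \<partial>(X 0 \<omega>)) = f 0"
  unfolding X_0[OF assms(1)] using assms by (intro integral_return) auto

lemma pos_bdd_inner:
  fixes e :: 'a
  assumes [measurable]: "g \<in> borel_measurable borel" and "\<And>y. 0 \<le> g y" "\<And>y. g y \<le> C"
  shows "pos_bdd (\<lambda>x. g (x \<bullet> e))"
  unfolding pos_bdd_def bounded_iff using assms(2,3)
  by (auto intro!: exI[of _ C] simp: abs_of_nonneg)

text \<open>If Y = X_t(g) > 0, then X_t charges x \<bullet> e >= R, hence norm x >= R. So 1 - exp (-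
  Y) is at most the indicator of the event, and its expectation is 1 - exp (- v t 0).\<close>

theorem prob_radius_ge:
  fixes e :: 'a
  assumes e: "norm e = 1" and t: "0 < t" and R: "0 < R"
    and v: "mild_solution g v C"
    and g: "\<And>x. 0 \<le> g x" "\<And>x. g x \<le> C" "\<And>x. x < R \<Longrightarrow> g x = 0"
  shows "1 - exp (- v t 0) \<le> prob (radius_ge R t)"
proof -
  have sol: "sbm_sol \<beta> \<alpha> n (\<lambda>x::'a. g (x \<bullet> e)) (\<lambda>t x. v t (x \<bullet> e))"
    by (rule sbm_sol_of_mild_1d[OF e v])
  have g': "pos_bdd (\<lambda>x::'a. g (x \<bullet> e))" by (rule pos_bdd_inner[OF mild_solutionD(1)[OF v] g(1,2)])
  have [measurable]: "v t \<in> borel_measurable borel" using v by (rule mild_solutionD)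
  have vt: "(\<lambda>x::'a. v t (x \<bullet> e)) \<in> borel_measurable borel" by measurable
  define Y where "Y \<omega> = (\<integral>x. g (x \<bullet> e) \<partial>(X t \<omega>))" for \<omega>
  have Y_meas[measurable]: "Y \<in> borel_measurable M" unfolding Y_def using t g' by (intro X_measurable) auto
  have Y0: "0 \<le> Y \<omega>" for \<omega> unfolding Y_def using g(1) by (intro Bochner_Integration.integral_nonneg) auto
  have "(\<integral>\<omega>. exp (- Y \<omega>) \<partial>M) = (\<integral>\<omega>. exp (- (\<integral>x. v t (x \<bullet> e) \<partial>(X 0 \<omega>))) \<partial>M)"
    \<comment> \<open>The Markov identity with s = 0 and an empty sum (k = 0) is the one-time
      Laplace functional.\<close>
    using markov[of 0 t "\<lambda>x::'a. g (x \<bullet> e)" "\<lambda>t x. v t (x \<bullet> e)" 0 "\<lambda>_. 0" "\<lambda>_ _. 0"] t g' sol by (simp add: Y_def)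
  also have "\<dots> = (\<integral>\<omega>. exp (- v t 0) \<partial>M)"
    by (intro Bochner_Integration.integral_cong) (auto simp: integral_X_0[OF _ vt])
  also have "\<dots> = exp (- v t 0)" by (simp add: prob_space)
  finally have L: "(\<integral>\<omega>. exp (- Y \<omega>) \<partial>M) = exp (- v t 0)" .
  let ?A = "radius_ge R t"
  have A: "?A \<in> sets M" by (rule radius_measurable[OF R t])
  have sub: "\<omega> \<in> ?A" if \<omega>: "\<omega> \<in> space M" "0 < Y \<omega>" for \<omega>
  proof -
    interpret finite_measure "X t \<omega>" using t finite_X by simp
    have pos: "0 < measure (X t \<omega>) {x. 0 < g (x \<bullet> e)}"
      using \<omega>(2) integral_pos_iff_measure_pos[OF finite_X sets_X g', of t \<omega>] t by (simp add: Y_def)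
    have "ereal R \<le> radius X t \<omega>"
      unfolding radius_def
    proof (rule Inf_greatest, clarify)
      fix r :: real assume r: "0 < r" "\<forall>s\<in>{0..t}. measure (X s \<omega>) {x. norm x \<ge> r} = 0"
      show "ereal R \<le> ereal r"
      proof (rule ccontr)
        assume "\<not> ereal R \<le> ereal r"
        then have rR: "r < R" by simp
        have "{x. 0 < g (x \<bullet> e)} \<subseteq> {x. norm x \<ge> r}"
        proof clarify
          fix x :: 'a assume "0 < g (x \<bullet> e)"
          then have "R \<le> x \<bullet> e" using g(3)[of "x \<bullet> e"] by (cases "x \<bullet> e < R") simp_all
          also have "\<dots> \<le> norm x * norm e" by (rule norm_cauchy_schwarz)
          finally show "norm x \<ge> r" using e rR by simp
        qed
        then have "measure (X t \<omega>) {x. 0 < g (x \<bullet> e)} \<le> measure (X t \<omega>) {x. norm x \<ge> r}"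
          using t sets_X[of t \<omega>] by (intro finite_measure_mono) auto
        with pos r t show False by auto
      qed
    qed
    with \<omega>(1) show ?thesis by (simp add: radius_ge_def)
  qed
  have int: "integrable M (\<lambda>\<omega>. exp (- Y \<omega>))"
    using Y0 by (intro integrable_const_bound[where B = 1]) auto
  have "1 - exp (- v t 0) = (\<integral>\<omega>. 1 - exp (- Y \<omega>) \<partial>M)"
    using int by (simp add: L prob_space)
  also have "\<dots> \<le> (\<integral>\<omega>. indicator ?A \<omega> \<partial>M)"
  proof (rule integral_mono)
    show "integrable M (\<lambda>\<omega>. 1 - exp (- Y \<omega>))" using int by simp
    show "integrable M (\<lambda>\<omega>. indicator ?A \<omega> :: real)" using A by (simp add: less_top[symmetric])
    fix \<omega> assume "\<omega> \<in> space M"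
    then show "1 - exp (- Y \<omega>) \<le> indicator ?A \<omega>"
      using sub[of \<omega>] Y0[of \<omega>] by (cases "0 < Y \<omega>") (auto simp: indicator_def less_le)
  qed
  also have "\<dots> = prob ?A" using A by simp
  finally show ?thesis .
qed

end

section \<open>Laplace functionals on time grids and hitting of half spaces\<close>

context super_brownian
begin

text \<open>The Laplace functional of the masses at the grid times \<open>i \<tau>\<close> is computed backwards in time.
  Each added mass \<open>\<theta>\<close> beyond r is absorbed by lowering the constant in the reciprocal barrier from
  1 / (C + j \<open>\<theta>\<close>) to 1 / (C + (j + 1) \<open>\<theta>\<close>), which does not affect the bound at the origin.\<close>

lemma grid_laplace:
  fixes e :: 'a and m :: nat
  assumes e: "norm e = 1" and \<rho>: "0 < \<rho>" and r: "0 < r" and \<tau>: "0 < \<tau>" and \<theta>: "0 \<le> \<theta>"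
    and \<kappa>: "\<kappa> = \<beta> + \<rho>\<^sup>2 / 2" and K: "0 < K" "exp \<rho> / K * (16 * \<rho> + 280) \<le> \<alpha> / 2"
    and C: "C = 2 * \<beta> / \<alpha>"
    and f: "f = (\<lambda>y::real. min 1 (max 0 (y - r)))"
    and j: "j \<le> m"
  shows "\<exists>w. w \<in> borel_measurable borel \<and> (\<forall>y. 0 \<le> w y \<and> w y \<le> barrier.bar_W \<rho> r \<kappa> K (inverse (C + real j * \<theta>)) (real j * \<tau>) y) \<and>
    (\<integral>\<omega>. exp (- (\<Sum>i<Suc m. \<integral>x. \<theta> * f (x \<bullet> e) \<partial>(X (real i * \<tau>) \<omega>))) \<partial>M)
    = (\<integral>\<omega>. exp (- (\<Sum>i<Suc (m - j). \<integral>x. \<theta> * f (x \<bullet> e) \<partial>(X (real i * \<tau>) \<omega>)))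
          * exp (- (\<integral>x. w (x \<bullet> e) \<partial>(X (real (m - j) * \<tau>) \<omega>))) \<partial>M)"
  using j
proof (induction j)
  case 0
  have C0: "0 < C" unfolding C using \<alpha>_pos \<beta>_pos by simp
  interpret b: barrier \<rho> r \<kappa> K "inverse (C + real 0 * \<theta>)"
    using \<rho> \<kappa> K C0 \<beta>_pos by unfold_locales auto
  \<comment> \<open>Nothing is absorbed yet: w = 0, and all m + 1 grid masses are in the
    sum.\<close>
  show ?case using b.bar_W_pos by (intro exI[of _ "\<lambda>_. 0"]) (auto intro: less_imp_le)
next
  let ?S = "\<lambda>k \<omega>. \<Sum>i<Suc k. \<integral>x. \<theta> * f (x \<bullet> e) \<partial>(X (real i * \<tau>) \<omega>)"
  case (Suc j)
  have C0: "0 < C" unfolding C using \<alpha>_pos \<beta>_pos by simp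
  have Cj: "0 < C + real j * \<theta>" "0 < C + real (Suc j) * \<theta>" using C0 \<theta> by (auto intro: add_pos_nonneg)
  interpret b: barrier \<rho> r \<kappa> K "inverse (C + real j * \<theta>)"
    using \<rho> \<kappa> K Cj \<beta>_pos by unfold_locales auto
  interpret b': barrier \<rho> r \<kappa> K "inverse (C + real (Suc j) * \<theta>)"
    using \<rho> \<kappa> K Cj \<beta>_pos by unfold_locales auto
  from Suc obtain w where w: "w \<in> borel_measurable borel" "\<And>y. 0 \<le> w y" "\<And>y. w y \<le> b.bar_W (real j * \<tau>) y"
    and L: "(\<integral>\<omega>. exp (- ?S m \<omega>) \<partial>M)
    = (\<integral>\<omega>. exp (- ?S (m - j) \<omega>)
          * exp (- (\<integral>x. w (x \<bullet> e) \<partial>(X (real (m - j) * \<tau>) \<omega>))) \<partial>M)" by auto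
  have [measurable]: "w \<in> borel_measurable borel" by fact
  have f_meas[measurable]: "f \<in> borel_measurable borel" unfolding f by measurable
  have f01: "0 \<le> f y" "f y \<le> 1" for y by (auto simp: f)
  \<comment> \<open>The mass at the latest remaining grid time, together with everything absorbed
    later, is the initial datum for one further step \<tau>.\<close>
  define g where "g y = \<theta> * f y + w y" for y
  have g_meas: "g \<in> borel_measurable borel" unfolding g_def by measurable
  have g0: "0 \<le> g y" for y using f01 w(2) \<theta> by (simp add: g_def)
  have w_le: "w y \<le> C + real j * \<theta>" for y
    using w(3)[of y] b.bar_W_le[of "real j * \<tau>" y] by simp
  \<comment> \<open>Beyond r the plateau rises by \<theta>, which covers \<theta> f because f <= 1.
    Before r the function f vanishes, and a smaller constant only raises the barrier.\<close>
  have g_le: "g y \<le> b'.bar_W (real j * \<tau>) y" for y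
  proof (cases "r \<le> y")
    case True
    have "\<theta> * f y \<le> \<theta> * 1" using f01 \<theta> by (intro mult_left_mono) auto
    then have "g y \<le> C + real (Suc j) * \<theta>" unfolding g_def using w_le[of y] by (simp add: algebra_simps)
    then show ?thesis using b'.bar_W_eq_inverse[OF True] by simp
  next
    case False
    then have "g y = w y" by (simp add: g_def f)
    also have "\<dots> \<le> b.bar_W (real j * \<tau>) y" by (rule w(3))
    also have "\<dots> \<le> b'.bar_W (real j * \<tau>) y"
      unfolding b.bar_W_def b'.bar_W_def b.bar_q_def b'.bar_q_def b.bar_E_def b'.bar_E_def
    proof (rule le_imp_inverse_le)
      show "0 < inverse (C + real (Suc j) * \<theta>) + exp (\<rho> * (r - y) - \<kappa> * (real j * \<tau>)) / K * ramp (r - y)"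
        using Cj K ramp_nonneg[of "r - y"] by (intro add_pos_nonneg mult_nonneg_nonneg) auto
      show "inverse (C + real (Suc j) * \<theta>) + exp (\<rho> * (r - y) - \<kappa> * (real j * \<tau>)) / K * ramp (r - y)
         \<le> inverse (C + real j * \<theta>) + exp (\<rho> * (r - y) - \<kappa> * (real j * \<tau>)) / K * ramp (r - y)"
        using Cj \<theta> by (intro add_right_mono le_imp_inverse_le) (auto simp: algebra_simps)
    qed
    finally show ?thesis .
  qed
  \<comment> \<open>C = 2 \<beta> / \<alpha> gives \<beta> / C = \<alpha> / 2; adding multiples of
    \<theta> to C only helps.\<close>
  have c': "\<beta> * inverse (C + real (Suc j) * \<theta>) \<le> \<alpha> / 2"
  proof -
    have "\<beta> * inverse (C + real (Suc j) * \<theta>) \<le> \<beta> * inverse C"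
      using C0 \<theta> \<beta>_pos by (intro mult_left_mono le_imp_inverse_le) auto
    also have "\<dots> = \<alpha> / 2" unfolding C using \<beta>_pos by (simp add: field_simps)
    finally show ?thesis .
  qed
  have jt: "0 \<le> real j * \<tau>" using \<tau> by simp
  obtain v D where v: "mild_solution g v D"
    "\<And>s y. 0 \<le> s \<Longrightarrow> v s y \<le> b'.bar_W (real j * \<tau> + s) y"
    by (rule ex_mild_solution_below_barrier[OF b'.barrier_axioms \<kappa> c' K(2) jt g_meas g0 g_le]) (rule that)
  have sol: "sbm_sol \<beta> \<alpha> n (\<lambda>x::'a. g (x \<bullet> e)) (\<lambda>t x. v t (x \<bullet> e))"
    by (rule sbm_sol_of_mild_1d[OF e v(1)])
  have g_pb: "pos_bdd (\<lambda>x::'a. g (x \<bullet> e))"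
  proof (rule pos_bdd_inner[OF g_meas g0])
    show "g y \<le> inverse (inverse (C + real (Suc j) * \<theta>))" for y
      using g_le[of y] b'.bar_W_le[of "real j * \<tau>" y] by linarith
  qed
  have f_pb: "pos_bdd (\<lambda>x::'a. \<theta> * f (x \<bullet> e))"
    using f01 \<theta> by (intro pos_bdd_inner[where g = "\<lambda>y. \<theta> * f y" and C = \<theta>]) (auto simp: mult_left_le)
  define q where "q = m - Suc j"
  have q: "m - j = Suc q" using Suc.prems by (simp add: q_def)
  have v\<tau>: "v \<tau> \<in> borel_measurable borel" "\<And>y. 0 \<le> v \<tau> y"
    using mild_solutionD[OF v(1)] \<tau> by auto
  have "(\<integral>\<omega>. exp (- ?S (m - j) \<omega>)
          * exp (- (\<integral>x. w (x \<bullet> e) \<partial>(X (real (m - j) * \<tau>) \<omega>))) \<partial>M)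
    = (\<integral>\<omega>. exp (- ?S q \<omega>)
          * exp (- (\<integral>x. g (x \<bullet> e) \<partial>(X (real q * \<tau> + \<tau>) \<omega>))) \<partial>M)"
  proof (rule Bochner_Integration.integral_cong[OF refl])
    fix \<omega>
    have tq: "real (Suc q) * \<tau> = real q * \<tau> + \<tau>" by (simp add: algebra_simps)
    have t0: "0 \<le> real q * \<tau> + \<tau>" using \<tau> by simp
    have "(\<integral>x. g (x \<bullet> e) \<partial>(X (real q * \<tau> + \<tau>) \<omega>))
      = (\<integral>x. \<theta> * f (x \<bullet> e) \<partial>(X (real q * \<tau> + \<tau>) \<omega>)) + (\<integral>x. w (x \<bullet> e) \<partial>(X (real q * \<tau> + \<tau>) \<omega>))"
      unfolding g_def
    proof (rule Bochner_Integration.integral_add)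
      show "integrable (X (real q * \<tau> + \<tau>) \<omega>) (\<lambda>x. \<theta> * f (x \<bullet> e))"
        using f01 \<theta> by (intro integrable_X[OF t0, where C = \<theta>]) (auto simp: abs_mult mult_left_le)
      show "integrable (X (real q * \<tau> + \<tau>) \<omega>) (\<lambda>x. w (x \<bullet> e))"
        using w(2) w_le by (intro integrable_X[OF t0, where C = "C + real j * \<theta>"]) auto
    qed
    then show "exp (- ?S (m - j) \<omega>)
          * exp (- (\<integral>x. w (x \<bullet> e) \<partial>(X (real (m - j) * \<tau>) \<omega>)))
      = exp (- ?S q \<omega>)
          * exp (- (\<integral>x. g (x \<bullet> e) \<partial>(X (real q * \<tau> + \<tau>) \<omega>)))"
      unfolding q sum.lessThan_Suc[of _ "Suc q"] tq
      by (simp only: exp_add[symmetric] minus_add_distrib add.assoc)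
  qed
  also have "\<dots> = (\<integral>\<omega>. exp (- ?S q \<omega>)
          * exp (- (\<integral>x. v \<tau> (x \<bullet> e) \<partial>(X (real q * \<tau>) \<omega>))) \<partial>M)"
    using \<tau> g_pb sol f_pb
    by (intro markov[where h = "\<lambda>_ x. \<theta> * f (x \<bullet> e)" and r = "\<lambda>i. real i * \<tau>"]) (auto intro!: mult_right_mono)
  finally have step: "(\<integral>\<omega>. exp (- ?S m \<omega>) \<partial>M)
    = (\<integral>\<omega>. exp (- ?S q \<omega>)
          * exp (- (\<integral>x. v \<tau> (x \<bullet> e) \<partial>(X (real q * \<tau>) \<omega>))) \<partial>M)"
    unfolding L .
  have "v \<tau> y \<le> b'.bar_W (real (Suc j) * \<tau>) y" for y
    using v(2)[of \<tau> y] \<tau> by (simp add: algebra_simps)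
  then show ?case
    using v\<tau> step unfolding q_def by (intro exI[of _ "v \<tau>"]) auto
qed

text \<open>exp (- k Y) decreases to the indicator of Y = 0, so a bound uniform in the weight k
  bounds the probability of positivity.\<close>

lemma laplace_tendsto_prob_pos:
  assumes Y[measurable]: "Y \<in> borel_measurable M" and Y0: "\<And>\<omega>. 0 \<le> Y \<omega>"
  shows "(\<lambda>k. 1 - (\<integral>\<omega>. exp (- (real k * Y \<omega>)) \<partial>M)) \<longlonglongrightarrow> prob {\<omega> \<in> space M. 0 < Y \<omega>}"
proof -
  have "(\<lambda>k. \<integral>\<omega>. exp (- (real k * Y \<omega>)) \<partial>M) \<longlonglongrightarrow> (\<integral>\<omega>. indicator {\<omega> \<in> space M. \<not> 0 < Y \<omega>} \<omega> \<partial>M)"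
  proof (rule integral_dominated_convergence[where w = "\<lambda>_. 1"])
    show "AE \<omega> in M. (\<lambda>k. exp (- (real k * Y \<omega>))) \<longlonglongrightarrow> indicator {\<omega> \<in> space M. \<not> 0 < Y \<omega>} \<omega>"
    proof (rule AE_I2)
      fix \<omega> assume \<omega>: "\<omega> \<in> space M"
      show "(\<lambda>k. exp (- (real k * Y \<omega>))) \<longlonglongrightarrow> indicator {\<omega> \<in> space M. \<not> 0 < Y \<omega>} \<omega>"
      proof (cases "0 < Y \<omega>")
        case True
        have "(\<lambda>k. exp (- Y \<omega>) ^ k) \<longlonglongrightarrow> 0" using True by (intro LIMSEQ_power_zero) auto
        then show ?thesis using True by (simp add: exp_of_nat_mult[symmetric])
      next
        case False
        with Y0[of \<omega>] have "Y \<omega> = 0" by simp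
        then show ?thesis using \<omega> by simp
      qed
    qed
    show "AE \<omega> in M. norm (exp (- (real k * Y \<omega>))) \<le> 1" for k using Y0 by auto
  qed auto
  then have "(\<lambda>k. 1 - (\<integral>\<omega>. exp (- (real k * Y \<omega>)) \<partial>M)) \<longlonglongrightarrow> 1 - prob {\<omega> \<in> space M. \<not> 0 < Y \<omega>}"
    by (intro tendsto_intros) simp
  also have "1 - prob {\<omega> \<in> space M. \<not> 0 < Y \<omega>} = prob {\<omega> \<in> space M. 0 < Y \<omega>}"
    by (subst prob_neg) auto
  finally show ?thesis .
qed

text \<open>The barrier at the origin is at most K exp (\<kappa> t - \<rho> r), whatever the
  constant in the reciprocal; 1 <= r puts the origin where the cut-off equals 1. The bound is thus
  uniform in the weight and in the grid, and both limits can be taken.\<close>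

theorem prob_half_space_hit_le:
  fixes e :: 'a
  assumes e: "norm e = 1" and \<rho>: "0 < \<rho>" and r: "1 \<le> r" and t: "0 < t"
    and \<kappa>: "\<kappa> = \<beta> + \<rho>\<^sup>2 / 2" and K: "0 < K" "exp \<rho> / K * (16 * \<rho> + 280) \<le> \<alpha> / 2"
  shows "prob {\<omega> \<in> space M. \<exists>s\<in>{0..t}. 0 < measure (X s \<omega>) {x. 0 < x \<bullet> e - r}} \<le> K * exp (\<kappa> * t - \<rho> * r)"
proof -
  define D where "D = K * exp (\<kappa> * t - \<rho> * r)"
  define f where "f = (\<lambda>y::real. min 1 (max 0 (y - r)))"
  have f_meas[measurable]: "f \<in> borel_measurable borel" unfolding f_def by measurable
  have f01: "0 \<le> f y" "f y \<le> 1" for y by (auto simp: f_def)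
  define Y where "Y N i \<omega> = (\<integral>x. f (x \<bullet> e) \<partial>(X (real i * (t / 2 ^ N)) \<omega>))" for N i :: nat and \<omega>
  have Y_meas[measurable]: "Y N i \<in> borel_measurable M" for N i
    unfolding Y_def using t f01 by (intro X_measurable pos_bdd_inner[where C = 1]) auto
  have Y0: "0 \<le> Y N i \<omega>" for N i \<omega>
    unfolding Y_def using f01 by (intro Bochner_Integration.integral_nonneg) auto
  define A where "A N = {\<omega> \<in> space M. 0 < (\<Sum>i<Suc (2 ^ N). Y N i \<omega>)}" for N
  have A_meas: "A N \<in> sets M" for N unfolding A_def by measurable
  have A_iff: "\<omega> \<in> A N \<longleftrightarrow> \<omega> \<in> space M \<and> (\<exists>i\<le>(2::nat) ^ N. 0 < Y N i \<omega>)" for N \<omega>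
  proof -
    have eq: "(\<Sum>i<Suc (2 ^ N). Y N i \<omega>) = 0 \<longleftrightarrow> (\<forall>i\<in>{..2 ^ N}. Y N i \<omega> = 0)"
      unfolding lessThan_Suc_atMost using Y0 by (intro sum_nonneg_eq_0_iff) auto
    have "0 \<le> (\<Sum>i<Suc (2 ^ N). Y N i \<omega>)" using Y0 by (intro sum_nonneg)
    then have pos: "0 < (\<Sum>i<Suc (2 ^ N). Y N i \<omega>) \<longleftrightarrow> (\<Sum>i<Suc (2 ^ N). Y N i \<omega>) \<noteq> 0" by linarith
    have "Y N i \<omega> = 0 \<longleftrightarrow> \<not> 0 < Y N i \<omega>" for i using Y0[of N i \<omega>] by linarith
    then show ?thesis unfolding A_def mem_Collect_eq pos eq by (simp only: Ball_def atMost_iff) blast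
  qed
  have A_le: "prob (A N) \<le> D" for N
  proof (rule LIMSEQ_le_const2)
    show "(\<lambda>k. 1 - (\<integral>\<omega>. exp (- (real k * (\<Sum>i<Suc (2 ^ N). Y N i \<omega>))) \<partial>M)) \<longlonglongrightarrow> prob (A N)"
      unfolding A_def using Y0 by (intro laplace_tendsto_prob_pos sum_nonneg) auto
    have "1 - (\<integral>\<omega>. exp (- (real k * (\<Sum>i<Suc (2 ^ N). Y N i \<omega>))) \<partial>M) \<le> D" for k
    proof -
      define \<theta> where "\<theta> = real k"
      define C where "C = 2 * \<beta> / \<alpha>"
      define \<tau> where "\<tau> = t / 2 ^ N"
      let ?m = "2 ^ N :: nat"
      have \<tau>: "0 < \<tau>" using t by (simp add: \<tau>_def)
      have r0: "0 < r" using r by simp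
      have \<theta>0: "0 \<le> \<theta>" by (simp add: \<theta>_def)
      obtain w where w: "w \<in> borel_measurable borel"
        "\<And>y. w y \<le> barrier.bar_W \<rho> r \<kappa> K (inverse (C + real ?m * \<theta>)) (real ?m * \<tau>) y"
        and L: "(\<integral>\<omega>. exp (- (\<Sum>i<Suc ?m. \<integral>x. \<theta> * f (x \<bullet> e) \<partial>(X (real i * \<tau>) \<omega>))) \<partial>M)
          = (\<integral>\<omega>. exp (- (\<Sum>i<Suc (?m - ?m). \<integral>x. \<theta> * f (x \<bullet> e) \<partial>(X (real i * \<tau>) \<omega>)))
          * exp (- (\<integral>x. w (x \<bullet> e) \<partial>(X (real (?m - ?m) * \<tau>) \<omega>))) \<partial>M)"
        using grid_laplace[OF e \<rho> r0 \<tau> \<theta>0 \<kappa> K C_def f_def order_refl, of ?m] by blast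
      have "0 < C + real ?m * \<theta>" unfolding C_def \<theta>_def using \<alpha>_pos \<beta>_pos by (intro add_pos_nonneg) auto
      then interpret b: barrier \<rho> r \<kappa> K "inverse (C + real ?m * \<theta>)"
        using \<rho> \<kappa> K \<beta>_pos by unfold_locales auto
      have mt: "real ?m * \<tau> = t" by (simp add: \<tau>_def)
      have "w 0 \<le> b.bar_W t 0" using w(2)[of 0] unfolding mt .
      also have "\<dots> \<le> D" unfolding D_def using b.bar_W_le_exp[of 0 t] r by simp
      finally have wD: "w 0 \<le> D" .
      have w_inner: "(\<lambda>x::'a. w (x \<bullet> e)) \<in> borel_measurable borel" "(\<lambda>x::'a. \<theta> * f (x \<bullet> e)) \<in> borel_measurable borel"
        using w(1) by auto
      have "(\<integral>\<omega>. exp (- (real k * (\<Sum>i<Suc ?m. Y N i \<omega>))) \<partial>M)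
         = (\<integral>\<omega>. exp (- (\<Sum>i<Suc ?m. \<integral>x. \<theta> * f (x \<bullet> e) \<partial>(X (real i * \<tau>) \<omega>))) \<partial>M)"
        unfolding Y_def \<theta>_def \<tau>_def by (simp only: integral_mult_right_zero sum_distrib_left)
      also have "\<dots> = (\<integral>\<omega>. exp (- w 0) \<partial>M)"
        unfolding L
      proof (rule Bochner_Integration.integral_cong[OF refl])
        fix \<omega> assume \<omega>: "\<omega> \<in> space M"
        \<comment> \<open>After all steps only the term i = 0 is left in the sum. It vanishes, since
          X_0 is the unit mass at 0 and f 0 = 0 by r > 0.\<close>
        show "exp (- (\<Sum>i<Suc (?m - ?m). \<integral>x. \<theta> * f (x \<bullet> e) \<partial>(X (real i * \<tau>) \<omega>)))
          * exp (- (\<integral>x. w (x \<bullet> e) \<partial>(X (real (?m - ?m) * \<tau>) \<omega>))) = exp (- w 0)"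
          using integral_X_0[OF \<omega> w_inner(1)] integral_X_0[OF \<omega> w_inner(2)] r0 by (simp add: f_def)
      qed
      also have "\<dots> = exp (- w 0)" by (simp add: prob_space)
      finally show ?thesis using exp_ge_add_one_self[of "- w 0"] wD by simp
    qed
    then show "\<exists>N'. \<forall>k\<ge>N'. 1 - (\<integral>\<omega>. exp (- (real k * (\<Sum>i<Suc (2 ^ N). Y N i \<omega>))) \<partial>M) \<le> D" by blast
  qed
  have inc: "incseq A"
  proof (rule incseq_SucI, rule subsetI)
    fix N \<omega> assume "\<omega> \<in> A N"
    then obtain i where i: "\<omega> \<in> space M" "i \<le> (2::nat) ^ N" "0 < Y N i \<omega>" by (auto simp: A_iff)
    \<comment> \<open>The grids are nested, so the events A N increase.\<close>
    have "Y (Suc N) (2 * i) \<omega> = Y N i \<omega>" unfolding Y_def by simp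
    with i show "\<omega> \<in> A (Suc N)" unfolding A_iff by (auto intro!: exI[of _ "2 * i"])
  qed
  have "{\<omega> \<in> space M. \<exists>s\<in>{0..t}. 0 < measure (X s \<omega>) {x. 0 < x \<bullet> e - r}} = (\<Union>N. A N)"
  proof (rule set_eqI)
    fix \<omega>
    have cont: "continuous_on UNIV (\<lambda>x::'a. x \<bullet> e - r)" by (intro continuous_intros)
    show "\<omega> \<in> {\<omega> \<in> space M. \<exists>s\<in>{0..t}. 0 < measure (X s \<omega>) {x. 0 < x \<bullet> e - r}} \<longleftrightarrow> \<omega> \<in> (\<Union>N. A N)"
    proof (cases "\<omega> \<in> space M")
      case True
      show ?thesis
        using mass_pos_iff_dyadic[OF cont t True] True by (simp only: mem_Collect_eq UN_iff A_iff Y_def f_def) blast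
    qed (simp add: A_iff)
  qed
  moreover have "(\<lambda>N. prob (A N)) \<longlonglongrightarrow> prob (\<Union>N. A N)"
    using A_meas inc by (intro finite_Lim_measure_incseq) auto
  then have "prob (\<Union>N. A N) \<le> D"
    using A_le by (intro LIMSEQ_le_const2) auto
  ultimately show ?thesis unfolding D_def by simp
qed

section \<open>From half spaces to balls, and the exponential rate\<close>

text \<open>Compactness of the sphere. The closer c is to 1, the less distance is lost when a point
  is tested in the best of the chosen directions.\<close>

lemma finite_directions:
  assumes "c < 1"
  obtains F :: "'a set" where "finite F" "\<And>e. e \<in> F \<Longrightarrow> norm e = 1"
    "\<And>x. norm x = 1 \<Longrightarrow> \<exists>e\<in>F. c < x \<bullet> e"
proof -
  have "compact (sphere (0::'a) 1)" by simp
  moreover have "open {x::'a. c < x \<bullet> e}" for e by (intro open_Collect_less continuous_intros)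
  moreover have "sphere (0::'a) 1 \<subseteq> (\<Union>e\<in>sphere 0 1. {x. c < x \<bullet> e})"
    using assms by (auto simp: power2_norm_eq_inner[symmetric] intro!: bexI)
  ultimately obtain F where F: "F \<subseteq> sphere (0::'a) 1" "finite F" "sphere (0::'a) 1 \<subseteq> (\<Union>e\<in>F. {x. c < x \<bullet> e})"
    by (rule compactE_image)
  show thesis by (rule that[of F]) (use F in auto)
qed

text \<open>The finite cover by half spaces costs a factor arbitrarily close to 1 in the radius,
  paid for by the gap between \<rho> and \<rho>'. The condition on t is 1 <= r for r = \<rho>
  t.\<close>

theorem prob_radius_le:
  assumes \<rho>: "0 < \<rho>" "\<rho> < \<rho>'"
  obtains D where "0 < D"
    "\<And>t. 1 \<le> \<rho> * t \<Longrightarrow> prob (radius_ge (\<rho>' * t) t) \<le> D * exp ((\<beta> - \<rho>\<^sup>2 / 2) * t)"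
proof -
  \<comment> \<open>Strictly below \<rho>', so that the infimum in \<open>radius\<close> yields mass
    beyond \<rho>'' t; strictly above \<rho>, so that \<rho> / \<rho>'' < 1 is an admissible cap
    parameter.\<close>
  define \<rho>'' where "\<rho>'' = (\<rho> + \<rho>') / 2"
  have \<rho>'': "\<rho> < \<rho>''" "\<rho>'' < \<rho>'" "0 < \<rho>''" using \<rho> by (auto simp: \<rho>''_def)
  have "\<rho> / \<rho>'' < 1" using \<rho>'' by simp
  then obtain F :: "'a set" where F: "finite F" "\<And>e. e \<in> F \<Longrightarrow> norm e = 1" "\<And>x. norm x = 1 \<Longrightarrow> \<exists>e\<in>F. \<rho> / \<rho>'' < x \<bullet> e"
    by (rule finite_directions) blast
  \<comment> \<open>Makes the smallness condition on K an equality.\<close>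
  define K where "K = 2 * exp \<rho> * (16 * \<rho> + 280) / \<alpha>"
  have K: "0 < K" "exp \<rho> / K * (16 * \<rho> + 280) \<le> \<alpha> / 2"
  proof -
    have p: "0 < 16 * \<rho> + 280" using \<rho> by simp
    then show "0 < K" unfolding K_def using \<alpha>_pos by (intro divide_pos_pos mult_pos_pos) auto
    have "exp \<rho> / (2 * exp \<rho> * p / \<alpha>) * p = \<alpha> / 2" if "0 < p" for p
      using that \<alpha>_pos by (simp add: field_simps)
    from this[OF p] show "exp \<rho> / K * (16 * \<rho> + 280) \<le> \<alpha> / 2" unfolding K_def by simp
  qed
  define \<kappa> where "\<kappa> = \<beta> + \<rho>\<^sup>2 / 2"
  show thesis
  proof (rule that[of "real (card F) * K + 1"])
    show "0 < real (card F) * K + 1" using K by (simp add: add_nonneg_pos)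
    fix t assume t1: "1 \<le> \<rho> * t"
    then have t: "0 < t" using \<rho> by (metis less_le_trans zero_less_mult_pos zero_less_one)
    define H where "H e = {\<omega> \<in> space M. \<exists>s\<in>{0..t}. 0 < measure (X s \<omega>) {x. 0 < x \<bullet> e - \<rho> * t}}" for e
    have H_meas: "H e \<in> sets M" for e
      unfolding H_def using t by (intro mass_pos_measurable continuous_intros)
    have "radius_ge (\<rho>' * t) t \<subseteq> (\<Union>e\<in>F. H e)"
      unfolding radius_ge_def
    proof clarify
      fix \<omega> assume \<omega>: "\<omega> \<in> space M" "ereal (\<rho>' * t) \<le> radius X t \<omega>"
      have "\<not> (\<forall>s\<in>{0..t}. measure (X s \<omega>) {x. norm x \<ge> \<rho>'' * t} = 0)"
      proof
        assume "\<forall>s\<in>{0..t}. measure (X s \<omega>) {x. norm x \<ge> \<rho>'' * t} = 0"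
        then have "radius X t \<omega> \<le> ereal (\<rho>'' * t)"
          unfolding radius_def using \<rho>'' t by (intro Inf_lower) (auto intro!: exI[of _ "\<rho>'' * t"])
        with \<omega>(2) have "ereal (\<rho>' * t) \<le> ereal (\<rho>'' * t)" by (rule order_trans)
        then show False using \<rho>'' t by simp
      qed
      then obtain s where s: "s \<in> {0..t}" "measure (X s \<omega>) {x. norm x \<ge> \<rho>'' * t} \<noteq> 0" by blast
      interpret finite_measure "X s \<omega>" using s finite_X by auto
      have sX: "sets (X s \<omega>) = sets borel" using s sets_X by simp
      have "{x. norm x \<ge> \<rho>'' * t} \<subseteq> (\<Union>e\<in>F. {x. 0 < x \<bullet> e - \<rho> * t})"
      proof clarify
        fix x :: 'a assume x: "\<rho>'' * t \<le> norm x"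
        have x0: "0 < norm x" using x \<rho>'' t by (meson less_le_trans mult_pos_pos)
        then obtain e where e: "e \<in> F" "\<rho> / \<rho>'' < (x /\<^sub>R norm x) \<bullet> e" using F(3)[of "x /\<^sub>R norm x"] by auto
        have "\<rho> * t = \<rho> / \<rho>'' * (\<rho>'' * t)" using \<rho>'' by simp
        also have "\<dots> \<le> \<rho> / \<rho>'' * norm x" using x \<rho> \<rho>'' by (intro mult_left_mono) auto
        also have "\<dots> < ((x /\<^sub>R norm x) \<bullet> e) * norm x" using e x0 by (intro mult_strict_right_mono)
        also have "\<dots> = x \<bullet> e" using x0 by simp
        finally show "x \<in> (\<Union>e\<in>F. {x. 0 < x \<bullet> e - \<rho> * t})" using e(1) by auto
      qed
      then have "measure (X s \<omega>) {x. norm x \<ge> \<rho>'' * t} \<le> measure (X s \<omega>) (\<Union>e\<in>F. {x. 0 < x \<bullet> e - \<rho> * t})"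
        using F(1) by (intro finite_measure_mono) (auto simp: sX intro!: sets.finite_UN)
      also have "\<dots> \<le> (\<Sum>e\<in>F. measure (X s \<omega>) {x. 0 < x \<bullet> e - \<rho> * t})"
        using F(1) by (intro finite_measure_subadditive_finite) (auto simp: sX)
      finally have "0 < (\<Sum>e\<in>F. measure (X s \<omega>) {x. 0 < x \<bullet> e - \<rho> * t})"
        using s(2) measure_nonneg[of "X s \<omega>" "{x. norm x \<ge> \<rho>'' * t}"] by linarith
      then obtain e where "e \<in> F" "0 < measure (X s \<omega>) {x. 0 < x \<bullet> e - \<rho> * t}"
        by (meson not_less sum_nonpos)
      then show "\<omega> \<in> (\<Union>e\<in>F. H e)" unfolding H_def using s(1) \<omega>(1) by blast
    qed
    then have "prob (radius_ge (\<rho>' * t) t) \<le> prob (\<Union>e\<in>F. H e)"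
      using F(1) H_meas by (intro finite_measure_mono sets.finite_UN) auto
    also have "\<dots> \<le> (\<Sum>e\<in>F. prob (H e))"
      using F(1) H_meas by (intro finite_measure_subadditive_finite) auto
    also have "\<dots> \<le> (\<Sum>e\<in>F. K * exp (\<kappa> * t - \<rho> * (\<rho> * t)))"
      unfolding H_def using F(2) \<rho> t1 t K by (intro sum_mono prob_half_space_hit_le) (auto simp: \<kappa>_def)
    also have "\<kappa> * t - \<rho> * (\<rho> * t) = (\<beta> - \<rho>\<^sup>2 / 2) * t" unfolding \<kappa>_def by (simp add: algebra_simps power2_eq_square)
    also have "(\<Sum>e\<in>F. K * exp ((\<beta> - \<rho>\<^sup>2 / 2) * t)) \<le> (real (card F) * K + 1) * exp ((\<beta> - \<rho>\<^sup>2 / 2) * t)"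
      by (simp add: algebra_simps)
    finally show "prob (radius_ge (\<rho>' * t) t) \<le> (real (card F) * K + 1) * exp ((\<beta> - \<rho>\<^sup>2 / 2) * t)" .
  qed
qed

text \<open>The bump travels with the larger speed \<rho>', so that for large t the left edge
  \<rho>' t - 1 / a of its initial support lies beyond \<rho> t.\<close>

theorem prob_radius_lower:
  assumes \<rho>: "0 < \<rho>" "\<rho> < \<rho>'" and \<eta>: "0 < \<eta>" and a: "0 < a"
    and rate: "\<mu> = \<beta> - \<rho>'\<^sup>2 / 2 - \<eta> - 8 * a\<^sup>2" "\<mu> \<le> 0"
  obtains D where "0 < D"
    "\<forall>\<^sub>F t in at_top. D * exp (\<mu> * t) \<le> prob (radius_ge (\<rho> * t) t)"
proof -
  obtain e :: 'a where e: "norm e = 1" using vector_choose_size[of 1] by auto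
  have \<rho>': "0 < \<rho>'" using \<rho> by simp
  obtain \<delta> where \<delta>: "0 < \<delta>"
    "\<And>t. 0 \<le> t \<Longrightarrow> \<exists>g v C. mild_solution g v C \<and> (\<forall>x. 0 \<le> g x \<and> g x \<le> C)
      \<and> (\<forall>x < \<rho>' * t - 1 / a. g x = 0) \<and> \<delta> * exp (\<mu> * t) \<le> v t 0"
    by (rule ex_mild_solution_above_bump[OF \<rho>' a \<eta> rate]) (rule that)
  \<comment> \<open>For 0 < y <= \<delta> one has 1 - exp (- y) >= y / (1 + y) >= y / (1 +
    \<delta>); applied to y = \<delta> exp (\<mu> t), which is at most \<delta> since \<mu> <=
    0.\<close>
  define \<delta>' where "\<delta>' = \<delta> / (1 + \<delta>)"
  have \<delta>': "0 < \<delta>'" using \<delta>(1) by (simp add: \<delta>'_def)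
  have "\<forall>\<^sub>F t in at_top. 1 / a / (\<rho>' - \<rho>) + 1 \<le> t" by (rule eventually_ge_at_top)
  then have "\<forall>\<^sub>F t in at_top. \<delta>' * exp (\<mu> * t) \<le> prob (radius_ge (\<rho> * t) t)"
  proof eventually_elim
    fix t :: real assume t: "1 / a / (\<rho>' - \<rho>) + 1 \<le> t"
    have "0 < 1 / a / (\<rho>' - \<rho>)" using a \<rho> by simp
    with t have t0: "0 < t" by linarith
    have "1 / a / (\<rho>' - \<rho>) \<le> t" using t by linarith
    then have "1 / a \<le> t * (\<rho>' - \<rho>)" using \<rho> by (subst (asm) pos_divide_le_eq) auto
    then have R: "\<rho> * t \<le> \<rho>' * t - 1 / a" by (simp add: algebra_simps)
    from \<delta>(2)[of t] t0 obtain g v C where gv: "mild_solution g v C" "\<And>x. 0 \<le> g x" "\<And>x. g x \<le> C"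
      "\<And>x. x < \<rho>' * t - 1 / a \<Longrightarrow> g x = 0" "\<delta> * exp (\<mu> * t) \<le> v t 0"
      by (metis less_imp_le)
    have g0: "g x = 0" if "x < \<rho> * t" for x using gv(4)[of x] R that by linarith
    have "1 - exp (- v t 0) \<le> prob (radius_ge (\<rho> * t) t)"
      by (rule prob_radius_ge[OF e t0 _ gv(1-3) g0]) (use \<rho> t0 in simp)
    moreover have "\<delta>' * exp (\<mu> * t) \<le> 1 - exp (- v t 0)"
    proof -
      define y where "y = \<delta> * exp (\<mu> * t)"
      have y: "0 < y" "y \<le> \<delta>"
        using \<delta>(1) rate(2) t0 by (auto simp: y_def mult_nonpos_nonneg)
      have "exp (- v t 0) \<le> exp (- y)" using gv(5) by (simp add: y_def)
      also have "\<dots> \<le> 1 / (1 + y)"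
        using exp_ge_add_one_self[of y] y by (simp add: exp_minus divide_inverse le_imp_inverse_le)
      finally have "y / (1 + y) \<le> 1 - exp (- v t 0)" using y by (simp add: field_simps)
      moreover have "y / (1 + \<delta>) \<le> y / (1 + y)" using y by (intro divide_left_mono) auto
      moreover have "\<delta>' * exp (\<mu> * t) = y / (1 + \<delta>)" by (simp add: \<delta>'_def y_def)
      ultimately show ?thesis by linarith
    qed
    ultimately show "\<delta>' * exp (\<mu> * t) \<le> prob (radius_ge (\<rho> * t) t)" by linarith
  qed
  with \<delta>' show thesis by (rule that)
qed

theorem ln_prob_radius_tendsto:
  assumes \<rho>: "sqrt (2 * \<beta>) < \<rho>"
  shows "((\<lambda>t. ln (prob (radius_ge (\<rho> * t) t)) / t) \<longlongrightarrow> - (\<rho>\<^sup>2 / 2 - \<beta>)) at_top"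
proof (rule order_tendstoI)
  have sq: "0 < sqrt (2 * \<beta>)" using \<beta>_pos by simp
  then have \<rho>0: "0 < \<rho>" using \<rho> by linarith
  have \<rho>2: "2 * \<beta> < \<rho>\<^sup>2"
  proof -
    have "(sqrt (2 * \<beta>))\<^sup>2 < \<rho>\<^sup>2" using \<rho> sq by (intro power_strict_mono) auto
    then show ?thesis using \<beta>_pos by simp
  qed
  let ?P = "\<lambda>t. prob (radius_ge (\<rho> * t) t)"
  have lower: "\<exists>D \<mu>. 0 < D \<and> l < \<mu> \<and> (\<forall>\<^sub>F t in at_top. D * exp (\<mu> * t) \<le> ?P t)" if l: "l < - (\<rho>\<^sup>2 / 2 - \<beta>)" for l
  proof -
    \<comment> \<open>A single small parameter h serves as excess speed, as \<eta> and as width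
      parameter a of the bump; the rate tends to \<beta> - \<rho>^2 / 2 as h decreases to 0.\<close>
    define g where "g h = \<beta> - (\<rho> + h)\<^sup>2 / 2 - h - 8 * h\<^sup>2" for h :: real
    have "(g \<longlongrightarrow> g 0) (at_right 0)" unfolding g_def[abs_def] by (intro tendsto_intros) auto
    moreover have "l < g 0" using l by (simp add: g_def)
    ultimately have "\<forall>\<^sub>F h in at_right 0. l < g h" by (rule order_tendstoD(1))
    moreover have "\<forall>\<^sub>F h in at_right (0::real). 0 < h" by (simp add: eventually_at_right_less)
    ultimately have "\<forall>\<^sub>F h in at_right 0. l < g h \<and> 0 < h" by eventually_elim simp
    then obtain h where h: "l < g h" "0 < h"
      using eventually_happens[of _ "at_right (0::real)"] by (auto simp: trivial_limit_at_right_real)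
    \<comment> \<open>Supercritical speed, \<rho>^2 > 2 \<beta>, yields the sign \<mu> <= 0 required
      by the bump.\<close>
    have "\<rho>\<^sup>2 \<le> (\<rho> + h)\<^sup>2" using h \<rho>0 by (intro power_mono) auto
    then have "g h \<le> 0" unfolding g_def using \<rho>2 h zero_le_power2[of h] by linarith
    then obtain D where "0 < D" "\<forall>\<^sub>F t in at_top. D * exp (g h * t) \<le> ?P t"
      using prob_radius_lower[of \<rho> "\<rho> + h" h h "g h"] h \<rho>0 by (auto simp: g_def)
    with h show ?thesis by blast
  qed
  \<comment> \<open>Since ln 0 = 0 here, the upper estimate of the logarithm needs the probability
    to be positive; the lower bound provides this for large t.\<close>
  have pos: "\<forall>\<^sub>F t in at_top. 0 < ?P t"
  proof -
    obtain D \<mu> where "0 < D" "\<forall>\<^sub>F t in at_top. D * exp (\<mu> * t) \<le> ?P t"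
      using lower[of "- (\<rho>\<^sup>2 / 2 - \<beta>) - 1"] by auto
    from this(2) show ?thesis
      by eventually_elim (use \<open>0 < D\<close> in \<open>metis exp_gt_zero less_le_trans mult_pos_pos\<close>)
  qed
  fix l
  {
    assume "l < - (\<rho>\<^sup>2 / 2 - \<beta>)"
    then obtain D \<mu> where D: "0 < D" "l < \<mu>" "\<forall>\<^sub>F t in at_top. D * exp (\<mu> * t) \<le> ?P t"
      using lower by blast
    have "((\<lambda>t. ln D / t + \<mu>) \<longlongrightarrow> 0 + \<mu>) at_top"
      by (intro tendsto_intros tendsto_divide_0[OF tendsto_const] filterlim_at_top_imp_at_infinity filterlim_ident)
    then have "\<forall>\<^sub>F t in at_top. l < ln D / t + \<mu>" using D(2) by (intro order_tendstoD(1)) auto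
    with D(3) eventually_gt_at_top[of 0] show "\<forall>\<^sub>F t in at_top. l < ln (?P t) / t"
    proof eventually_elim
      fix t :: real assume t: "D * exp (\<mu> * t) \<le> ?P t" "0 < t" "l < ln D / t + \<mu>"
      have "ln D + \<mu> * t = ln (D * exp (\<mu> * t))" using D(1) by (simp add: ln_mult)
      also have "\<dots> \<le> ln (?P t)" using t(1) D(1) by (subst ln_le_cancel_iff) (auto intro: less_le_trans[of _ "D * exp (\<mu> * t)"])
      finally have "(ln D + \<mu> * t) / t \<le> ln (?P t) / t" using t(2) by (intro divide_right_mono) auto
      moreover have "(ln D + \<mu> * t) / t = ln D / t + \<mu>" using t(2) by (simp add: add_divide_distrib)
      ultimately show "l < ln (?P t) / t" using t(3) by linarith
    qed
  }
  {
    assume l: "- (\<rho>\<^sup>2 / 2 - \<beta>) < l"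
    \<comment> \<open>The rate of the upper estimate at the slightly smaller speed \<rho> - h, again
      continuous at h = 0.\<close>
    define g where "g h = \<beta> - (\<rho> - h)\<^sup>2 / 2" for h :: real
    have "(g \<longlongrightarrow> g 0) (at_right 0)" unfolding g_def[abs_def] by (intro tendsto_intros) auto
    moreover have "g 0 < l" using l by (simp add: g_def)
    ultimately have "\<forall>\<^sub>F h in at_right 0. g h < l" by (rule order_tendstoD(2))
    moreover have "\<forall>\<^sub>F h in at_right 0. 0 < h \<and> h < \<rho>" using \<rho>0
      by (auto simp: eventually_at_right_field)
    ultimately have "\<forall>\<^sub>F h in at_right 0. g h < l \<and> 0 < h \<and> h < \<rho>" by eventually_elim simp
    then obtain h where h: "g h < l" "0 < h" "h < \<rho>"
      using eventually_happens[of _ "at_right (0::real)"] by (auto simp: trivial_limit_at_right_real)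
    obtain D where D: "0 < D" "\<And>t. 1 \<le> (\<rho> - h) * t \<Longrightarrow> ?P t \<le> D * exp (g h * t)"
      using prob_radius_le[of "\<rho> - h" \<rho>] h unfolding g_def by auto
    have "((\<lambda>t. ln D / t + g h) \<longlongrightarrow> 0 + g h) at_top"
      by (intro tendsto_intros tendsto_divide_0[OF tendsto_const] filterlim_at_top_imp_at_infinity filterlim_ident)
    then have "\<forall>\<^sub>F t in at_top. ln D / t + g h < l" using h(1) by (intro order_tendstoD(2)) auto
    with pos eventually_gt_at_top[of 0] eventually_ge_at_top[of "1 / (\<rho> - h)"]
    show "\<forall>\<^sub>F t in at_top. ln (?P t) / t < l"
    proof eventually_elim
      fix t :: real assume t: "0 < ?P t" "0 < t" "1 / (\<rho> - h) \<le> t" "ln D / t + g h < l"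
      have "1 \<le> (\<rho> - h) * t" using t(3) h by (simp add: field_simps)
      then have "ln (?P t) \<le> ln (D * exp (g h * t))" using D t(1) by (subst ln_le_cancel_iff) auto
      also have "\<dots> = ln D + g h * t" using D(1) by (simp add: ln_mult)
      finally have "ln (?P t) / t \<le> (ln D + g h * t) / t" using t(2) by (intro divide_right_mono) auto
      moreover have "(ln D + g h * t) / t = ln D / t + g h" using t(2) by (simp add: add_divide_distrib)
      ultimately show "ln (?P t) / t < l" using t(4) by linarith
    qed
  }
qed

end

theorem theorem1:
  fixes M :: "'w measure" and X :: "real \<Rightarrow> 'w \<Rightarrow> 'a::euclidean_space measure"
    and n :: "real measure" and \<beta> \<alpha> \<gamma> \<rho> :: real
  assumes "\<beta> > 0" and "\<alpha> > 0"
    and "sets n = sets borel" and "sigma_finite_measure n" and "emeasure n {..0} = 0"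
    and "(\<integral>\<^sup>+ y. ennreal (min (y\<^sup>2) y) \<partial>n) < \<infinity>"
    and "\<gamma> > 0" and "(\<integral>\<^sup>+ y\<in>{1..}. ennreal (y * (ln y) powr (2 + \<gamma>)) \<partial>n) < \<infinity>"
    and "super_BM M X \<beta> \<alpha> n"
    and "sqrt (2 * \<beta>) < \<rho>"
  shows "((\<lambda>t. ln (measure M {\<omega> \<in> space M. radius X t \<omega> \<ge> ereal (\<rho> * t)}) / t)
           \<longlongrightarrow> - (\<rho>\<^sup>2 / 2 - \<beta>)) at_top"
proof -
  interpret super_brownian \<beta> \<alpha> n M X
    by (intro super_brownian.intro branching.intro super_brownian_axioms.intro assms)
  show ?thesis using ln_prob_radius_tendsto[OF assms(10)] by (simp only: radius_ge_def)
qed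

end
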